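(* The coordinate ring of the commuting variety $\{(X,Y)\in\mathcal{M}_3\times\mathcal{M}_3 : XY=YX\}/\!/\mathrm{GL}_3(\mathbb{C})$ of $3\times3$ matrices is $$\mathbb{C}[a_1,a_2]\otimes\mathbb{C}[a_3,a_4,a_5,a_6,a_7,a_8,a_9]/J,$$ where $J$ is the ideal generated by $$\begin{aligned} &a_3a_9-2a_4a_8+a_5a_7,\\ &a_5a_6-2a_4a_7+a_3a_8,\\ &a_3^2a_5-a_3a_4^2+6a_6a_8-6a_7^2,\\ &a_3a_4a_5-a_4^3+3a_6a_9-3a_7a_8,\\ &a_3a_5^2-a_4^2a_5+6a_7a_9-6a_8^2. \end{aligned}$$
   Context: $\mathcal{M}_3$ is the algebra of complex $3\times3$ matrices, and $\mathrm{GL}_3(\mathbb{C})$ acts on pairs by simultaneous conjugation; the commuting variety is taken as a GIT quotient (a subvariety of $(\mathcal{M}_3\times\mathcal{M}_3)/\!/\mathrm{GL}_3$). The variables $a_i$ correspond to the invariant functions $a_1=\mathrm{Tr}(X)$, $a_2=\mathrm{Tr}(Y)$, $a_3=\mathrm{Tr}(A^2)$, $a_4=\mathrm{Tr}(AB)$, $a_5=\mathrm{Tr}(B^2)$, $a_6=\mathrm{Tr}(A^3)$, $a_7=\mathrm{Tr}(A^2B)$, $a_8=\mathrm{Tr}(AB^2)$, $a_9=\mathrm{Tr}(B^3)$, where $A=X-\frac13\mathrm{Tr}(X)I_3$ and $B=Y-\frac13\mathrm{Tr}(Y)I_3$. *)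

theory Defs
  imports
    "HOL-Analysis.Determinants"
    "HOL-Library.FuncSet"
    "HOL-Library.Poly_Mapping"
    "HOL-Algebra.Module"
    "HOL-Algebra.QuotRing"
begin

section \<open>Complex algebras\<close>

text \<open>
  A complex algebra is a HOL-Algebra \<^type>\<open>module_ext\<close> record with scalars in \<^typ>\<open>complex\<close>.
\<close>

type_synonym 'a calgebra = "(complex, 'a) module"

definition algebra_iso :: "'a calgebra \<Rightarrow> 'b calgebra \<Rightarrow> ('a \<Rightarrow> 'b) set" where
  "algebra_iso A B =
     {h \<in> ring_iso A B. \<forall>c. \<forall>x \<in> carrier A. h (c \<odot>\<^bsub>A\<^esub> x) = c \<odot>\<^bsub>B\<^esub> h x}"

text \<open>
  The scalar \<open>c\<close> maps the coset of \<open>x\<close> to the coset of \<open>c x\<close>; the union over representatives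
  is the convention by which \<^const>\<open>rcoset_mult\<close> is defined.
\<close>

definition quotient_algebra :: "'a calgebra \<Rightarrow> 'a set \<Rightarrow> 'a set calgebra" where
  "quotient_algebra A I =
     ring.extend (A Quot I) (module.fields (\<lambda>c S. \<Union>x \<in> S. I +>\<^bsub>A\<^esub> (c \<odot>\<^bsub>A\<^esub> x)))"


section \<open>Tensor products of complex algebras\<close>

definition monoid_algebra :: "'m monoid \<Rightarrow> ('m \<Rightarrow>\<^sub>0 complex) calgebra" where
  "monoid_algebra M =
     \<lparr>carrier = {f. Poly_Mapping.keys f \<subseteq> carrier M},
      mult = (\<lambda>f g. \<Sum>x \<in> Poly_Mapping.keys f. \<Sum>y \<in> Poly_Mapping.keys g.
        Poly_Mapping.single (x \<otimes>\<^bsub>M\<^esub> y) (Poly_Mapping.lookup f x * Poly_Mapping.lookup g y)),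
      one = Poly_Mapping.single \<one>\<^bsub>M\<^esub> 1,
      zero = 0,
      add = (+),
      smult = (\<lambda>c. Poly_Mapping.map ((*) c))\<rparr>"

definition tensor_relations :: "'a calgebra \<Rightarrow> 'b calgebra \<Rightarrow> ('a \<times> 'b \<Rightarrow>\<^sub>0 complex) set" where
  "tensor_relations A B =
     (let e = (\<lambda>a b. Poly_Mapping.single (a, b) 1) in
      {e (a \<oplus>\<^bsub>A\<^esub> a') b - e a b - e a' b | a a' b.
         a \<in> carrier A \<and> a' \<in> carrier A \<and> b \<in> carrier B} \<union>
      {e a (b \<oplus>\<^bsub>B\<^esub> b') - e a b - e a b' | a b b'.
         a \<in> carrier A \<and> b \<in> carrier B \<and> b' \<in> carrier B} \<union>
      {e (c \<odot>\<^bsub>A\<^esub> a) b - Poly_Mapping.single (a, b) c | c a b.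
         a \<in> carrier A \<and> b \<in> carrier B} \<union>
      {e a (c \<odot>\<^bsub>B\<^esub> b) - Poly_Mapping.single (a, b) c | c a b.
         a \<in> carrier A \<and> b \<in> carrier B})"

definition tensor_ideal :: "'a calgebra \<Rightarrow> 'b calgebra \<Rightarrow> ('a \<times> 'b \<Rightarrow>\<^sub>0 complex) set" where
  "tensor_ideal A B = Idl\<^bsub>monoid_algebra (A \<times>\<times> B)\<^esub> (tensor_relations A B)"

text \<open>
  As a vector space, the monoid algebra of the multiplicative monoid \<open>A \<times>\<times> B\<close> is the free vector
  space on the pairs.  The linear span of the bilinearity relations is already an ideal of it, so
  the quotient is the usual tensor product over \<open>\<complex>\<close>, with
  \<open>(a \<otimes> b) (a' \<otimes> b') = a a' \<otimes> b b'\<close>.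
\<close>

definition tensor_algebra :: "'a calgebra \<Rightarrow> 'b calgebra \<Rightarrow> ('a \<times> 'b \<Rightarrow>\<^sub>0 complex) set calgebra" where
  "tensor_algebra A B = quotient_algebra (monoid_algebra (A \<times>\<times> B)) (tensor_ideal A B)"

definition pure_tensor ::
  "'a calgebra \<Rightarrow> 'b calgebra \<Rightarrow> 'a \<Rightarrow> 'b \<Rightarrow> ('a \<times> 'b \<Rightarrow>\<^sub>0 complex) set" where
  "pure_tensor A B a b =
     tensor_ideal A B +>\<^bsub>monoid_algebra (A \<times>\<times> B)\<^esub> Poly_Mapping.single (a, b) 1"


section \<open>Polynomials\<close>

text \<open>
  A monomial is a finitely supported exponent vector, and the product of
  these polynomials is the convolution product of \<^theory>\<open>HOL-Library.Poly_Mapping\<close>.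
\<close>

type_synonym 'v cpoly = "('v \<Rightarrow>\<^sub>0 nat) \<Rightarrow>\<^sub>0 complex"

definition var :: "'v \<Rightarrow> 'v cpoly" where
  "var v = Poly_Mapping.single (Poly_Mapping.single v 1) 1"

definition poly_eval :: "'v cpoly \<Rightarrow> ('v \<Rightarrow> complex) \<Rightarrow> complex" where
  "poly_eval p x =
     (\<Sum>m \<in> Poly_Mapping.keys p. Poly_Mapping.lookup p m *
        (\<Prod>v \<in> Poly_Mapping.keys m. x v ^ Poly_Mapping.lookup m v))"

text \<open>The polynomial algebra in the variables indexed by \<open>I\<close>.\<close>

definition poly_algebra :: "'v set \<Rightarrow> 'v cpoly calgebra" where
  "poly_algebra I =
     \<lparr>carrier = {p. \<forall>m \<in> Poly_Mapping.keys p. Poly_Mapping.keys m \<subseteq> I},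
      mult = (*), one = 1, zero = 0, add = (+),
      smult = (\<lambda>c. Poly_Mapping.map ((*) c))\<rparr>"


section \<open>The commuting variety and its quotient\<close>

type_synonym mat3 = "complex^3^3"

definition commuting_variety :: "(mat3 \<times> mat3) set" where
  "commuting_variety = {(X, Y). X ** Y = Y ** X}"

definition simultaneous_conj :: "mat3 \<Rightarrow> mat3 \<times> mat3 \<Rightarrow> mat3 \<times> mat3" where
  "simultaneous_conj g = (\<lambda>(X, Y). (g ** X ** matrix_inv g, g ** Y ** matrix_inv g))"

text \<open>The 18 coordinates of a pair; \<open>Inl\<close> selects an entry of the first matrix, \<open>Inr\<close> of the second.\<close>

fun entry :: "mat3 \<times> mat3 \<Rightarrow> (3 \<times> 3) + (3 \<times> 3) \<Rightarrow> complex" where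
  "entry (X, Y) (Inl (i, j)) = X $ i $ j"
| "entry (X, Y) (Inr (i, j)) = Y $ i $ j"

text \<open>
  Regular functions on \<open>V\<close> are restrictions of polynomial functions.  They are represented as
  extensional functions, so that two of them are equal iff they agree on \<open>V\<close>.
\<close>

definition regular_functions :: "(mat3 \<times> mat3) set \<Rightarrow> (mat3 \<times> mat3 \<Rightarrow> complex) set" where
  "regular_functions V = {\<lambda>Z\<in>V. poly_eval p (entry Z) | p. True}"

text \<open>
  For a conjugation-stable closed \<open>V\<close>, the affine GIT quotient \<open>V // GL\<^sub>3\<close> is by definition the
  affine variety whose coordinate ring is the algebra of invariant regular functions on \<open>V\<close>.
\<close>

definition git_coordinate_ring :: "(mat3 \<times> mat3) set \<Rightarrow> (mat3 \<times> mat3 \<Rightarrow> complex) calgebra" where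
  "git_coordinate_ring V =
     \<lparr>carrier = {f \<in> regular_functions V.
        \<forall>g Z. invertible g \<longrightarrow> Z \<in> V \<longrightarrow> f (simultaneous_conj g Z) = f Z},
      mult = (\<lambda>f h. \<lambda>Z\<in>V. f Z * h Z),
      one = (\<lambda>Z\<in>V. 1),
      zero = (\<lambda>Z\<in>V. 0),
      add = (\<lambda>f h. \<lambda>Z\<in>V. f Z + h Z),
      smult = (\<lambda>c f. \<lambda>Z\<in>V. c * f Z)\<rparr>"

text \<open>The invariants \<open>a\<^sub>1, \<dots>, a\<^sub>9\<close>, indexed from 1; \<^term>\<open>mat c\<close> is the scalar matrix \<open>c I\<^sub>3\<close>.\<close>

definition trace_invariant :: "nat \<Rightarrow> mat3 \<times> mat3 \<Rightarrow> complex" where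
  "trace_invariant i = (\<lambda>(X, Y).
     let A = X - mat (trace X / 3); B = Y - mat (trace Y / 3)
     in [trace X, trace Y,
         trace (A ** A), trace (A ** B), trace (B ** B),
         trace (A ** A ** A), trace (A ** A ** B), trace (A ** B ** B), trace (B ** B ** B)]
        ! (i - 1))"

definition J_generators :: "nat cpoly set" where
  "J_generators = (let a = var in
     {a 3 * a 9 - 2 * a 4 * a 8 + a 5 * a 7,
      a 5 * a 6 - 2 * a 4 * a 7 + a 3 * a 8,
      a 3 ^ 2 * a 5 - a 3 * a 4 ^ 2 + 6 * a 6 * a 8 - 6 * a 7 ^ 2,
      a 3 * a 4 * a 5 - a 4 ^ 3 + 3 * a 6 * a 9 - 3 * a 7 * a 8,
      a 3 * a 5 ^ 2 - a 4 ^ 2 * a 5 + 6 * a 7 * a 9 - 6 * a 8 ^ 2})"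

definition J :: "nat cpoly set" where
  "J = Idl\<^bsub>poly_algebra {3..9}\<^esub> J_generators"

end

theory Submission
  imports Defs
begin

text \<open>
  An invariant regular function on commuting pairs is determined by its values on pairs of diagonal
  matrices: a commuting pair is simultaneously triangularizable, and conjugation by
  \<open>diag(t\<^sup>2, t, 1)\<close> with \<open>t \<rightarrow> 0\<close> degenerates a triangular pair to its diagonal part.
  On diagonal pairs the function is invariant under permutations, hence a polynomial in the
  bivariate power sums of degree at most 3; this gives surjectivity.

  For the relations, diagonalize the cyclic permutation: in Fourier coordinates
  \<open>A = (u, v)\<close>, \<open>B = (r, s)\<close> the symmetric group is generated by
  \<open>(u, v, r, s) \<mapsto> (\<omega>u, \<omega>\<^sup>2v, \<omega>r, \<omega>\<^sup>2s)\<close> and the swap \<open>u \<leftrightarrow> v\<close>, \<open>r \<leftrightarrow> s\<close>. Modulo the five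
  generators every polynomial is a combination of \<open>1, a\<^sub>4, a\<^sub>4\<^sup>2, a\<^sub>4\<^sup>3, a\<^sub>7, a\<^sub>8\<close> with coefficients
  in \<open>\<complex>[a\<^sub>1, a\<^sub>2, a\<^sub>3, a\<^sub>5, a\<^sub>6, a\<^sub>9]\<close>. The six parameters determine \<open>A\<close> and \<open>B\<close> separately up to
  permutation, so a generic value of them is attained at six orbits, and the six basis elements are
  linearly independent on these six orbits. Hence a combination that vanishes on all diagonal pairs
  has zero coefficients.
\<close>

section \<open>Polynomials\<close>

text \<open>The ring to be presented consists of functions and is therefore reduced, so it is not
  enough that the five generators cut out the right set: they must generate the full vanishing
  ideal. This follows by matching two counts. Six elements span modulo the generators, and six is
  also the number of orbits in a generic fibre of the parameters, the index of the diagonal S3 in S3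
  x S3: the eigenvalues of \<open>A\<close> and of \<open>B\<close> are given as unordered triples,
  and an orbit records how they are matched. Nongeneric parameters are absorbed by multiplying with
  a product of two discriminants. For surjectivity the obstacle is that power sums of all bidegrees
  occur. Newton recursion works in each variable separately and leaves \<open>power_sum 2 2\<close>
  as the only base case of degree above 3. The tensor product is a quotient of the free vector space
  on pairs; the kernel of evaluation there is computed by the linear map \<open>to_tensor\<close>,
  which cuts monomials in nine variables into pure tensors.\<close>

abbreviation lookup where "lookup \<equiv> Poly_Mapping.lookup"
abbreviation keys where "keys \<equiv> Poly_Mapping.keys"
abbreviation single where "single \<equiv> Poly_Mapping.single"

lemma poly_mapping_sum_single:
  "(\<Sum>k \<in> keys p. single k (lookup p k)) = p"
proof (rule poly_mapping_eqI)
  fix k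
  show "lookup (\<Sum>k \<in> keys p. single k (lookup p k)) k = lookup p k"
    by (simp add: lookup_sum lookup_single when_def in_keys_iff sum.delta)
qed

text \<open>The added key \<open>k\<close> ranges over the support of the original \<open>p\<close>,
  while \<open>c\<close> and the tail \<open>q\<close> are arbitrary. A support condition on
  \<open>p\<close> thus stays available in the step without being carried through the
  induction.\<close>

lemma poly_mapping_add_induct [case_names zero add]:
  fixes p :: "'k \<Rightarrow>\<^sub>0 'b::comm_monoid_add"
  assumes "P 0"
    and "\<And>k c q. k \<in> keys p \<Longrightarrow> P q \<Longrightarrow> P (single k c + q)"
  shows "P p"
proof -
  have "P (\<Sum>k \<in> K. single k (lookup p k))" if "finite K" "K \<subseteq> keys p" for K
    using that by (induction K rule: finite_induct) (auto intro: assms)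
  from this[of "keys p"] show ?thesis
    by (simp add: poly_mapping_sum_single)
qed

definition polys :: "'v set \<Rightarrow> 'v cpoly set" where
  "polys I = {p. \<forall>m \<in> keys p. keys m \<subseteq> I}"

definition monom_eval :: "('v \<Rightarrow> complex) \<Rightarrow> ('v \<Rightarrow>\<^sub>0 nat) \<Rightarrow> complex" where
  "monom_eval x m = (\<Prod>v \<in> keys m. x v ^ lookup m v)"

lemma monom_eval_superset:
  assumes "finite K" "keys m \<subseteq> K"
  shows "monom_eval x m = (\<Prod>v \<in> K. x v ^ lookup m v)"
  unfolding monom_eval_def
  using assms by (intro prod.mono_neutral_left) (auto simp: in_keys_iff)

lemma monom_eval_0 [simp]: "monom_eval x 0 = 1"
  by (simp add: monom_eval_def)

lemma monom_eval_add: "monom_eval x (m + n) = monom_eval x m * monom_eval x n"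
proof -
  let ?K = "keys m \<union> keys n"
  have "monom_eval x (m + n) = (\<Prod>v \<in> ?K. x v ^ lookup (m + n) v)"
    by (rule monom_eval_superset) (auto simp: keys_add)
  also have "\<dots> = (\<Prod>v \<in> ?K. x v ^ lookup m v) * (\<Prod>v \<in> ?K. x v ^ lookup n v)"
    by (simp add: lookup_add power_add prod.distrib)
  also have "\<dots> = monom_eval x m * monom_eval x n"
    using monom_eval_superset[of ?K m x] monom_eval_superset[of ?K n x] by simp
  finally show ?thesis .
qed

lemma monom_eval_single [simp]: "monom_eval x (single v k) = x v ^ k"
  by (cases "k = 0") (simp_all add: monom_eval_def)

lemma monom_eval_mult: "monom_eval (\<lambda>v. x v * y v) m = monom_eval x m * monom_eval y m"
  by (simp add: monom_eval_def power_mult_distrib prod.distrib)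

lemma monom_eval_one [simp]: "monom_eval (\<lambda>v. 1) m = 1"
  by (simp add: monom_eval_def)

lemma poly_eval_conv: "poly_eval p x = (\<Sum>m \<in> keys p. lookup p m * monom_eval x m)"
  by (simp add: poly_eval_def monom_eval_def)

lemma poly_eval_0 [simp]: "poly_eval 0 x = 0"
  by (simp add: poly_eval_def)

lemma poly_eval_add [simp]: "poly_eval (p + q) x = poly_eval p x + poly_eval q x"
  unfolding poly_eval_conv
  by (rule setsum_keys_plus_distrib) (auto simp: algebra_simps)

lemma poly_eval_single: "poly_eval (single m c) x = c * monom_eval x m"
  by (cases "c = 0") (simp_all add: poly_eval_conv)

lemma poly_eval_const [simp]: "poly_eval (single 0 c) x = c"
  by (simp add: poly_eval_single)

lemma poly_eval_var [simp]: "poly_eval (var v) x = x v"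
  by (simp add: var_def poly_eval_single)

lemma poly_eval_mult [simp]: "poly_eval (p * q) x = poly_eval p x * poly_eval q x"
proof (induction p rule: poly_mapping_add_induct)
  case zero
  show ?case by simp
next
  case (add k c p)
  have "poly_eval (single k c * q) x = c * monom_eval x k * poly_eval q x"
  proof (induction q rule: poly_mapping_add_induct)
    case (add l d q)
    then show ?case
      by (simp add: distrib_left mult_single poly_eval_single monom_eval_add algebra_simps)
  qed simp
  with add.IH show ?case
    by (simp add: distrib_right poly_eval_single)
qed

lemma poly_eval_uminus [simp]: "poly_eval (- p) x = - poly_eval p x"
  using poly_eval_add[of p "- p" x] by (simp add: add_eq_0_iff)

lemma poly_eval_diff [simp]: "poly_eval (p - q) x = poly_eval p x - poly_eval q x"
  using poly_eval_add[of p "- q" x] by simp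

lemma poly_eval_1 [simp]: "poly_eval 1 x = 1"
  using poly_eval_const[of 1 x] by simp

lemma poly_eval_numeral [simp]: "poly_eval (numeral n) x = numeral n"
  using poly_eval_const[of "numeral n" x] by simp

lemma poly_eval_power [simp]: "poly_eval (p ^ n) x = poly_eval p x ^ n"
  by (induction n) simp_all

lemma poly_eval_sum [simp]: "poly_eval (sum f A) x = (\<Sum>a \<in> A. poly_eval (f a) x)"
  by (induction A rule: infinite_finite_induct) simp_all

lemma poly_eval_cong:
  assumes "p \<in> polys I" "\<And>v. v \<in> I \<Longrightarrow> x v = y v"
  shows "poly_eval p x = poly_eval p y"
  using assms unfolding poly_eval_def polys_def
  by (intro sum.cong refl arg_cong2[of _ _ _ _ "(*)"] prod.cong arg_cong2[of _ _ _ _ "(^)"]) blast+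

lemma smult_cpoly [simp]: "Poly_Mapping.map ((*) c) p = single 0 c * (p :: 'v cpoly)"
  by (rule mult_map_scale_conv_mult)

text \<open>Artin's argument: the monomials are distinct characters of a multiplicative monoid.\<close>

lemma monom_eval_independent:
  assumes "finite K" "\<And>x. (\<Sum>m \<in> K. c m * monom_eval x m) = 0" "m \<in> K"
  shows "c m = 0"
  using assms
proof (induction K arbitrary: c m rule: finite_induct)
  case (insert m0 K)
  have zero: "c m1 = 0" if "m1 \<in> K" for m1
  proof -
    from that insert.hyps have "m1 \<noteq> m0" by auto
    then obtain v where v: "lookup m1 v \<noteq> lookup m0 v"
      by (metis poly_mapping_eqI)
    \<comment> \<open>\<open>y\<close> is 2 at one variable where the exponents of \<open>m1\<close>
      and \<open>m0\<close> differ, so their values at \<open>y\<close> are different powers of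
      2.\<close>
    define y :: "'a \<Rightarrow> complex" where "y = (\<lambda>w. if w = v then 2 else 1)"
    have y: "monom_eval y m = 2 ^ lookup m v" for m
    proof -
      have "monom_eval y m = (\<Prod>w \<in> insert v (keys m). y w ^ lookup m w)"
        by (rule monom_eval_superset) auto
      also have "\<dots> = (\<Prod>w \<in> insert v (keys m). if w = v then 2 ^ lookup m v else 1)"
        by (rule prod.cong) (auto simp: y_def)
      finally show ?thesis by simp
    qed
    have ne: "monom_eval y m1 \<noteq> monom_eval y m0"
    proof
      assume "monom_eval y m1 = monom_eval y m0"
      then have "(of_nat (2 ^ lookup m1 v) :: complex) = of_nat (2 ^ lookup m0 v)"
        by (simp add: y)
      then show False using v unfolding of_nat_eq_iff by simp
    qed
    have "c m1 * (monom_eval y m1 - monom_eval y m0) = 0"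
    proof (rule insert.IH[where c = "\<lambda>m. c m * (monom_eval y m - monom_eval y m0)", OF _ that])
      fix x
      \<comment> \<open>Replacing \<open>x\<close> by \<open>y * x\<close> and subtracting
        \<open>monom_eval y m0\<close> times the relation at \<open>x\<close> cancels the
        \<open>m0\<close> term.\<close>
      have 1: "(\<Sum>m \<in> insert m0 K. c m * monom_eval (\<lambda>v. y v * x v) m) = 0"
        by (rule insert.prems)
      have 2: "monom_eval y m0 * (\<Sum>m \<in> insert m0 K. c m * monom_eval x m) = 0"
        by (simp only: insert.prems mult_zero_right)
      have "(\<Sum>m \<in> insert m0 K. c m * (monom_eval y m - monom_eval y m0) * monom_eval x m) = 0"
        using arg_cong2[OF 1 2, of minus] insert.hyps
        by (simp add: sum_distrib_left monom_eval_mult algebra_simps sum_subtractf)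
      then show "(\<Sum>m \<in> K. c m * (monom_eval y m - monom_eval y m0) * monom_eval x m) = 0"
        using insert.hyps by simp
    qed
    then show ?thesis using ne by simp
  qed
  then have "c m0 = 0"
    using insert.prems(1)[of "\<lambda>v. 1"] insert.hyps by simp
  with zero insert.prems(2) show ?case by auto
qed simp

lemma poly_eval_eq_zero:
  assumes "\<And>x. poly_eval p x = 0"
  shows "p = 0"
proof (rule poly_mapping_eqI)
  fix m
  show "lookup p m = lookup 0 m"
    using monom_eval_independent[of "keys p" "lookup p" m] assms
    by (cases "m \<in> keys p") (auto simp: poly_eval_conv in_keys_iff)
qed

lemma polys_single: "keys m \<subseteq> I \<Longrightarrow> single m c \<in> polys I"
  by (cases "c = 0") (auto simp: polys_def)

lemma polys_const [simp]: "single 0 c \<in> polys I"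
  by (simp add: polys_single)

lemma polys_0 [simp]: "0 \<in> polys I" and polys_1 [simp]: "1 \<in> polys I"
  by (simp_all add: polys_def)

lemma polys_numeral [simp]: "numeral n \<in> polys I"
  using polys_const[of "numeral n" I] by simp

lemma polys_var [simp]: "v \<in> I \<Longrightarrow> var v \<in> polys I"
  by (simp add: var_def polys_single)

lemma polys_add: "p \<in> polys I \<Longrightarrow> q \<in> polys I \<Longrightarrow> p + q \<in> polys I"
  using keys_add[of p q] by (auto simp: polys_def)

lemma polys_uminus: "p \<in> polys I \<Longrightarrow> - p \<in> polys I"
  by (auto simp: polys_def in_keys_iff)

lemma polys_diff: "p \<in> polys I \<Longrightarrow> q \<in> polys I \<Longrightarrow> p - q \<in> polys I"
  using polys_add[of p I "- q"] polys_uminus[of q I] by simp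

lemma polys_mult: "p \<in> polys I \<Longrightarrow> q \<in> polys I \<Longrightarrow> p * q \<in> polys I"
proof -
  assume pq: "p \<in> polys I" "q \<in> polys I"
  show ?thesis
    unfolding polys_def
  proof (intro CollectI ballI)
    fix m assume "m \<in> keys (p * q)"
    then obtain a b where "m = a + b" "a \<in> keys p" "b \<in> keys q"
      using keys_mult[of p q] by blast
    moreover from this pq have "keys a \<union> keys b \<subseteq> I"
      by (auto simp: polys_def)
    ultimately show "keys m \<subseteq> I"
      using keys_add[of a b] by blast
  qed
qed

lemma polys_power: "p \<in> polys I \<Longrightarrow> p ^ n \<in> polys I"
  by (induction n) (simp_all add: polys_mult)

lemma polys_mono: "I \<subseteq> I' \<Longrightarrow> p \<in> polys I \<Longrightarrow> p \<in> polys I'"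
  by (auto simp: polys_def)

lemmas polys_intros = polys_add polys_uminus polys_diff polys_mult polys_power

text \<open>Only variables of the original \<open>m\<close> are added, one at a time; this is what
  keeps \<open>polys_induct\<close> inside the variables of \<open>I\<close>.\<close>

lemma monomial_induct [case_names zero add]:
  fixes m :: "'v \<Rightarrow>\<^sub>0 nat"
  assumes "P 0" and "\<And>v n. v \<in> keys m \<Longrightarrow> P n \<Longrightarrow> P (single v 1 + n)"
  shows "P m"
proof -
  have step: "P (single v k + n)" if "v \<in> keys m" "P n" for v k n
  proof (induction k)
    case (Suc k)
    have "single v (Suc k) + n = single v 1 + (single v k + n)"
      by (simp add: add.assoc[symmetric] single_add[symmetric])
    then show ?case using assms(2)[OF that(1) Suc] by simp
  qed (use that in simp)
  have "P (\<Sum>v \<in> K. single v (lookup m v))" if "finite K" "K \<subseteq> keys m" for K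
    using that by (induction K rule: finite_induct) (auto intro: assms(1) step)
  moreover have "(\<Sum>v \<in> keys m. single v (lookup m v)) = m"
    by (rule poly_mapping_eqI) (simp add: lookup_sum lookup_single when_def in_keys_iff sum.delta)
  ultimately show ?thesis by (metis finite_keys order_refl)
qed

lemma polys_induct [consumes 1, case_names const add var]:
  assumes "p \<in> polys I"
    and const: "\<And>c. P (single 0 c)"
    and add: "\<And>p q. p \<in> polys I \<Longrightarrow> q \<in> polys I \<Longrightarrow> P p \<Longrightarrow> P q \<Longrightarrow> P (p + q)"
    and var: "\<And>v p. v \<in> I \<Longrightarrow> p \<in> polys I \<Longrightarrow> P p \<Longrightarrow> P (var v * p)"
  shows "P p"
proof -
  have single: "P (single m c) \<and> single m c \<in> polys I" if "m \<in> keys p" for m c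
  proof (induction m rule: monomial_induct)
    case zero
    show ?case by (simp add: const)
  next
    case (add v n)
    have eq: "single (single v 1 + n) c = var v * single n c"
      by (simp add: var_def mult_single)
    have "v \<in> I" using add(1) that assms(1) by (auto simp: polys_def)
    then show ?case
      unfolding eq using add(2) by (auto intro: var polys_mult)
  qed
  have "P p \<and> p \<in> polys I"
  proof (induction p rule: poly_mapping_add_induct)
    case zero
    show ?case using const[of 0] by simp
  next
    case (add m c q)
    with single[of m c] show ?case by (auto intro: assms(3) polys_add)
  qed
  then show ?thesis ..
qed

section \<open>Relations between the trace invariants\<close>

declare One_nat_def [simp del]

text \<open>The coefficients come from a subset \<open>A\<close>, since the type
  \<open>nat cpoly\<close> has more variables than the ring in question. Recording them in explicit
  sums lets \<open>to_tensor_Jext\<close> expand each coefficient into monomials.\<close>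

definition ideal_span :: "'a::comm_ring_1 set \<Rightarrow> 'a set \<Rightarrow> 'a set" where
  "ideal_span A G = {\<Sum>g \<in> G. h g * g | h. \<forall>g \<in> G. h g \<in> A}"

lemma ideal_span_add:
  assumes "\<And>a b. a \<in> A \<Longrightarrow> b \<in> A \<Longrightarrow> a + b \<in> A" "p \<in> ideal_span A G" "q \<in> ideal_span A G"
  shows "p + q \<in> ideal_span A G"
proof -
  obtain h k where "p = (\<Sum>g \<in> G. h g * g)" "\<forall>g \<in> G. h g \<in> A"
    "q = (\<Sum>g \<in> G. k g * g)" "\<forall>g \<in> G. k g \<in> A"
    using assms(2,3) by (auto simp: ideal_span_def)
  then have "p + q = (\<Sum>g \<in> G. (h g + k g) * g)" "\<forall>g \<in> G. h g + k g \<in> A"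
    using assms(1) by (auto simp: sum.distrib distrib_right)
  then show ?thesis unfolding ideal_span_def
    by (intro CollectI exI[of _ "\<lambda>g. h g + k g"]) simp
qed

lemma ideal_span_mult:
  assumes "\<And>a b. a \<in> A \<Longrightarrow> b \<in> A \<Longrightarrow> a * b \<in> A" "a \<in> A" "p \<in> ideal_span A G"
  shows "a * p \<in> ideal_span A G"
proof -
  obtain h where "p = (\<Sum>g \<in> G. h g * g)" "\<forall>g \<in> G. h g \<in> A"
    using assms(3) by (auto simp: ideal_span_def)
  then have "a * p = (\<Sum>g \<in> G. (a * h g) * g)" "\<forall>g \<in> G. a * h g \<in> A"
    using assms(1,2) by (auto simp: sum_distrib_left mult.assoc)
  then show ?thesis unfolding ideal_span_def
    by (intro CollectI exI[of _ "\<lambda>g. a * h g"]) simp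
qed

lemma ideal_span_superset:
  assumes "finite G" "0 \<in> A" "1 \<in> A" "g \<in> G"
  shows "g \<in> ideal_span A G"
proof -
  have "g = (\<Sum>g' \<in> G. (if g' = g then 1 else 0) * g')"
    using assms(1,4) by (simp add: if_distrib[of "\<lambda>x. x * _"] cong: if_cong)
  then show ?thesis unfolding ideal_span_def
    using assms(2,3) by (intro CollectI exI[of _ "\<lambda>g'. if g' = g then 1 else 0"]) auto
qed

lemma ideal_span_zero: "0 \<in> A \<Longrightarrow> 0 \<in> ideal_span A G"
  unfolding ideal_span_def by (intro CollectI exI[of _ "\<lambda>_. 0"]) auto

text \<open>The extension of \<open>J\<close> to nine variables. Relations are found in this one
  polynomial ring and only later distributed over the two tensor factors.\<close>

abbreviation Jext :: "nat cpoly set" where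
  "Jext \<equiv> ideal_span (polys {1..9}) J_generators"

lemma Jext_add: "p \<in> Jext \<Longrightarrow> q \<in> Jext \<Longrightarrow> p + q \<in> Jext"
  by (rule ideal_span_add) (auto intro: polys_add)

lemma Jext_mult: "p \<in> polys {1..9} \<Longrightarrow> q \<in> Jext \<Longrightarrow> p * q \<in> Jext"
  by (rule ideal_span_mult) (auto intro: polys_mult)

lemma Jext_uminus: "p \<in> Jext \<Longrightarrow> - p \<in> Jext"
  using Jext_mult[of "-1" p] by (simp add: polys_uminus)

lemma finite_J_generators: "finite J_generators"
  by (simp add: J_generators_def Let_def)

lemma J_generators_subset_Jext: "g \<in> J_generators \<Longrightarrow> g \<in> Jext"
  by (rule ideal_span_superset) (auto simp: finite_J_generators)

lemma Jext_0: "0 \<in> Jext"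
  by (rule ideal_span_zero) simp

text \<open>The parameter ring: indices 1, 3, 6 belong to \<open>X\<close> alone and 2, 5, 9 to
  \<open>Y\<close> alone. Modulo \<open>Jext\<close> the mixed invariants 4, 7, 8 are integral over
  it.\<close>

abbreviation param_polys :: "nat cpoly set" where
  "param_polys \<equiv> polys {1, 2, 3, 5, 6, 9}"

lemma param_polys_subset: "p \<in> param_polys \<Longrightarrow> p \<in> polys {1..9}"
  by (erule polys_mono[rotated]) auto

text \<open>The bidegrees in \<open>X\<close> and \<open>Y\<close> are (0,0), (1,1), (2,2), (3,3),
  (2,1), (1,2), in accordance with the bigraded numerator
  \<open>1 + (q + q^2) (t + t^2) + q^3 t^3\<close> for the diagonal invariants of S3.\<close>

definition module_basis :: "nat \<Rightarrow> nat cpoly" where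
  "module_basis k = [1, var 4, var 4 ^ 2, var 4 ^ 3, var 7, var 8] ! k"

definition reducible :: "nat cpoly \<Rightarrow> bool" where
  "reducible p \<longleftrightarrow> (\<exists>s. (\<forall>k. s k \<in> param_polys) \<and> p - (\<Sum>k<6. s k * module_basis k) \<in> Jext)"

lemma reducible_add:
  assumes "reducible p" "reducible q"
  shows "reducible (p + q)"
proof -
  obtain s t where "\<forall>k. s k \<in> param_polys" "p - (\<Sum>k<6. s k * module_basis k) \<in> Jext"
    "\<forall>k. t k \<in> param_polys" "q - (\<Sum>k<6. t k * module_basis k) \<in> Jext"
    using assms unfolding reducible_def by blast
  moreover have "p + q - (\<Sum>k<6. (s k + t k) * module_basis k) =
    (p - (\<Sum>k<6. s k * module_basis k)) + (q - (\<Sum>k<6. t k * module_basis k))"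
    by (simp add: distrib_right sum.distrib algebra_simps)
  ultimately show ?thesis
    unfolding reducible_def
    by (intro exI[of _ "\<lambda>k. s k + t k"]) (simp only: Jext_add polys_add simp_thms)
qed

lemma reducible_smult:
  assumes "a \<in> param_polys" "reducible p"
  shows "reducible (a * p)"
proof -
  obtain s where "\<forall>k. s k \<in> param_polys" "p - (\<Sum>k<6. s k * module_basis k) \<in> Jext"
    using assms unfolding reducible_def by blast
  moreover have "a * p - (\<Sum>k<6. (a * s k) * module_basis k) =
    a * (p - (\<Sum>k<6. s k * module_basis k))"
    by (simp add: sum_distrib_left algebra_simps)
  ultimately show ?thesis using assms(1)
    unfolding reducible_def
    by (intro exI[of _ "\<lambda>k. a * s k"]) (simp only: Jext_mult param_polys_subset polys_mult simp_thms)
qed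

lemma reducible_cong:
  assumes "reducible p" "q - p \<in> Jext"
  shows "reducible q"
proof -
  obtain s where "\<forall>k. s k \<in> param_polys" "p - (\<Sum>k<6. s k * module_basis k) \<in> Jext"
    using assms unfolding reducible_def by blast
  moreover from this assms(2) have "q - p + (p - (\<Sum>k<6. s k * module_basis k)) \<in> Jext"
    using Jext_add by blast
  ultimately show ?thesis unfolding reducible_def by auto
qed

lemma reducible_basis: "k < 6 \<Longrightarrow> reducible (module_basis k)"
  unfolding reducible_def
  by (intro exI[of _ "\<lambda>i. if i = k then 1 else 0"])
    (auto simp: if_distrib[of "\<lambda>x. x * _"] Jext_0 cong: if_cong)

lemma reducible_sum: "(\<And>k. k \<in> K \<Longrightarrow> reducible (f k)) \<Longrightarrow> reducible (sum f K)"
proof (induction K rule: infinite_finite_induct)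
  case empty
  show ?case using reducible_smult[OF _ reducible_basis[of 0], of 0] by simp
next
  case (infinite K)
  show ?case using reducible_smult[OF _ reducible_basis[of 0], of 0] infinite by simp
qed (auto intro: reducible_add)

section \<open>Rewriting products by the five generators\<close>

abbreviation half :: "nat cpoly" where "half \<equiv> single 0 (1/2)"
abbreviation third :: "nat cpoly" where "third \<equiv> single 0 (1/3)"

lemma two_half: "2 * half = 1"
proof -
  have "single 0 2 * half = (1 :: nat cpoly)"
    unfolding mult_single by simp
  then show ?thesis by simp
qed

lemma three_third: "3 * third = 1"
proof -
  have "single 0 3 * third = (1 :: nat cpoly)"
    unfolding mult_single by simp
  then show ?thesis by simp
qed

text \<open>Each generator, multiplied by \<open>- h\<close>, \<open>- (h * t)\<close> or
  \<open>- t\<close>, is solved for one product of mixed invariants. The inverses of 2 and 3 stay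
  abstract ring elements, so that these are plain identities in a commutative ring.\<close>

lemma half_third_identities:
  fixes h t a3 a4 a5 a6 a7 a8 a9 :: "'a::comm_ring_1"
  assumes "2 * h = 1" "3 * t = 1"
  shows "- h * (a3 * a9 - 2 * a4 * a8 + a5 * a7) = a4 * a8 - (h * a3 * a9 + h * a5 * a7)"
    and "- h * (a5 * a6 - 2 * a4 * a7 + a3 * a8) = a4 * a7 - (h * a5 * a6 + h * a3 * a8)"
    and "- (h * t) * (a3 ^ 2 * a5 - a3 * a4 ^ 2 + 6 * a6 * a8 - 6 * a7 ^ 2) =
      a7 * a7 - (h * t * a3 ^ 2 * a5 - h * t * a3 * a4 ^ 2 + a6 * a8)"
    and "- t * (a3 * a4 * a5 - a4 ^ 3 + 3 * a6 * a9 - 3 * a7 * a8) =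
      a7 * a8 - (t * a3 * a5 * a4 - t * a4 ^ 3 + a6 * a9)"
    and "- (h * t) * (a3 * a5 ^ 2 - a4 ^ 2 * a5 + 6 * a7 * a9 - 6 * a8 ^ 2) =
      a8 * a8 - (h * t * a3 * a5 ^ 2 - h * t * a5 * a4 ^ 2 + a9 * a7)"
proof -
  have 1: "h * (2 * x) = x" for x
    using assms(1) by (simp add: mult.assoc[symmetric] mult.commute[of h])
  have 2: "t * (3 * x) = x" for x
    using assms(2) by (simp add: mult.assoc[symmetric] mult.commute[of t])
  have 3: "h * t * (6 * x) = x" for x
  proof -
    have "h * t * (6 * x) = h * (2 * (t * (3 * x)))"
      by (simp add: algebra_simps)
    then show ?thesis by (simp only: 1 2)
  qed
  have "- h * (a3 * a9 - 2 * a4 * a8 + a5 * a7) = h * (2 * (a4 * a8)) - (h * a3 * a9 + h * a5 * a7)"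
    by (simp add: algebra_simps)
  then show "- h * (a3 * a9 - 2 * a4 * a8 + a5 * a7) = a4 * a8 - (h * a3 * a9 + h * a5 * a7)"
    by (simp only: 1)
  have "- h * (a5 * a6 - 2 * a4 * a7 + a3 * a8) = h * (2 * (a4 * a7)) - (h * a5 * a6 + h * a3 * a8)"
    by (simp add: algebra_simps)
  then show "- h * (a5 * a6 - 2 * a4 * a7 + a3 * a8) = a4 * a7 - (h * a5 * a6 + h * a3 * a8)"
    by (simp only: 1)
  have "- (h * t) * (a3 ^ 2 * a5 - a3 * a4 ^ 2 + 6 * a6 * a8 - 6 * a7 ^ 2) =
      h * t * (6 * (a7 * a7)) - (h * t * a3 ^ 2 * a5 - h * t * a3 * a4 ^ 2 + h * t * (6 * (a6 * a8)))"
    by (simp add: algebra_simps power2_eq_square)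
  then show "- (h * t) * (a3 ^ 2 * a5 - a3 * a4 ^ 2 + 6 * a6 * a8 - 6 * a7 ^ 2) =
      a7 * a7 - (h * t * a3 ^ 2 * a5 - h * t * a3 * a4 ^ 2 + a6 * a8)"
    by (simp only: 3)
  have "- t * (a3 * a4 * a5 - a4 ^ 3 + 3 * a6 * a9 - 3 * a7 * a8) =
      t * (3 * (a7 * a8)) - (t * a3 * a5 * a4 - t * a4 ^ 3 + t * (3 * (a6 * a9)))"
    by (simp add: algebra_simps)
  then show "- t * (a3 * a4 * a5 - a4 ^ 3 + 3 * a6 * a9 - 3 * a7 * a8) =
      a7 * a8 - (t * a3 * a5 * a4 - t * a4 ^ 3 + a6 * a9)"
    by (simp only: 2)
  have "- (h * t) * (a3 * a5 ^ 2 - a4 ^ 2 * a5 + 6 * a7 * a9 - 6 * a8 ^ 2) =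
      h * t * (6 * (a8 * a8)) - (h * t * a3 * a5 ^ 2 - h * t * a5 * a4 ^ 2 + h * t * (6 * (a9 * a7)))"
    by (simp add: algebra_simps power2_eq_square)
  then show "- (h * t) * (a3 * a5 ^ 2 - a4 ^ 2 * a5 + 6 * a7 * a9 - 6 * a8 ^ 2) =
      a8 * a8 - (h * t * a3 * a5 ^ 2 - h * t * a5 * a4 ^ 2 + a9 * a7)"
    by (simp only: 3)
qed

context
  fixes a :: "nat \<Rightarrow> nat cpoly"
  defines "a \<equiv> var"
begin

text \<open>The generators as rewriting rules for all quadratic products of \<open>a 4\<close>,
  \<open>a 7\<close>, \<open>a 8\<close> except \<open>a 4 ^ 2\<close>. The right hand sides are
  combinations of the basis elements with coefficients in the parameter ring.\<close>

lemma J_rewrite: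
  shows "a 4 * a 8 - (half * a 3 * a 9 + half * a 5 * a 7) \<in> Jext" (is ?t1)
    and "a 4 * a 7 - (half * a 5 * a 6 + half * a 3 * a 8) \<in> Jext" (is ?t2)
    and "a 7 * a 7 - (half * third * a 3 ^ 2 * a 5 - half * third * a 3 * a 4 ^ 2 + a 6 * a 8) \<in> Jext" (is ?t3)
    and "a 7 * a 8 - (third * a 3 * a 5 * a 4 - third * a 4 ^ 3 + a 6 * a 9) \<in> Jext" (is ?t4)
    and "a 8 * a 8 - (half * third * a 3 * a 5 ^ 2 - half * third * a 5 * a 4 ^ 2 + a 9 * a 7) \<in> Jext" (is ?t5)
proof -
  have g: "a 3 * a 9 - 2 * a 4 * a 8 + a 5 * a 7 \<in> Jext"
    "a 5 * a 6 - 2 * a 4 * a 7 + a 3 * a 8 \<in> Jext"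
    "a 3 ^ 2 * a 5 - a 3 * a 4 ^ 2 + 6 * a 6 * a 8 - 6 * a 7 ^ 2 \<in> Jext"
    "a 3 * a 4 * a 5 - a 4 ^ 3 + 3 * a 6 * a 9 - 3 * a 7 * a 8 \<in> Jext"
    "a 3 * a 5 ^ 2 - a 4 ^ 2 * a 5 + 6 * a 7 * a 9 - 6 * a 8 ^ 2 \<in> Jext"
    by (rule J_generators_subset_Jext, simp only: J_generators_def Let_def a_def insert_iff simp_thms)+
  have c: "- half \<in> polys {1..9}" "- (half * third) \<in> polys {1..9}" "- third \<in> polys {1..9}"
    by (intro polys_intros polys_const)+
  note ids = half_third_identities[OF two_half three_third]
  show ?t1 using Jext_mult[OF c(1) g(1)] unfolding ids .
  show ?t2 using Jext_mult[OF c(1) g(2)] unfolding ids .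
  show ?t3 using Jext_mult[OF c(2) g(3)] unfolding ids .
  show ?t4 using Jext_mult[OF c(3) g(4)] unfolding ids .
  show ?t5 using Jext_mult[OF c(2) g(5)] unfolding ids .
qed

lemma reducible_rewrite:
  assumes "m - r \<in> Jext" "t \<in> polys {1..9}" "reducible (t * r)"
  shows "reducible (t * m)"
proof (rule reducible_cong[OF assms(3)])
  have "t * (m - r) \<in> Jext" using assms(1,2) by (rule Jext_mult[rotated])
  then show "t * m - t * r \<in> Jext" by (simp add: algebra_simps)
qed

lemma reducible_base: "reducible 1" "reducible (a 4)" "reducible (a 4 ^ 2)" "reducible (a 4 ^ 3)"
    "reducible (a 7)" "reducible (a 8)"
  using reducible_basis[of 0] reducible_basis[of 1] reducible_basis[of 2]
    reducible_basis[of 3] reducible_basis[of 4] reducible_basis[of 5]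
  by (simp_all add: module_basis_def a_def)

lemma param_var: "a 1 \<in> param_polys" "a 2 \<in> param_polys" "a 3 \<in> param_polys"
    "a 5 \<in> param_polys" "a 6 \<in> param_polys" "a 9 \<in> param_polys"
  by (simp_all add: a_def)

lemma poly_var: "k \<in> {1..9} \<Longrightarrow> a k \<in> polys {1..9}"
  by (simp add: a_def)

lemma reducible_diff: "reducible p \<Longrightarrow> reducible q \<Longrightarrow> reducible (p - q)"
  using reducible_add[of p "- 1 * q"] reducible_smult[of "-1" q] by (simp add: polys_uminus)

lemma reducible_param: "c \<in> param_polys \<Longrightarrow> reducible c"
  using reducible_smult[OF _ reducible_base(1)] by simp

lemmas reducible_closure = reducible_add reducible_diff reducible_smult reducible_base param_var
  polys_const polys_intros

lemma reducible_48: "reducible (a 4 * a 8)"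
proof -
  have "reducible (1 * (half * a 3 * a 9 + half * a 5 * a 7))"
    unfolding mult_1_left
    by (intro reducible_add reducible_param[of "half * a 3 * a 9"] reducible_closure)
  from reducible_rewrite[OF J_rewrite(1) _ this] show ?thesis by simp
qed

lemma reducible_47: "reducible (a 4 * a 7)"
proof -
  have "reducible (1 * (half * a 5 * a 6 + half * a 3 * a 8))"
    unfolding mult_1_left
    by (intro reducible_add reducible_param[of "half * a 5 * a 6"] reducible_closure)
  from reducible_rewrite[OF J_rewrite(2) _ this] show ?thesis by simp
qed

lemma reducible_77: "reducible (a 7 * a 7)"
proof -
  have "reducible (1 * (half * third * a 3 ^ 2 * a 5 - half * third * a 3 * a 4 ^ 2 + a 6 * a 8))"
    unfolding mult_1_left
    by (intro reducible_add reducible_diff reducible_param[of "half * third * a 3 ^ 2 * a 5"] reducible_closure)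
  from reducible_rewrite[OF J_rewrite(3) _ this] show ?thesis by simp
qed

lemma reducible_78: "reducible (a 7 * a 8)"
proof -
  have "reducible (1 * (third * a 3 * a 5 * a 4 - third * a 4 ^ 3 + a 6 * a 9))"
    unfolding mult_1_left
    by (intro reducible_add reducible_diff reducible_param[of "a 6 * a 9"] reducible_closure)
  from reducible_rewrite[OF J_rewrite(4) _ this] show ?thesis by simp
qed

lemma reducible_88: "reducible (a 8 * a 8)"
proof -
  have "reducible (1 * (half * third * a 3 * a 5 ^ 2 - half * third * a 5 * a 4 ^ 2 + a 9 * a 7))"
    unfolding mult_1_left
    by (intro reducible_add reducible_diff reducible_param[of "half * third * a 3 * a 5 ^ 2"] reducible_closure)
  from reducible_rewrite[OF J_rewrite(5) _ this] show ?thesis by simp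
qed

text \<open>Rewriting \<open>a 4 * a 8\<close> gives a parameter term and a multiple of
  \<open>a 7\<close>; rewriting \<open>a 4 * a 7\<close> gives a parameter term and a multiple of
  \<open>a 8\<close>. Further factors \<open>a 4\<close> thus alternate between the two chains, one
  power lower each time.\<close>

lemma reducible_448: "reducible (a 4 * (a 4 * a 8))"
proof (rule reducible_rewrite[OF J_rewrite(1)])
  have "reducible ((half * a 3 * a 9) * a 4 + (half * a 5) * (a 4 * a 7))"
    by (intro reducible_closure reducible_47)
  then show "reducible (a 4 * (half * a 3 * a 9 + half * a 5 * a 7))"
    by (simp add: algebra_simps)
qed (simp add: poly_var)

lemma reducible_447: "reducible (a 4 * (a 4 * a 7))"
proof (rule reducible_rewrite[OF J_rewrite(2)])
  have "reducible ((half * a 5 * a 6) * a 4 + (half * a 3) * (a 4 * a 8))"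
    by (intro reducible_closure reducible_48)
  then show "reducible (a 4 * (half * a 5 * a 6 + half * a 3 * a 8))"
    by (simp add: algebra_simps)
qed (simp add: poly_var)

lemma reducible_4448: "reducible (a 4 ^ 2 * (a 4 * a 8))"
proof (rule reducible_rewrite[OF J_rewrite(1)])
  have "reducible ((half * a 3 * a 9) * a 4 ^ 2 + (half * a 5) * (a 4 * (a 4 * a 7)))"
    by (intro reducible_closure reducible_447)
  then show "reducible (a 4 ^ 2 * (half * a 3 * a 9 + half * a 5 * a 7))"
    by (simp add: algebra_simps power2_eq_square)
qed (simp add: poly_var polys_power)

lemma reducible_4447: "reducible (a 4 ^ 2 * (a 4 * a 7))"
proof (rule reducible_rewrite[OF J_rewrite(2)])
  have "reducible ((half * a 5 * a 6) * a 4 ^ 2 + (half * a 3) * (a 4 * (a 4 * a 8)))"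
    by (intro reducible_closure reducible_448)
  then show "reducible (a 4 ^ 2 * (half * a 5 * a 6 + half * a 3 * a 8))"
    by (simp add: algebra_simps power2_eq_square)
qed (simp add: poly_var polys_power)

text \<open>An overlap of the rules for \<open>a 4 * a 7\<close> and \<open>a 7 * a 8\<close>: this
  order of rewriting reaches the basis, whereas the other order produces
  \<open>a 4 ^ 4\<close>.\<close>

lemma reducible_478: "reducible (a 8 * (a 4 * a 7))"
proof (rule reducible_rewrite[OF J_rewrite(2)])
  have "reducible ((half * a 5 * a 6) * a 8 + (half * a 3) * (a 8 * a 8))"
    by (intro reducible_closure reducible_88)
  then show "reducible (a 8 * (half * a 5 * a 6 + half * a 3 * a 8))"
    by (simp add: algebra_simps)
qed (simp add: poly_var)

text \<open>The relation for \<open>a\<^sub>7 a\<^sub>8\<close> has \<open>a\<^sub>4\<^sup>3\<close> in it, so multiplying it by \<open>a\<^sub>4\<close> reduces \<open>a\<^sub>4\<^sup>4\<close>.\<close>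

lemma reducible_4444: "reducible (a 4 * a 4 ^ 3)"
proof (rule reducible_cong)
  show "reducible ((a 3 * a 5) * a 4 ^ 2 + (3 * a 6 * a 9) * a 4 - 3 * (a 8 * (a 4 * a 7)))"
    by (intro reducible_closure reducible_478 polys_numeral)
  have "- (3 * a 4) * (a 7 * a 8 - (third * a 3 * a 5 * a 4 - third * a 4 ^ 3 + a 6 * a 9)) \<in> Jext"
    by (intro Jext_mult J_rewrite) (simp add: polys_intros poly_var)
  also have "- (3 * a 4) * (a 7 * a 8 - (third * a 3 * a 5 * a 4 - third * a 4 ^ 3 + a 6 * a 9)) =
    - ((3 * third) * (a 4 * a 4 ^ 3)) - 3 * (a 8 * (a 4 * a 7)) + (3 * third) * a 3 * a 5 * a 4 ^ 2 + 3 * a 6 * a 9 * a 4"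
    by (simp add: algebra_simps power2_eq_square)
  finally have "- (a 4 * a 4 ^ 3) - 3 * (a 8 * (a 4 * a 7)) + a 3 * a 5 * a 4 ^ 2 + 3 * a 6 * a 9 * a 4 \<in> Jext"
    by (simp only: three_third mult_1_left)
  from Jext_uminus[OF this]
  show "a 4 * a 4 ^ 3 - ((a 3 * a 5) * a 4 ^ 2 + (3 * a 6 * a 9) * a 4 - 3 * (a 8 * (a 4 * a 7))) \<in> Jext"
    by (simp add: algebra_simps)
qed

text \<open>Completes the multiplication table, so that the span modulo \<open>Jext\<close> is
  stable under the three variables that are not parameters.\<close>

lemma reducible_var_basis:
  assumes "v \<in> {4, 7, 8}" "k < 6"
  shows "reducible (a v * module_basis k)"
proof -
  have b: "module_basis 0 = 1" "module_basis 1 = a 4" "module_basis 2 = a 4 ^ 2" "module_basis 3 = a 4 ^ 3"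
    "module_basis 4 = a 7" "module_basis 5 = a 8"
    by (simp_all add: module_basis_def a_def)
  have *: "reducible (a 7 * a 4)" "reducible (a 8 * a 4)" "reducible (a 8 * a 7)"
    "reducible (a 7 * a 4 ^ 2)" "reducible (a 8 * a 4 ^ 2)"
    "reducible (a 7 * a 4 ^ 3)" "reducible (a 8 * a 4 ^ 3)" "reducible (a 4 * a 4)" "reducible (a 4 * a 4 ^ 2)"
    using reducible_47 reducible_48 reducible_78 reducible_447 reducible_448 reducible_4447 reducible_4448 reducible_base
    by (simp_all add: power2_eq_square power3_eq_cube ac_simps)
  have "k \<in> {0,1,2,3,4,5}" using assms(2) by auto
  then show ?thesis
    using assms(1) * reducible_47 reducible_48 reducible_78 reducible_77 reducible_88 reducible_4444 reducible_base
    by (elim insertE emptyE) (simp_all only: b mult_1_right)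
qed

lemma reducible_var:
  assumes "v \<in> {1..9}" "reducible p"
  shows "reducible (a v * p)"
proof (cases "v \<in> {4, 7, 8}")
  case True
  obtain s where s: "\<forall>k. s k \<in> param_polys" "p - (\<Sum>k<6. s k * module_basis k) \<in> Jext"
    using assms unfolding reducible_def by blast
  have "a v * (p - (\<Sum>k<6. s k * module_basis k)) \<in> Jext"
    using s(2) assms(1) by (intro Jext_mult poly_var)
  moreover have "reducible (\<Sum>k<6. s k * (a v * module_basis k))"
    using True s(1) by (intro reducible_sum reducible_smult reducible_var_basis) auto
  ultimately show ?thesis
    by (intro reducible_cong[where q = "a v * p" and p = "\<Sum>k<6. s k * (a v * module_basis k)"])
      (simp_all add: sum_distrib_left algebra_simps)
next
  case False
  with assms(1) have "v \<in> {1, 2, 3, 5, 6, 9}"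
    by auto
  then show ?thesis
    using assms(2) by (intro reducible_smult) (simp_all add: a_def)
qed

end

lemma all_reducible: "p \<in> polys {1..9} \<Longrightarrow> reducible p"
proof (induction p rule: polys_induct)
  case (const c)
  show ?case by (rule reducible_param) simp
next
  case (add p q)
  then show ?case by (intro reducible_add)
next
  case (var v p)
  then show ?case by (intro reducible_var)
qed

text \<open>The values of the invariants at diagonal matrices with entries
  \<open>c + z * u + z ^ 2 * v\<close> and \<open>d + z * r + z ^ 2 * s\<close>, where
  \<open>z\<close> runs over the cube roots of unity. Summation over \<open>z\<close> leaves 3 times
  the terms whose weight is divisible by 3, where \<open>u\<close>, \<open>r\<close> have weight 1
  and \<open>v\<close>, \<open>s\<close> weight 2.\<close>

definition diag_invariants :: "complex \<Rightarrow> complex \<Rightarrow> complex \<Rightarrow> complex \<Rightarrow> complex \<Rightarrow> complex \<Rightarrow> nat \<Rightarrow> complex" where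
  "diag_invariants c d u v r s i =
    [3 * c, 3 * d, 6 * u * v, 3 * (u * s + v * r), 6 * r * s,
     3 * (u ^ 3 + v ^ 3), 3 * (u ^ 2 * r + v ^ 2 * s), 3 * (u * r ^ 2 + v * s ^ 2), 3 * (r ^ 3 + s ^ 3)] ! (i - 1)"

lemma diag_invariants_simps:
  "diag_invariants c d u v r s 1 = 3 * c" "diag_invariants c d u v r s 2 = 3 * d"
  "diag_invariants c d u v r s 3 = 6 * u * v" "diag_invariants c d u v r s 4 = 3 * (u * s + v * r)"
  "diag_invariants c d u v r s 5 = 6 * r * s" "diag_invariants c d u v r s 6 = 3 * (u ^ 3 + v ^ 3)"
  "diag_invariants c d u v r s 7 = 3 * (u ^ 2 * r + v ^ 2 * s)" "diag_invariants c d u v r s 8 = 3 * (u * r ^ 2 + v * s ^ 2)"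
  "diag_invariants c d u v r s 9 = 3 * (r ^ 3 + s ^ 3)"
  by (simp_all add: diag_invariants_def)

lemma Jext_vanishes_on_diag:
  assumes "p \<in> Jext"
  shows "poly_eval p (diag_invariants c d u v r s) = 0"
proof -
  obtain h where "p = (\<Sum>g \<in> J_generators. h g * g)"
    using assms by (auto simp: ideal_span_def)
  moreover have "poly_eval g (diag_invariants c d u v r s) = 0" if "g \<in> J_generators" for g
    using that[unfolded J_generators_def Let_def]
    by (elim insertE emptyE; hypsubst_thin;
        simp add: diag_invariants_simps power2_eq_square power3_eq_cube; simp add: algebra_simps)
  ultimately show ?thesis by simp
qed

section \<open>The six orbits over a generic parameter value\<close>

lemma cube_root_of_unity_cubed:
  fixes w :: complex
  assumes "w ^ 2 + w + 1 = 0"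
  shows "w ^ 3 = 1"
proof -
  have "w ^ 3 - 1 = (w - 1) * (w ^ 2 + w + 1)"
    by (simp add: algebra_simps power2_eq_square power3_eq_cube)
  then show ?thesis using assms by simp
qed

text \<open>Inversion of the Fourier matrix of order 3. The multiples of
  \<open>w ^ 2 + w + 1\<close> and \<open>w ^ 3 - 1\<close> turn the inversion formulas into
  identities in a free \<open>w\<close>.\<close>

lemma fourier3:
  fixes w a b c :: complex
  assumes w: "w ^ 2 + w + 1 = 0"
    and eq: "a + b + c = 0" "a + b * w + c * w ^ 2 = 0" "a + b * w ^ 2 + c * w = 0"
  shows "a = 0" "b = 0" "c = 0"
proof -
  have w3: "w ^ 3 - 1 = 0" using cube_root_of_unity_cubed[OF w] by simp
  have "3 * a = (a + b + c) + (a + b * w + c * w ^ 2) + (a + b * w ^ 2 + c * w) - (b + c) * (w ^ 2 + w + 1)"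
    by (simp add: algebra_simps)
  then show "a = 0" by (simp only: w eq) simp
  have "3 * b = (a + b + c) + w ^ 2 * (a + b * w + c * w ^ 2) + w * (a + b * w ^ 2 + c * w)
    - (a + c) * (w ^ 2 + w + 1) - (2 * b + c * w) * (w ^ 3 - 1)"
    by (simp add: algebra_simps power2_eq_square power3_eq_cube)
  then show "b = 0" by (simp only: w w3 eq) simp
  have "3 * c = (a + b + c) + w * (a + b * w + c * w ^ 2) + w ^ 2 * (a + b * w ^ 2 + c * w)
    - (a + b) * (w ^ 2 + w + 1) - (2 * c + b * w) * (w ^ 3 - 1)"
    by (simp add: algebra_simps power2_eq_square power3_eq_cube)
  then show "c = 0" by (simp only: w w3 eq) simp
qed

text \<open>Cramer's rule: the determinant of the system is \<open>a ^ 3 - b ^ 3\<close>.\<close>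

lemma solve_two_by_two:
  fixes a b p q :: complex
  assumes eq: "a * p + b ^ 2 * q = 0" "b * p + a ^ 2 * q = 0" and "a ^ 3 \<noteq> b ^ 3"
  shows "p = 0" "q = 0"
proof -
  have "(a ^ 3 - b ^ 3) * p = a ^ 2 * (a * p + b ^ 2 * q) - b ^ 2 * (b * p + a ^ 2 * q)"
    "(a ^ 3 - b ^ 3) * q = a * (b * p + a ^ 2 * q) - b * (a * p + b ^ 2 * q)"
    by (simp_all add: algebra_simps power2_eq_square power3_eq_cube)
  then have "(a ^ 3 - b ^ 3) * p = 0" "(a ^ 3 - b ^ 3) * q = 0"
    by (simp_all only: eq) simp_all
  then show "p = 0" "q = 0" using assms(3) by auto
qed

text \<open>For fixed \<open>u\<close>, \<open>v\<close> the six orbits are represented by the pairs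
  \<open>(z * r, z ^ 2 * s)\<close> and \<open>(z * s, z ^ 2 * r)\<close> with
  \<open>z ^ 3 = 1\<close>. Varying \<open>z\<close> separates the equation into three Fourier
  components, and exchanging \<open>r\<close> and \<open>s\<close> doubles their number to
  six.\<close>

lemma generic_independence:
  fixes S :: "nat \<Rightarrow> complex" and w u v r s :: complex
  assumes w: "w ^ 2 + w + 1 = 0"
    and uv: "u ^ 3 \<noteq> v ^ 3" and rs: "r ^ 3 \<noteq> s ^ 3"
    and eq: "\<And>r' s'. r' * s' = r * s \<Longrightarrow> r' ^ 3 + s' ^ 3 = r ^ 3 + s ^ 3 \<Longrightarrow>
      S 0 + S 1 * (3 * (u * s' + v * r')) + S 2 * (3 * (u * s' + v * r')) ^ 2 + S 3 * (3 * (u * s' + v * r')) ^ 3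
        + S 4 * (3 * (u ^ 2 * r' + v ^ 2 * s')) + S 5 * (3 * (u * r' ^ 2 + v * s' ^ 2)) = 0"
  shows "S 0 = 0 \<and> S 1 = 0 \<and> S 2 = 0 \<and> S 3 = 0 \<and> S 4 = 0 \<and> S 5 = 0"
proof -
  \<comment> \<open>\<open>A\<close>, \<open>B\<close>, \<open>C\<close> collect the coefficients of
    1, \<open>z\<close>, \<open>z ^ 2\<close> after substituting
    \<open>(z * r', z ^ 2 * s')\<close>, with exponents reduced by \<open>z ^ 3 = 1\<close> and
    \<open>r' * s'\<close> replaced by \<open>r * s\<close>.\<close>
  define A where "A = (\<lambda>r' s'. S 0 + 18 * (S 2 * (u * v * (r * s))) + 27 * S 3 * (u ^ 3 * s' ^ 3 + v ^ 3 * r' ^ 3))"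
  define B where "B = (\<lambda>r' s'. S 1 * 3 * (v * r') + S 2 * 9 * (u ^ 2 * s' ^ 2) + S 3 * 81 * (u * v * (r * s)) * (v * r')
    + S 4 * 3 * (u ^ 2 * r') + S 5 * 3 * (v * s' ^ 2))"
  define C where "C = (\<lambda>r' s'. S 1 * 3 * (u * s') + S 2 * 9 * (v ^ 2 * r' ^ 2) + S 3 * 81 * (u * v * (r * s)) * (u * s')
    + S 4 * 3 * (v ^ 2 * s') + S 5 * 3 * (u * r' ^ 2))"
  have comb: "A r' s' + B r' s' * z + C r' s' * z ^ 2 = 0"
    if h: "r' * s' = r * s" "r' ^ 3 + s' ^ 3 = r ^ 3 + s ^ 3" and z: "z ^ 3 = 1" for r' s' z
  proof -
    define X where "X = z * r'"
    define Y where "Y = z ^ 2 * s'"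
    have "X * Y = z ^ 3 * (r' * s')" by (simp add: X_def Y_def power2_eq_square power3_eq_cube)
    then have XY: "X * Y = r * s" using h z by simp
    have X2: "X ^ 2 = z ^ 2 * r' ^ 2" by (simp add: X_def power_mult_distrib)
    have Y2: "Y ^ 2 = z * s' ^ 2"
    proof -
      have "Y ^ 2 = z ^ 3 * (z * s' ^ 2)" by (simp add: Y_def power2_eq_square power3_eq_cube)
      then show ?thesis by (simp add: z)
    qed
    have X3: "X ^ 3 = r' ^ 3" by (simp add: X_def power_mult_distrib z)
    have Y3: "Y ^ 3 = s' ^ 3"
    proof -
      have "Y ^ 3 = z ^ 3 * z ^ 3 * s' ^ 3" by (simp add: Y_def power2_eq_square power3_eq_cube)
      then show ?thesis by (simp add: z)
    qed
    have sq: "(3 * (u * Y + v * X)) ^ 2 = 9 * (u ^ 2 * Y ^ 2) + 18 * (u * v * (X * Y)) + 9 * (v ^ 2 * X ^ 2)"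
      by (simp add: algebra_simps power2_eq_square)
    have cb: "(3 * (u * Y + v * X)) ^ 3 = 27 * (u ^ 3 * Y ^ 3 + v ^ 3 * X ^ 3)
        + 81 * (u * v * (X * Y)) * (u * Y + v * X)"
      by (simp add: algebra_simps power3_eq_cube)
    have "0 = S 0 + S 1 * (3 * (u * Y + v * X)) + S 2 * (3 * (u * Y + v * X)) ^ 2 + S 3 * (3 * (u * Y + v * X)) ^ 3
        + S 4 * (3 * (u ^ 2 * X + v ^ 2 * Y)) + S 5 * (3 * (u * X ^ 2 + v * Y ^ 2))"
      using eq[of X Y] h by (simp only: XY X3 Y3 simp_thms)
    also have "\<dots> = A r' s' + B r' s' * z + C r' s' * z ^ 2"
      unfolding sq cb unfolding XY X2 Y2 X3 Y3 unfolding X_def Y_def A_def B_def C_def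
      by (simp add: algebra_simps)
    finally show ?thesis by simp
  qed
  note w3 = cube_root_of_unity_cubed[OF w]
  have w6: "(w ^ 2) ^ 3 = 1"
    by (metis power_commutes power_mult power_one mult.commute w3)
  have "(w ^ 2) ^ 2 = w ^ 3 * w"
    by (simp add: power2_eq_square power3_eq_cube mult.assoc)
  then have w4: "(w ^ 2) ^ 2 = w" by (simp add: w3)
  have freq: "A r' s' = 0 \<and> B r' s' = 0 \<and> C r' s' = 0"
    if h: "r' * s' = r * s" "r' ^ 3 + s' ^ 3 = r ^ 3 + s ^ 3" for r' s'
    using fourier3[OF w, of "A r' s'" "B r' s'" "C r' s'"] comb[OF h, of 1] comb[OF h w3] comb[OF h w6]
    unfolding w4 by simp
  have f1: "A r s = 0" "B r s = 0" "C r s = 0" and f2: "A s r = 0" "B s r = 0" "C s r = 0"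
    using freq[of r s] freq[of s r] by (simp_all add: mult.commute add.commute)
  \<comment> \<open>Only the coefficient of \<open>S 3\<close> in \<open>A\<close> changes when
    \<open>r\<close> and \<open>s\<close> are exchanged.\<close>
  have "S 3 * ((u ^ 3 - v ^ 3) * (r ^ 3 - s ^ 3)) = (A s r - A r s) / 27"
    unfolding A_def by (simp add: algebra_simps)
  then have S3: "S 3 = 0" using uv rs f1 f2 by simp
  \<comment> \<open>The matrix with rows \<open>(S 1, S 5)\<close> and \<open>(S 4, 3 S 2)\<close> is annihilated by \<open>(v, u\<^sup>2)\<close>, \<open>(u, v\<^sup>2)\<close> on the left
    together with \<open>(r, s\<^sup>2)\<close>, \<open>(s, r\<^sup>2)\<close> on the right; both pairs are bases.\<close>
  have "v * (S 1 * r + S 5 * s ^ 2) + u ^ 2 * (S 4 * r + 3 * S 2 * s ^ 2) = B r s / 3"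
      "u * (S 1 * r + S 5 * s ^ 2) + v ^ 2 * (S 4 * r + 3 * S 2 * s ^ 2) = C s r / 3"
      "v * (S 1 * s + S 5 * r ^ 2) + u ^ 2 * (S 4 * s + 3 * S 2 * r ^ 2) = B s r / 3"
      "u * (S 1 * s + S 5 * r ^ 2) + v ^ 2 * (S 4 * s + 3 * S 2 * r ^ 2) = C r s / 3"
    unfolding B_def C_def S3 by (simp_all add: field_simps)
  then have 1: "v * (S 1 * r + S 5 * s ^ 2) + u ^ 2 * (S 4 * r + 3 * S 2 * s ^ 2) = 0"
      "u * (S 1 * r + S 5 * s ^ 2) + v ^ 2 * (S 4 * r + 3 * S 2 * s ^ 2) = 0"
      "v * (S 1 * s + S 5 * r ^ 2) + u ^ 2 * (S 4 * s + 3 * S 2 * r ^ 2) = 0"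
      "u * (S 1 * s + S 5 * r ^ 2) + v ^ 2 * (S 4 * s + 3 * S 2 * r ^ 2) = 0"
    by (simp_all only: f1 f2 div_0)
  note pq = solve_two_by_two[OF 1(1,2) uv[symmetric]] solve_two_by_two[OF 1(3,4) uv[symmetric]]
  have 2: "r * S 1 + s ^ 2 * S 5 = 0" "s * S 1 + r ^ 2 * S 5 = 0"
      "r * S 4 + s ^ 2 * (3 * S 2) = 0" "s * S 4 + r ^ 2 * (3 * S 2) = 0"
    using pq by (simp_all add: ac_simps)
  from solve_two_by_two[OF 2(1,2) rs] solve_two_by_two[OF 2(3,4) rs]
  have 3: "S 1 = 0" "S 5 = 0" "S 4 = 0" "S 2 = 0" by simp_all
  then have "S 0 = 0" using f1(1) S3 by (simp add: A_def)
  with 3 S3 show ?thesis by simp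
qed

lemma cube_root_of_unity_exists: "\<exists>w :: complex. w ^ 2 + w + 1 = 0"
proof
  let ?w = "Complex (-1/2) (sqrt 3 / 2)"
  show "?w ^ 2 + ?w + 1 = 0"
    by (simp add: complex_eq_iff power2_eq_square)
qed

lemma complex_root_exists: "n > 0 \<Longrightarrow> \<exists>z :: complex. z ^ n = a"
  by (intro exI[of _ "rcis (root n (cmod a)) (Arg a / n)"]) (simp add: DeMoivre2 rcis_cmod_Arg)

text \<open>Cardano's step: \<open>u ^ 3\<close> and \<open>v ^ 3\<close> are the roots of
  \<open>T ^ 2 - b * T + a ^ 3\<close>. It serves both the parameters of a diagonal pair and the
  roots of a cubic.\<close>

lemma product_and_sum_of_cubes_exist:
  "\<exists>u v :: complex. u * v = a \<and> u ^ 3 + v ^ 3 = b"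
proof -
  obtain d where d: "d ^ 2 = b ^ 2 - 4 * a ^ 3"
    using complex_root_exists[of 2] by auto
  \<comment> \<open>The sign of the square root is chosen so that \<open>b + e = 0\<close> forces
    \<open>b = 0\<close> and \<open>e = 0\<close>; in all other cases \<open>u\<close> is nonzero
    and \<open>v = a / u\<close> makes sense.\<close>
  define e where "e = (if b + d = 0 then - d else d)"
  have e2: "e ^ 2 = b ^ 2 - 4 * a ^ 3" using d by (simp add: e_def)
  obtain u where u: "u ^ 3 = (b + e) / 2"
    using complex_root_exists[of 3 "(b + e) / 2"] by auto
  show ?thesis
  proof (cases "u = 0")
    case True
    then have "b + e = 0" using u by simp
    then have "b = 0 \<and> e = 0" by (auto simp: e_def split: if_splits)
    then have "a ^ 3 = 0" using e2 by simp
    then show ?thesis using \<open>b = 0 \<and> e = 0\<close> by (intro exI[of _ 0]) simp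
  next
    case False
    have "e = 2 * u ^ 3 - b" using u by (simp add: field_simps)
    with e2 have "4 * (u ^ 3 * u ^ 3 + a ^ 3 - b * u ^ 3) = 0"
      by (simp add: algebra_simps power2_eq_square)
    then have *: "u ^ 3 * u ^ 3 + a ^ 3 = b * u ^ 3"
      by (simp only: mult_eq_0_iff right_minus_eq) simp
    have "u ^ 3 + (a / u) ^ 3 = (u ^ 3 * u ^ 3 + a ^ 3) / u ^ 3"
    proof -
      have "t + a ^ 3 / t = (t * t + a ^ 3) / t" if "t \<noteq> 0" for t
        using that by (simp add: add_divide_distrib)
      from this[of "u ^ 3"] show ?thesis using False by (simp add: power_divide)
    qed
    then have "u ^ 3 + (a / u) ^ 3 = b"
      unfolding * using False by simp
    then show ?thesis using False by (intro exI[of _ u] exI[of _ "a / u"]) simp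
  qed
qed

text \<open>The parameters of the first matrix involve only \<open>c\<close>, \<open>u\<close>,
  \<open>v\<close> and those of the second only \<open>d\<close>, \<open>r\<close>,
  \<open>s\<close>, so the problem splits into two independent Cardano problems.\<close>

lemma diag_invariants_surj:
  "\<exists>c d u v r s. \<forall>i \<in> {1, 2, 3, 5, 6, 9}. diag_invariants c d u v r s i = x i"
proof -
  obtain u v where uv: "u * v = x 3 / 6" "u ^ 3 + v ^ 3 = x 6 / 3"
    using product_and_sum_of_cubes_exist by blast
  obtain r s where rs: "r * s = x 5 / 6" "r ^ 3 + s ^ 3 = x 9 / 3"
    using product_and_sum_of_cubes_exist by blast
  have "3 * (x 1 / 3) = x 1" "3 * (x 2 / 3) = x 2" "6 * u * v = x 3" "6 * r * s = x 5"
    "3 * (u ^ 3 + v ^ 3) = x 6" "3 * (r ^ 3 + s ^ 3) = x 9"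
    using uv rs by (simp_all add: field_simps)
  then have "\<forall>i \<in> {1, 2, 3, 5, 6, 9}. diag_invariants (x 1 / 3) (x 2 / 3) u v r s i = x i"
    by (intro ballI, elim insertE emptyE) (simp_all only: diag_invariants_simps)
  then show ?thesis by blast
qed

theorem vanishing_on_diag_imp_Jext:
  assumes p: "p \<in> polys {1..9}"
    and van: "\<And>c d u v r s. poly_eval p (diag_invariants c d u v r s) = 0"
  shows "p \<in> Jext"
proof -
  obtain S where S: "\<forall>k. S k \<in> param_polys" and pS: "p - (\<Sum>k<6. S k * module_basis k) \<in> Jext"
    using all_reducible[OF p] unfolding reducible_def by blast
  obtain w :: complex where w: "w ^ 2 + w + 1 = 0"
    using cube_root_of_unity_exists by blast
  \<comment> \<open>At a diagonal pair the first factor is \<open>54 * (u ^ 3 - v ^ 3) ^ 2\<close>,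
    up to a constant the discriminant of the eigenvalues of the first matrix; likewise for the
    second. So \<open>D\<close> vanishes exactly where \<open>generic_independence\<close> does not
    apply.\<close>
  define D where "D = (6 * var 6 ^ 2 - var 3 ^ 3) * (6 * var 9 ^ 2 - var 5 ^ 3 :: nat cpoly)"
  have Dne: "D \<noteq> 0"
  proof
    assume "D = 0"
    then have "poly_eval D (\<lambda>i. if i = 3 \<or> i = 5 then 0 else 1) = 0" by simp
    then show False by (simp add: D_def)
  qed
  have "S k = 0" if "k < 6" for k
  proof -
    \<comment> \<open>The product can be tested at arbitrary \<open>x\<close>: every value of the
      six parameters is attained, and \<open>S k\<close> and \<open>D\<close> contain no other
      variables.\<close>
    have "poly_eval (S k * D) x = 0" for x
    proof -
      obtain c d u v r s where x: "\<forall>i \<in> {1, 2, 3, 5, 6, 9}. diag_invariants c d u v r s i = x i"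
        using diag_invariants_surj by blast
      have D: "poly_eval D x = 54 ^ 2 * (u ^ 3 - v ^ 3) ^ 2 * (r ^ 3 - s ^ 3) ^ 2"
      proof -
        have e: "x 3 = 6 * u * v" "x 5 = 6 * r * s" "x 6 = 3 * (u ^ 3 + v ^ 3)" "x 9 = 3 * (r ^ 3 + s ^ 3)"
          using x[rule_format, of 3] x[rule_format, of 5] x[rule_format, of 6] x[rule_format, of 9]
          unfolding diag_invariants_simps by simp_all
        have "6 * x 6 ^ 2 - x 3 ^ 3 = 54 * (u ^ 3 - v ^ 3) ^ 2"
          "6 * x 9 ^ 2 - x 5 ^ 3 = 54 * (r ^ 3 - s ^ 3) ^ 2"
          unfolding e by (simp_all add: algebra_simps power2_eq_square power3_eq_cube)
        then show ?thesis by (simp add: D_def)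
      qed
      show ?thesis
      proof (cases "u ^ 3 = v ^ 3 \<or> r ^ 3 = s ^ 3")
        case True
        then show ?thesis using D by auto
      next
        case False
        define \<sigma> where "\<sigma> = (\<lambda>k. poly_eval (S k) x)"
        have "\<sigma> 0 = 0 \<and> \<sigma> 1 = 0 \<and> \<sigma> 2 = 0 \<and> \<sigma> 3 = 0 \<and> \<sigma> 4 = 0 \<and> \<sigma> 5 = 0"
        proof (rule generic_independence[OF w])
          show "u ^ 3 \<noteq> v ^ 3" "r ^ 3 \<noteq> s ^ 3" using False by simp_all
        next
          fix r' s' assume h: "r' * s' = r * s" "r' ^ 3 + s' ^ 3 = r ^ 3 + s ^ 3"
          let ?y = "diag_invariants c d u v r' s'"
          have y: "?y i = x i" if "i \<in> {1, 2, 3, 5, 6, 9}" for i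
          proof -
            have "?y i = diag_invariants c d u v r s i"
              using that h by (auto simp: diag_invariants_simps mult.assoc)
            then show ?thesis using x[rule_format, OF that] by simp
          qed
          have sy: "poly_eval (S k) ?y = \<sigma> k" for k
            unfolding \<sigma>_def using S y by (intro poly_eval_cong[of _ "{1, 2, 3, 5, 6, 9}"]) auto
          have "poly_eval (p - (\<Sum>k<6. S k * module_basis k)) ?y = 0"
            by (rule Jext_vanishes_on_diag[OF pS])
          then have "(\<Sum>k<6. \<sigma> k * poly_eval (module_basis k) ?y) = 0"
            by (simp add: van sy)
          moreover have "{..<6::nat} = {0, 1, 2, 3, 4, 5}" by auto
          moreover have "poly_eval (module_basis 0) ?y = 1" "poly_eval (module_basis 1) ?y = 3 * (u * s' + v * r')"
            "poly_eval (module_basis 2) ?y = (3 * (u * s' + v * r')) ^ 2"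
            "poly_eval (module_basis 3) ?y = (3 * (u * s' + v * r')) ^ 3"
            "poly_eval (module_basis 4) ?y = 3 * (u ^ 2 * r' + v ^ 2 * s')"
            "poly_eval (module_basis 5) ?y = 3 * (u * r' ^ 2 + v * s' ^ 2)"
            by (simp_all add: module_basis_def diag_invariants_simps)
          ultimately show "\<sigma> 0 + \<sigma> 1 * (3 * (u * s' + v * r')) + \<sigma> 2 * (3 * (u * s' + v * r')) ^ 2
            + \<sigma> 3 * (3 * (u * s' + v * r')) ^ 3
            + \<sigma> 4 * (3 * (u ^ 2 * r' + v ^ 2 * s')) + \<sigma> 5 * (3 * (u * r' ^ 2 + v * s' ^ 2)) = 0"
            by (simp add: add.assoc del: distrib_left_numeral distrib_right_numeral)
        qed
        moreover have "k \<in> {0, 1, 2, 3, 4, 5}" using that by auto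
        ultimately have "\<sigma> k = 0" by auto
        then show ?thesis by (simp add: \<sigma>_def)
      qed
    qed
    then have "S k * D = 0" by (rule poly_eval_eq_zero)
    then show ?thesis using Dne by simp
  qed
  with pS show ?thesis by simp
qed

section \<open>Degeneration of a commuting pair to a diagonal pair\<close>

lemma matrix_inv_inverse:
  fixes g :: "complex^'n^'n"
  assumes "invertible g"
  shows "g ** matrix_inv g = mat 1" "matrix_inv g ** g = mat 1"
proof -
  have "g ** matrix_inv g = mat 1 \<and> matrix_inv g ** g = mat 1"
    unfolding matrix_inv_def using assms unfolding invertible_def by (rule someI_ex)
  then show "g ** matrix_inv g = mat 1" "matrix_inv g ** g = mat 1" by auto
qed

text \<open>Reduces a conjugation to an intertwining equation, so that the inverse of an explicit
  \<open>g\<close> never has to be written down.\<close>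

lemma conj_eqI:
  fixes g :: mat3
  assumes "invertible g" "g ** X = X' ** g"
  shows "g ** X ** matrix_inv g = X'"
  using assms by (simp add: matrix_inv_inverse flip: matrix_mul_assoc)

lemma mult_smult_vec: "(A :: complex^'n^'m) *v (c *s x) = c *s (A *v x)"
  by (simp add: matrix_vector_mult_def vec_eq_iff sum_distrib_left ac_simps)

text \<open>Cardano's formula: the roots are \<open>c + u + v\<close>,
  \<open>c + w * u + w ^ 2 * v\<close> and \<open>c + w ^ 2 * u + w * v\<close>, with
  \<open>w ^ 2\<close> replaced by \<open>- 1 - w\<close>.\<close>

lemma cubic_roots_exist:
  "\<exists>x y z :: complex. x + y + z = e1 \<and> x * y + x * z + y * z = e2 \<and> x * y * z = e3"
proof -
  obtain w :: complex where w: "w ^ 2 + w + 1 = 0"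
    using cube_root_of_unity_exists by blast
  define c where "c = e1 / 3"
  \<comment> \<open>The elementary symmetric functions of the three roots are \<open>3 * c\<close>,
    \<open>3 * c ^ 2 - 3 * (u * v)\<close> and
    \<open>c ^ 3 + (u ^ 3 + v ^ 3) - 3 * c * (u * v)\<close>; solving for \<open>e2\<close> and
    \<open>e3\<close> gives these two values.\<close>
  obtain u v where uv: "u * v = (3 * c ^ 2 - e2) / 3" "u ^ 3 + v ^ 3 = e3 - c ^ 3 + 3 * c * ((3 * c ^ 2 - e2) / 3)"
    using product_and_sum_of_cubes_exist by blast
  have w2: "w ^ 2 = - 1 - w" using w by (simp add: eq_neg_iff_add_eq_0 algebra_simps)
  define p where "p = w * u + (- 1 - w) * v"
  define q where "q = (- 1 - w) * u + w * v"
  have pq: "p + q = - (u + v)" by (simp add: p_def q_def algebra_simps)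
  have "p * q = (- w - w ^ 2) * (u ^ 2 + v ^ 2) + (2 * w ^ 2 + 2 * w + 1) * (u * v)"
    by (simp add: p_def q_def algebra_simps power2_eq_square)
  then have pq2: "p * q = u ^ 2 + v ^ 2 - u * v" unfolding w2 by simp
  let ?x = "c + u + v" and ?y = "c + p" and ?z = "c + q"
  have "?y + ?z = 2 * c + (p + q)" by simp
  then have yz: "?y + ?z = 2 * c - (u + v)"
    unfolding pq by simp
  have "?y * ?z = c ^ 2 + c * (p + q) + p * q"
    by (simp add: algebra_simps power2_eq_square)
  then have yz2: "?y * ?z = c ^ 2 - c * (u + v) + (u ^ 2 + v ^ 2 - u * v)"
    unfolding pq pq2 by (simp add: algebra_simps)
  have "?x + ?y + ?z = ?x + (?y + ?z)" by (simp only: add.assoc)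
  then have "?x + ?y + ?z = 3 * c" unfolding yz by (simp add: algebra_simps)
  moreover have "?x * ?y + ?x * ?z + ?y * ?z = ?x * (?y + ?z) + ?y * ?z"
    by (simp only: distrib_left)
  then have "?x * ?y + ?x * ?z + ?y * ?z = 3 * c ^ 2 - 3 * (u * v)"
    unfolding yz yz2 by (simp add: algebra_simps power2_eq_square)
  moreover have "?x * ?y * ?z = ?x * (?y * ?z)" by (simp only: mult.assoc)
  then have "?x * ?y * ?z = c ^ 3 + (u ^ 3 + v ^ 3) - 3 * c * (u * v)"
    unfolding yz2 by (simp add: algebra_simps power2_eq_square power3_eq_cube)
  moreover have "3 * c = e1" "3 * c ^ 2 - 3 * (u * v) = e2" "c ^ 3 + (u ^ 3 + v ^ 3) - 3 * c * (u * v) = e3"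
    unfolding uv by (simp_all add: c_def field_simps)
  ultimately have "?x + ?y + ?z = e1 \<and> ?x * ?y + ?x * ?z + ?y * ?z = e2 \<and> ?x * ?y * ?z = e3"
    by (simp only: simp_thms)
  then show ?thesis by blast
qed

lemma cayley_hamilton_3:
  fixes Y :: mat3
  defines "e1 \<equiv> Y$1$1 + Y$2$2 + Y$3$3"
    and "e2 \<equiv> Y$1$1 * Y$2$2 - Y$1$2 * Y$2$1 + (Y$1$1 * Y$3$3 - Y$1$3 * Y$3$1) + (Y$2$2 * Y$3$3 - Y$2$3 * Y$3$2)"
    and "e3 \<equiv> Y$1$1 * (Y$2$2 * Y$3$3 - Y$2$3 * Y$3$2) - Y$1$2 * (Y$2$1 * Y$3$3 - Y$2$3 * Y$3$1)
      + Y$1$3 * (Y$2$1 * Y$3$2 - Y$2$2 * Y$3$1)"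
  shows "Y *v (Y *v (Y *v v)) - e1 *s (Y *v (Y *v v)) + e2 *s (Y *v v) - e3 *s v = 0"
  unfolding e1_def e2_def e3_def
  by (simp add: vec_eq_iff forall_3 matrix_vector_mult_def sum_3 algebra_simps)

text \<open>Split the characteristic polynomial into linear factors and apply them to
  \<open>n\<close> one after the other: their product annihilates \<open>n\<close>, so the last
  nonzero vector reached is an eigenvector. \<open>P\<close> stands for an invariant subspace, in
  the form of stability under all \<open>Y - \<mu>\<close>.\<close>

lemma eigenvector_exists:
  fixes Y :: mat3
  assumes "n \<noteq> 0" "P n" and closed: "\<And>v \<mu>. P v \<Longrightarrow> P (Y *v v - \<mu> *s v)"
  obtains v \<mu> where "v \<noteq> 0" "P v" "Y *v v = \<mu> *s v"
proof -
  obtain e1 e2 e3 where ch: "\<And>v. Y *v (Y *v (Y *v v)) - e1 *s (Y *v (Y *v v)) + e2 *s (Y *v v) - e3 *s v = 0"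
    using cayley_hamilton_3 by blast
  obtain a b c where abc: "a + b + c = e1" "a * b + a * c + b * c = e2" "a * b * c = e3"
    using cubic_roots_exist by blast
  define n1 where "n1 = Y *v n - c *s n"
  define n2 where "n2 = Y *v n1 - b *s n1"
  have "Y *v n2 - a *s n2 = Y *v (Y *v (Y *v n)) - e1 *s (Y *v (Y *v n)) + e2 *s (Y *v n) - e3 *s n"
    unfolding n2_def n1_def abc[symmetric] matrix_vector_mult_diff_distrib mult_smult_vec
    by (simp add: vec_eq_iff algebra_simps)
  then have n3: "Y *v n2 = a *s n2" using ch by simp
  have P1: "P n1" unfolding n1_def by (intro closed assms)
  have P2: "P n2" unfolding n2_def by (intro closed P1)
  show thesis
  proof (cases "n1 = 0")
    case True
    then show thesis using that[of n c] assms by (simp add: n1_def)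
  next
    case False
    show thesis
    proof (cases "n2 = 0")
      case True
      then show thesis using that[of n1 b] False P1 by (simp add: n2_def)
    next
      case False
      then show thesis using that[of n2 a] P2 n3 by simp
    qed
  qed
qed

text \<open>An eigenspace of \<open>X\<close> is stable under \<open>Y\<close> by commutation, so
  \<open>eigenvector_exists\<close> applies a second time with the eigenspace condition added to
  \<open>P\<close>.\<close>

lemma common_eigenvector_exists:
  fixes X Y :: mat3
  assumes comm: "X ** Y = Y ** X" and "n \<noteq> 0" "P n"
    and closed: "\<And>v \<mu>. P v \<Longrightarrow> P (X *v v - \<mu> *s v)" "\<And>v \<mu>. P v \<Longrightarrow> P (Y *v v - \<mu> *s v)"
  obtains v \<alpha> \<mu> where "v \<noteq> 0" "P v" "X *v v = \<alpha> *s v" "Y *v v = \<mu> *s v"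
proof -
  obtain v1 \<alpha> where v1: "v1 \<noteq> 0" "P v1" "X *v v1 = \<alpha> *s v1"
    using eigenvector_exists[of n P X] assms by blast
  have "X *v (Y *v v - \<mu> *s v) = \<alpha> *s (Y *v v - \<mu> *s v)" if "X *v v = \<alpha> *s v" for v \<mu>
  proof -
    have "X *v (Y *v v) = Y *v (X *v v)"
      by (simp add: matrix_vector_mul_assoc comm)
    then show ?thesis using that
      by (simp add: matrix_vector_mult_diff_distrib mult_smult_vec vec_eq_iff algebra_simps)
  qed
  then obtain v \<mu> where "v \<noteq> 0" "P v \<and> X *v v = \<alpha> *s v" "Y *v v = \<mu> *s v"
    using eigenvector_exists[of v1 "\<lambda>v. P v \<and> X *v v = \<alpha> *s v" Y] v1 closed(2) by blast
  then show thesis using that by blast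
qed

text \<open>The bilinear pairing, without complex conjugation, because \<open>r\<close> plays the
  role of a linear form and is moved by transposes.\<close>

definition dot :: "complex^3 \<Rightarrow> complex^3 \<Rightarrow> complex" where
  "dot r v = (\<Sum>i\<in>UNIV. r $ i * v $ i)"

lemma dot_transpose: "dot r (A *v v) = dot (transpose A *v r) v"
  by (simp add: dot_def matrix_vector_mult_def transpose_def sum_3 algebra_simps)

text \<open>A common eigenvector in the kernel of a common eigenform, that is, an invariant complete flag.\<close>

definition invariant_flag :: "mat3 \<times> mat3 \<Rightarrow> complex^3 \<Rightarrow> complex^3 \<Rightarrow> bool" where
  "invariant_flag Z w r \<longleftrightarrow> w \<noteq> 0 \<and> r \<noteq> 0 \<and> dot r w = 0 \<and>
    (\<exists>a. fst Z *v w = a *s w) \<and> (\<exists>a. snd Z *v w = a *s w) \<and>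
    (\<exists>a. transpose (fst Z) *v r = a *s r) \<and> (\<exists>a. transpose (snd Z) *v r = a *s r)"

text \<open>The transposes commute as well, and a common eigenvector \<open>r\<close> of them is a
  common eigenform. Its kernel is an invariant plane, in which the common eigenvector
  \<open>w\<close> is sought.\<close>

lemma invariant_flag_exists:
  assumes comm: "X ** Y = Y ** (X :: mat3)"
  obtains w r where "invariant_flag (X, Y) w r"
proof -
  have "transpose X ** transpose Y = transpose Y ** transpose X"
    using comm by (simp flip: matrix_transpose_mul)
  then obtain r \<alpha> \<mu> where r: "r \<noteq> 0" "transpose X *v r = \<alpha> *s r" "transpose Y *v r = \<mu> *s r"
    using common_eigenvector_exists[of "transpose X" "transpose Y" 1 "\<lambda>_. True"] by auto
  \<comment> \<open>A nonzero vector in the kernel of \<open>r\<close>, from which the search inside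
    that plane starts.\<close>
  define n :: "complex^3" where "n = (if r $ 1 = 0 then vector [1, 0, 0] else vector [r $ 2, - r $ 1, 0])"
  have "n \<noteq> 0" "dot r n = 0"
    by (auto simp: n_def dot_def sum_3 vec_eq_iff forall_3)
  have diff: "dot r (A *v v - \<nu> *s v) = 0" if "transpose A *v r = \<kappa> *s r" "dot r v = 0" for A \<kappa> \<nu> v
  proof -
    have "dot r (A *v v - \<nu> *s v) = dot r (A *v v) - \<nu> * dot r v"
      by (simp add: dot_def sum_3 algebra_simps)
    also have "dot r (A *v v) = \<kappa> * dot r v"
      unfolding dot_transpose that(1) by (simp add: dot_def sum_3 algebra_simps)
    finally show ?thesis using that(2) by simp
  qed
  obtain w where "w \<noteq> 0" "dot r w = 0" "\<exists>a. X *v w = a *s w" "\<exists>a. Y *v w = a *s w"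
    using common_eigenvector_exists[of X Y n "\<lambda>v. dot r v = 0"] comm \<open>n \<noteq> 0\<close> \<open>dot r n = 0\<close>
      diff[OF r(2)] diff[OF r(3)] by metis
  with r that show thesis unfolding invariant_flag_def by auto
qed

text \<open>Vectors move by \<open>g\<close> and forms by the contragredient; this preserves the
  pairing and all eigenvalues.\<close>

lemma invariant_flag_conj:
  assumes "invariant_flag Z w r" "invertible g"
  shows "invariant_flag (simultaneous_conj g Z) (g *v w) (transpose (matrix_inv g) *v r)"
proof -
  obtain X Y where Z: "Z = (X, Y)" by force
  note inv = matrix_inv_inverse[OF assms(2)]
  have cancel: "matrix_inv g *v (g *v v) = v" "transpose g *v (transpose (matrix_inv g) *v v) = v" for v
    by (simp_all only: matrix_vector_mul_assoc matrix_transpose_mul[symmetric] inv transpose_mat matrix_vector_mul_lid)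
  have "g *v w \<noteq> 0" "transpose (matrix_inv g) *v r \<noteq> 0"
    using assms(1) cancel(1)[of w] cancel(2)[of r] by (auto simp: invariant_flag_def)
  moreover have "dot (transpose (matrix_inv g) *v r) (g *v w) = dot r w"
    by (simp only: dot_transpose[symmetric] cancel)
  moreover have "(g ** A ** matrix_inv g) *v (g *v w) = a *s (g *v w)" if "A *v w = a *s w" for A a
    by (simp only: cancel mult_smult_vec that flip: matrix_vector_mul_assoc)
  moreover have "transpose (g ** A ** matrix_inv g) *v (transpose (matrix_inv g) *v r)
      = a *s (transpose (matrix_inv g) *v r)" if "transpose A *v r = a *s r" for A a
    by (simp only: matrix_transpose_mul cancel mult_smult_vec that flip: matrix_vector_mul_assoc)
  ultimately show ?thesis using assms(1)
    unfolding invariant_flag_def Z simultaneous_conj_def by auto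
qed

section \<open>Bringing an invariant flag into standard position\<close>

lemma invertibleI_ker: "(\<And>x. (A :: mat3) *v x = 0 \<Longrightarrow> x = 0) \<Longrightarrow> invertible A"
  using invertible_left_inverse matrix_left_invertible_ker by blast

text \<open>Take the inverse of a matrix with first column \<open>w\<close>. The other columns are
  two standard basis vectors, omitting the index of a nonzero coordinate of
  \<open>w\<close>.\<close>

lemma moves_to_first_axis:
  fixes w :: "complex^3"
  assumes "w \<noteq> 0"
  obtains g :: mat3 where "invertible g" "g *v w = vector [1, 0, 0]"
proof -
  have "\<exists>h :: mat3. invertible h \<and> h *v vector [1, 0, 0] = w"
  proof -
    define h :: "complex^3 \<Rightarrow> complex^3 \<Rightarrow> mat3"
      where "h b c = vector [vector [w$1, b$1, c$1], vector [w$2, b$2, c$2], vector [w$3, b$3, c$3]]" for b c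
    have h1: "h b c *v vector [1, 0, 0] = w" for b c
      by (simp add: h_def matrix_vector_mult_def vec_eq_iff forall_3 sum_3)
    consider "w $ 1 \<noteq> 0" | "w $ 2 \<noteq> 0" | "w $ 3 \<noteq> 0"
      using assms by (auto simp: vec_eq_iff forall_3)
    then show ?thesis
    proof cases
      case 1
      then have "invertible (h (vector [0, 1, 0]) (vector [0, 0, 1]))"
        by (intro invertibleI_ker) (auto simp: h_def matrix_vector_mult_def vec_eq_iff forall_3 sum_3)
      then show ?thesis using h1 by blast
    next
      case 2
      then have "invertible (h (vector [1, 0, 0]) (vector [0, 0, 1]))"
        by (intro invertibleI_ker) (auto simp: h_def matrix_vector_mult_def vec_eq_iff forall_3 sum_3)
      then show ?thesis using h1 by blast
    next
      case 3
      then have "invertible (h (vector [1, 0, 0]) (vector [0, 1, 0]))"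
        by (intro invertibleI_ker) (auto simp: h_def matrix_vector_mult_def vec_eq_iff forall_3 sum_3)
      then show ?thesis using h1 by blast
    qed
  qed
  then obtain h :: mat3 where h: "invertible h" "h *v vector [1, 0, 0] = w" by blast
  have "matrix_inv h *v w = vector [1, 0, 0]"
    by (simp add: h(2)[symmetric] matrix_vector_mul_assoc matrix_inv_inverse[OF h(1)])
  moreover have "invertible (matrix_inv h)"
    unfolding invertible_def using matrix_inv_inverse[OF h(1)] by blast
  ultimately show thesis using that by blast
qed

lemma moves_form_to_last_axis:
  fixes r :: "complex^3"
  assumes "r \<noteq> 0" "r $ 1 = 0"
  obtains g :: mat3 where "invertible g" "g *v vector [1, 0, 0] = vector [1, 0, 0]"
    "transpose (matrix_inv g) *v r = vector [0, 0, 1]"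
proof -
  \<comment> \<open>The second row of \<open>g\<close> is the second or third standard basis vector,
    whichever completes the first one and \<open>r\<close> to a basis. The condition
    \<open>r $ 1 = 0\<close> keeps the first axis fixed.\<close>
  define a :: complex where "a = (if r $ 3 \<noteq> 0 then 1 else 0)"
  define g :: mat3 where "g = vector [vector [1, 0, 0], vector [0, a, 1 - a], r]"
  have r23: "r $ 2 \<noteq> 0 \<or> r $ 3 \<noteq> 0"
    using assms by (auto simp: vec_eq_iff forall_3)
  have inv: "invertible g"
    using r23 assms(2)
    by (intro invertibleI_ker) (auto simp: g_def a_def matrix_vector_mult_def vec_eq_iff forall_3 sum_3 split: if_splits)
  have "transpose g *v vector [0, 0, 1] = r"
    by (simp add: g_def matrix_vector_mult_def transpose_def vec_eq_iff forall_3 sum_3)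
  then have "transpose (matrix_inv g) *v r = transpose (matrix_inv g) *v (transpose g *v vector [0, 0, 1])"
    by simp
  also have "\<dots> = vector [0, 0, 1]"
    by (simp only: matrix_vector_mul_assoc matrix_transpose_mul[symmetric] matrix_inv_inverse[OF inv]
        transpose_mat matrix_vector_mul_lid)
  finally have "transpose (matrix_inv g) *v r = vector [0, 0, 1]" .
  moreover have "g *v vector [1, 0, 0] = vector [1, 0, 0]"
    using assms(2) by (simp add: g_def matrix_vector_mult_def vec_eq_iff forall_3 sum_3)
  ultimately show thesis using inv that by blast
qed

definition upper_triangular :: "mat3 \<Rightarrow> bool" where
  "upper_triangular U \<longleftrightarrow> U $ 2 $ 1 = 0 \<and> U $ 3 $ 1 = 0 \<and> U $ 3 $ 2 = 0"

lemma conj_mult: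
  fixes g :: mat3
  assumes "invertible g"
  shows "(g ** A ** matrix_inv g) ** (g ** B ** matrix_inv g) = g ** (A ** B) ** matrix_inv g"
proof -
  have "(g ** A ** matrix_inv g) ** (g ** B ** matrix_inv g) = g ** A ** (matrix_inv g ** g) ** B ** matrix_inv g"
    by (simp add: matrix_mul_assoc)
  then show ?thesis by (simp add: matrix_inv_inverse[OF assms] matrix_mul_assoc)
qed

lemma simultaneous_conj_commute:
  assumes "Z \<in> commuting_variety" "invertible g"
  shows "simultaneous_conj g Z \<in> commuting_variety"
proof -
  obtain X Y where Z: "Z = (X, Y)" by force
  show ?thesis
    using assms(1) by (simp add: Z simultaneous_conj_def commuting_variety_def conj_mult[OF assms(2)])
qed

lemma flag_imp_upper_triangular:
  assumes "invariant_flag (X, Y) (vector [1, 0, 0]) (vector [0, 0, 1])"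
  shows "upper_triangular X" "upper_triangular Y"
proof -
  have *: "upper_triangular A"
    if "A *v vector [1, 0, 0] = a *s vector [1, 0, 0]" "transpose A *v vector [0, 0, 1] = b *s vector [0, 0, 1]"
    for A :: mat3 and a b
  proof -
    have "(A *v vector [1, 0, 0]) $ 2 = 0" "(A *v vector [1, 0, 0]) $ 3 = 0"
      "(transpose A *v vector [0, 0, 1]) $ 2 = 0"
      unfolding that by simp_all
    then show ?thesis
      unfolding upper_triangular_def matrix_vector_mult_def transpose_def by (simp add: sum_3)
  qed
  show "upper_triangular X" "upper_triangular Y"
    using assms unfolding invariant_flag_def fst_conv snd_conv by (blast intro: *)+
qed

text \<open>One matrix puts the eigenvector on the first axis, the other puts the form on the last
  axis while fixing the first. They are kept separate since invariance can be applied once for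
  each.\<close>

lemma simultaneously_triangularizable:
  assumes "Z \<in> commuting_variety"
  obtains g h X Y where "invertible g" "invertible h"
    "simultaneous_conj h (simultaneous_conj g Z) = (X, Y)" "upper_triangular X" "upper_triangular Y"
proof -
  obtain A B where Z: "Z = (A, B)" by force
  with assms have "A ** B = B ** A" by (simp add: commuting_variety_def)
  then obtain w r where "invariant_flag (A, B) w r" by (rule invariant_flag_exists)
  then have wr: "invariant_flag Z w r" by (simp only: Z)
  then have "w \<noteq> 0" by (simp add: invariant_flag_def)
  then obtain g :: mat3 where g: "invertible g" "g *v w = vector [1, 0, 0]"
    by (rule moves_to_first_axis)
  define r1 where "r1 = transpose (matrix_inv g) *v r"
  have fl: "invariant_flag (simultaneous_conj g Z) (vector [1, 0, 0]) r1"
    using invariant_flag_conj[OF wr g(1)] by (simp only: g(2) r1_def)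
  then have "r1 \<noteq> 0" "dot r1 (vector [1, 0, 0]) = 0"
    unfolding invariant_flag_def by blast+
  then have "r1 \<noteq> 0" "r1 $ 1 = 0"
    by (simp_all add: dot_def sum_3)
  then obtain h :: mat3 where h: "invertible h" "h *v vector [1, 0, 0] = vector [1, 0, 0]"
    "transpose (matrix_inv h) *v r1 = vector [0, 0, 1]"
    by (rule moves_form_to_last_axis)
  obtain X Y where XY: "simultaneous_conj h (simultaneous_conj g Z) = (X, Y)" by force
  have "invariant_flag (X, Y) (vector [1, 0, 0]) (vector [0, 0, 1])"
    using invariant_flag_conj[OF fl h(1)] by (simp only: h XY)
  from that[OF g(1) h(1) XY flag_imp_upper_triangular[OF this]] show thesis .
qed

definition diag3 :: "complex \<Rightarrow> complex \<Rightarrow> complex \<Rightarrow> mat3" where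
  "diag3 x y z = vector [vector [x, 0, 0], vector [0, y, 0], vector [0, 0, z]]"

text \<open>For nonzero \<open>t\<close> and upper triangular \<open>U\<close> this is the conjugate
  of \<open>U\<close> by \<open>diag3 (t ^ 2) t 1\<close>. Its entries are polynomials in
  \<open>t\<close>, so it extends to \<open>t = 0\<close>, where there is no conjugating
  matrix.\<close>

definition contract :: "complex \<Rightarrow> mat3 \<Rightarrow> mat3" where
  "contract t U = vector [vector [U$1$1, t * U$1$2, t ^ 2 * U$1$3], vector [0, U$2$2, t * U$2$3], vector [0, 0, U$3$3]]"

lemma contract_conj:
  assumes "upper_triangular X" "upper_triangular Y" "t \<noteq> 0"
  shows "invertible (diag3 (t ^ 2) t 1)"
    "simultaneous_conj (diag3 (t ^ 2) t 1) (X, Y) = (contract t X, contract t Y)"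
proof -
  show inv: "invertible (diag3 (t ^ 2) t 1)"
    using assms(3) by (intro invertibleI_ker) (auto simp: diag3_def matrix_vector_mult_def vec_eq_iff forall_3 sum_3)
  have "diag3 (t ^ 2) t 1 ** U = contract t U ** diag3 (t ^ 2) t 1" if "upper_triangular U" for U
    using that by (simp add: diag3_def contract_def upper_triangular_def matrix_matrix_mult_def
        vec_eq_iff forall_3 sum_3 power2_eq_square)
  from conj_eqI[OF inv this[OF assms(1)]] conj_eqI[OF inv this[OF assms(2)]]
  show "simultaneous_conj (diag3 (t ^ 2) t 1) (X, Y) = (contract t X, contract t Y)"
    by (simp add: simultaneous_conj_def)
qed

lemma contract_0: "contract 0 U = diag3 (U$1$1) (U$2$2) (U$3$3)"
  by (simp add: contract_def diag3_def)

lemma continuous_contract: "continuous_on UNIV (\<lambda>t. poly_eval p (entry (contract t X, contract t Y)))"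
proof -
  have c: "continuous_on UNIV (\<lambda>t. contract t U $ i $ j)" for U i j
    using exhaust_3[of i] exhaust_3[of j]
    by (auto simp: contract_def intro!: continuous_intros)
  have "continuous_on UNIV (\<lambda>t. entry (contract t X, contract t Y) k)" for k
    by (cases k) (auto simp: c)
  then show ?thesis unfolding poly_eval_def
    by (intro continuous_intros) auto
qed

text \<open>Invariance is demanded on commuting pairs only: a polynomial that represents an
  invariant regular function need not be invariant at other pairs.\<close>

definition invariant_on_commuting :: "(mat3 \<times> mat3 \<Rightarrow> complex) \<Rightarrow> bool" where
  "invariant_on_commuting f \<longleftrightarrow>
    (\<forall>g Z. invertible g \<longrightarrow> Z \<in> commuting_variety \<longrightarrow> f (simultaneous_conj g Z) = f Z)"

text \<open>The diagonal pair depends on \<open>Z\<close> alone and serves every invariant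
  polynomial, so that two of them can be compared at the same diagonal pair.\<close>

lemma degenerates_to_diagonal:
  assumes "Z \<in> commuting_variety"
  obtains x1 x2 x3 y1 y2 y3 where
    "\<And>p. invariant_on_commuting (\<lambda>Z. poly_eval p (entry Z)) \<Longrightarrow>
      poly_eval p (entry Z) = poly_eval p (entry (diag3 x1 x2 x3, diag3 y1 y2 y3))"
proof -
  obtain g h X Y where gh: "invertible g" "invertible h"
    "simultaneous_conj h (simultaneous_conj g Z) = (X, Y)" "upper_triangular X" "upper_triangular Y"
    using simultaneously_triangularizable[OF assms] by blast
  have V: "simultaneous_conj g Z \<in> commuting_variety"
    using simultaneous_conj_commute[OF assms gh(1)] .
  have V': "(X, Y) \<in> commuting_variety"
    using simultaneous_conj_commute[OF V gh(2)] gh(3) by simp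
  have "poly_eval p (entry Z) = poly_eval p (entry (contract 0 X, contract 0 Y))"
    if inv: "invariant_on_commuting (\<lambda>Z. poly_eval p (entry Z))" for p
  proof -
    let ?F = "\<lambda>t. poly_eval p (entry (contract t X, contract t Y))"
    have I: "poly_eval p (entry (simultaneous_conj g Z)) = poly_eval p (entry Z)"
      if "invertible g" "Z \<in> commuting_variety" for g Z
      using inv that unfolding invariant_on_commuting_def by blast
    have XY: "poly_eval p (entry (X, Y)) = poly_eval p (entry Z)"
      using I[OF gh(2) V] I[OF gh(1) assms] gh(3) by simp
    \<comment> \<open>Away from 0 the function is constant by invariance; continuity extends its
      value to 0.\<close>
    have "?F t = poly_eval p (entry Z)" if "t \<noteq> 0" for t
      using I[OF contract_conj(1) V', OF gh(4,5) that] contract_conj(2)[OF gh(4,5) that] XY by simp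
    then have "\<forall>\<^sub>F t in at 0. ?F t = poly_eval p (entry Z)"
      by (simp add: eventually_at_filter)
    then have "(?F \<longlongrightarrow> poly_eval p (entry Z)) (at 0)"
      by (rule tendsto_eventually)
    moreover have "(?F \<longlongrightarrow> ?F 0) (at 0)"
      using continuous_contract[of p X Y] by (simp add: continuous_on_def)
    ultimately show ?thesis
      by (rule tendsto_unique[rotated]) simp
  qed
  then show thesis using that unfolding contract_0 by blast
qed

section \<open>The trace invariants generate the invariant functions\<close>

definition is_polynomial :: "(mat3 \<times> mat3 \<Rightarrow> complex) \<Rightarrow> bool" where
  "is_polynomial f \<longleftrightarrow> (\<exists>p. \<forall>Z. f Z = poly_eval p (entry Z))"

lemma is_polynomial_const: "is_polynomial (\<lambda>Z. c)"
  unfolding is_polynomial_def by (intro exI[of _ "single 0 c"]) simp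

lemma is_polynomial_add: "is_polynomial f \<Longrightarrow> is_polynomial h \<Longrightarrow> is_polynomial (\<lambda>Z. f Z + h Z)"
  unfolding is_polynomial_def by (metis poly_eval_add)

lemma is_polynomial_diff: "is_polynomial f \<Longrightarrow> is_polynomial h \<Longrightarrow> is_polynomial (\<lambda>Z. f Z - h Z)"
  unfolding is_polynomial_def by (metis poly_eval_diff)

lemma is_polynomial_mult: "is_polynomial f \<Longrightarrow> is_polynomial h \<Longrightarrow> is_polynomial (\<lambda>Z. f Z * h Z)"
  unfolding is_polynomial_def by (metis poly_eval_mult)

lemma is_polynomial_entry: "is_polynomial (\<lambda>Z. entry Z k)"
  unfolding is_polynomial_def by (intro exI[of _ "var k"]) simp

definition polynomial_matrix :: "(mat3 \<times> mat3 \<Rightarrow> mat3) \<Rightarrow> bool" where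
  "polynomial_matrix M \<longleftrightarrow> (\<forall>i j. is_polynomial (\<lambda>Z. M Z $ i $ j))"

lemma polynomial_matrix_fst: "polynomial_matrix fst" and polynomial_matrix_snd: "polynomial_matrix snd"
proof -
  have "(\<lambda>Z. fst Z $ i $ j) = (\<lambda>Z. entry Z (Inl (i, j)))" "(\<lambda>Z. snd Z $ i $ j) = (\<lambda>Z. entry Z (Inr (i, j)))" for i j
    by (auto simp: fun_eq_iff)
  then show "polynomial_matrix fst" "polynomial_matrix snd"
    by (simp_all add: polynomial_matrix_def is_polynomial_entry)
qed

lemma polynomial_matrix_mult:
  "polynomial_matrix M \<Longrightarrow> polynomial_matrix N \<Longrightarrow> polynomial_matrix (\<lambda>Z. M Z ** N Z)"
  unfolding polynomial_matrix_def matrix_matrix_mult_def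
  by (simp add: sum_3 is_polynomial_add is_polynomial_mult)

lemma polynomial_matrix_trace: "polynomial_matrix M \<Longrightarrow> is_polynomial (\<lambda>Z. trace (M Z))"
  unfolding polynomial_matrix_def trace_def by (simp add: sum_3 is_polynomial_add)

definition traceless :: "mat3 \<Rightarrow> mat3" where
  "traceless X = X - mat (trace X / 3)"

lemma polynomial_matrix_traceless:
  assumes "polynomial_matrix M"
  shows "polynomial_matrix (\<lambda>Z. traceless (M Z))"
proof -
  have "is_polynomial (\<lambda>Z. trace (M Z) * (1/3))"
    by (intro is_polynomial_mult is_polynomial_const polynomial_matrix_trace assms)
  then have "is_polynomial (\<lambda>Z. mat (trace (M Z) / 3) $ i $ j)" for i j :: 3
    by (cases "i = j") (simp_all add: mat_def is_polynomial_const)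
  then show ?thesis
    using assms unfolding polynomial_matrix_def traceless_def by (simp add: is_polynomial_diff)
qed

lemma trace_invariant_simps:
  "trace_invariant 1 (X, Y) = trace X"
  "trace_invariant 2 (X, Y) = trace Y"
  "trace_invariant 3 (X, Y) = trace (traceless X ** traceless X)"
  "trace_invariant 4 (X, Y) = trace (traceless X ** traceless Y)"
  "trace_invariant 5 (X, Y) = trace (traceless Y ** traceless Y)"
  "trace_invariant 6 (X, Y) = trace (traceless X ** traceless X ** traceless X)"
  "trace_invariant 7 (X, Y) = trace (traceless X ** traceless X ** traceless Y)"
  "trace_invariant 8 (X, Y) = trace (traceless X ** traceless Y ** traceless Y)"
  "trace_invariant 9 (X, Y) = trace (traceless Y ** traceless Y ** traceless Y)"
  by (simp_all add: trace_invariant_def Let_def traceless_def)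

lemma index_cases:
  assumes "i \<in> {1..9::nat}"
  obtains "i = 1" | "i = 2" | "i = 3" | "i = 4" | "i = 5" | "i = 6" | "i = 7" | "i = 8" | "i = 9"
proof -
  have "i = 1 \<or> i = 2 \<or> i = 3 \<or> i = 4 \<or> i = 5 \<or> i = 6 \<or> i = 7 \<or> i = 8 \<or> i = 9"
    using assms by auto
  with that show thesis by blast
qed

lemma is_polynomial_trace_invariant:
  assumes "i \<in> {1..9}"
  shows "is_polynomial (trace_invariant i)"
proof -
  have *: "is_polynomial (\<lambda>Z. trace_invariant i (fst Z, snd Z))"
    using assms
    by (cases rule: index_cases; simp only: trace_invariant_simps;
        intro polynomial_matrix_trace polynomial_matrix_mult polynomial_matrix_traceless
          polynomial_matrix_fst polynomial_matrix_snd)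
  then show ?thesis by simp
qed

lemma trace_conj:
  fixes g :: mat3
  assumes "invertible g"
  shows "trace (g ** M ** matrix_inv g) = trace M"
  by (subst trace_mul_sym) (simp add: matrix_mul_assoc matrix_inv_inverse[OF assms])

lemma traceless_conj:
  fixes g :: mat3
  assumes "invertible g"
  shows "traceless (g ** M ** matrix_inv g) = g ** traceless M ** matrix_inv g"
proof -
  have "g ** mat c = mat c ** g" for c
    by (simp add: vec_eq_iff matrix_matrix_mult_def mat_def if_distrib[of "\<lambda>x. _ * x"] if_distrib[of "\<lambda>x. x * _"]
        sum.delta sum.delta' mult.commute cong: if_cong)
  then have "g ** mat c ** matrix_inv g = mat c" for c
    by (rule conj_eqI[OF assms])
  moreover have "g ** (M - mat c) ** matrix_inv g = g ** M ** matrix_inv g - g ** mat c ** matrix_inv g" for c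
    by (simp add: vec_eq_iff matrix_matrix_mult_def sum_3 algebra_simps)
  ultimately show ?thesis
    unfolding traceless_def trace_conj[OF assms] by simp
qed

lemma trace_invariant_conj:
  assumes "i \<in> {1..9}" "invertible g"
  shows "trace_invariant i (simultaneous_conj g Z) = trace_invariant i Z"
proof -
  obtain X Y where Z: "Z = (X, Y)" by force
  show ?thesis
    unfolding Z using assms(1)
    by (cases rule: index_cases; simp only: simultaneous_conj_def case_prod_conv trace_invariant_simps
        traceless_conj[OF assms(2)] conj_mult[OF assms(2)] trace_conj[OF assms(2)])
qed

section \<open>Diagonal pairs and bivariate power sums\<close>

definition diag_pair :: "(3 \<Rightarrow> complex) \<Rightarrow> (3 \<Rightarrow> complex) \<Rightarrow> mat3 \<times> mat3" where
  "diag_pair x y = (diag3 (x 1) (x 2) (x 3), diag3 (y 1) (y 2) (y 3))"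

lemma diag3_mult: "diag3 a b c ** diag3 d e f = diag3 (a * d) (b * e) (c * f)"
  by (simp add: diag3_def vec_eq_iff forall_3 matrix_matrix_mult_def sum_3)

lemma trace_diag3: "trace (diag3 a b c) = a + b + c"
  by (simp add: diag3_def trace_def sum_3)

lemma traceless_diag3:
  "traceless (diag3 a b c) = diag3 (a - (a + b + c) / 3) (b - (a + b + c) / 3) (c - (a + b + c) / 3)"
  by (simp add: traceless_def trace_diag3) (simp add: diag3_def vec_eq_iff forall_3 mat_def)

lemma diag_pair_commuting: "diag_pair x y \<in> commuting_variety"
  by (simp add: diag_pair_def commuting_variety_def diag3_mult mult.commute)

text \<open>Generation is tested on diagonal pairs only; the passage to all commuting pairs is made
  once, in \<open>invariant_imp_generated\<close>.\<close>

definition generated :: "((3 \<Rightarrow> complex) \<Rightarrow> (3 \<Rightarrow> complex) \<Rightarrow> complex) \<Rightarrow> bool" where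
  "generated F \<longleftrightarrow> (\<exists>P \<in> polys {1..9}. \<forall>x y. F x y = poly_eval P (\<lambda>i. trace_invariant i (diag_pair x y)))"

lemma generated_const: "generated (\<lambda>x y. c)"
  unfolding generated_def by (intro bexI[of _ "single 0 c"]) simp_all

lemma generated_add: "generated F \<Longrightarrow> generated G \<Longrightarrow> generated (\<lambda>x y. F x y + G x y)"
  unfolding generated_def by (metis poly_eval_add polys_add)

lemma generated_diff: "generated F \<Longrightarrow> generated G \<Longrightarrow> generated (\<lambda>x y. F x y - G x y)"
  unfolding generated_def by (metis poly_eval_diff polys_diff)

lemma generated_mult: "generated F \<Longrightarrow> generated G \<Longrightarrow> generated (\<lambda>x y. F x y * G x y)"
  unfolding generated_def by (metis poly_eval_mult polys_mult)

lemma generated_power: "generated F \<Longrightarrow> generated (\<lambda>x y. F x y ^ n)"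
  by (induction n) (simp_all add: generated_const generated_mult)

lemma generated_trace_invariant: "i \<in> {1..9} \<Longrightarrow> generated (\<lambda>x y. trace_invariant i (diag_pair x y))"
  unfolding generated_def by (intro bexI[of _ "var i"]) simp_all

lemmas generated_intros = generated_const generated_add generated_diff generated_mult generated_power

definition power_sum :: "nat \<Rightarrow> nat \<Rightarrow> (3 \<Rightarrow> complex) \<Rightarrow> (3 \<Rightarrow> complex) \<Rightarrow> complex" where
  "power_sum a b x y = (\<Sum>i\<in>UNIV. x i ^ a * y i ^ b)"

text \<open>Binomial expansion about the means \<open>t 1 / 3\<close> and \<open>t 2 / 3\<close>:
  the terms linear in the traceless parts sum to zero, which leaves the trace invariants and the
  powers of the means.\<close>

lemma power_sum_eqs:
  defines "t \<equiv> \<lambda>i x y. trace_invariant i (diag_pair x y)"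
  shows "power_sum 0 0 = (\<lambda>x y. 3)"
    and "power_sum 1 0 = t 1" and "power_sum 0 1 = t 2"
    and "power_sum 2 0 = (\<lambda>x y. t 3 x y + 1/3 * t 1 x y ^ 2)"
    and "power_sum 1 1 = (\<lambda>x y. t 4 x y + 1/3 * (t 1 x y * t 2 x y))"
    and "power_sum 0 2 = (\<lambda>x y. t 5 x y + 1/3 * t 2 x y ^ 2)"
    and "power_sum 3 0 = (\<lambda>x y. t 6 x y + t 1 x y * t 3 x y + 1/9 * t 1 x y ^ 3)"
    and "power_sum 2 1 = (\<lambda>x y. t 7 x y + 2/3 * (t 1 x y * t 4 x y) + 1/3 * (t 2 x y * t 3 x y)
      + 1/9 * (t 1 x y ^ 2 * t 2 x y))"
    and "power_sum 1 2 = (\<lambda>x y. t 8 x y + 2/3 * (t 2 x y * t 4 x y) + 1/3 * (t 1 x y * t 5 x y)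
      + 1/9 * (t 1 x y * t 2 x y ^ 2))"
    and "power_sum 0 3 = (\<lambda>x y. t 9 x y + t 2 x y * t 5 x y + 1/9 * t 2 x y ^ 3)"
proof -
  have t: "t 1 x y = x 1 + x 2 + x 3" "t 2 x y = y 1 + y 2 + y 3" for x y
    by (simp_all add: t_def diag_pair_def trace_invariant_simps trace_diag3)
  define A where "A x i = x i - (x 1 + x 2 + x 3) / 3" for x :: "3 \<Rightarrow> complex" and i
  have x: "x i = A x i + t 1 x y / 3" "y i = A y i + t 2 x y / 3" for x y i
    by (simp_all add: A_def t)
  \<comment> \<open>Eliminating the third entry encodes that the traceless part sums to
    zero.\<close>
  have A3: "A x 3 = - A x 1 - A x 2" for x
    by (simp add: A_def field_simps)
  have T: "t 3 x y = A x 1 ^ 2 + A x 2 ^ 2 + A x 3 ^ 2"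
    "t 4 x y = A x 1 * A y 1 + A x 2 * A y 2 + A x 3 * A y 3"
    "t 5 x y = A y 1 ^ 2 + A y 2 ^ 2 + A y 3 ^ 2"
    "t 6 x y = A x 1 ^ 3 + A x 2 ^ 3 + A x 3 ^ 3"
    "t 7 x y = A x 1 ^ 2 * A y 1 + A x 2 ^ 2 * A y 2 + A x 3 ^ 2 * A y 3"
    "t 8 x y = A x 1 * A y 1 ^ 2 + A x 2 * A y 2 ^ 2 + A x 3 * A y 3 ^ 2"
    "t 9 x y = A y 1 ^ 3 + A y 2 ^ 3 + A y 3 ^ 3" for x y
    unfolding t_def diag_pair_def trace_invariant_simps traceless_diag3 diag3_mult trace_diag3 A_def
    by (simp_all only: power2_eq_square power3_eq_cube mult.assoc)
  have P: "power_sum a b x y = (A x 1 + t 1 x y / 3) ^ a * (A y 1 + t 2 x y / 3) ^ b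
    + (A x 2 + t 1 x y / 3) ^ a * (A y 2 + t 2 x y / 3) ^ b
    + (A x 3 + t 1 x y / 3) ^ a * (A y 3 + t 2 x y / 3) ^ b" for a b x y
    unfolding power_sum_def sum_3 x[symmetric] ..
  show "power_sum 0 0 = (\<lambda>x y. 3)" by (simp add: power_sum_def sum_3 fun_eq_iff)
  show "power_sum 1 0 = t 1" "power_sum 0 1 = t 2"
    by (simp_all add: power_sum_def sum_3 fun_eq_iff t)
  show "power_sum 2 0 = (\<lambda>x y. t 3 x y + 1/3 * t 1 x y ^ 2)"
    by (intro ext, unfold P T A3) (simp add: field_simps power2_eq_square)
  show "power_sum 1 1 = (\<lambda>x y. t 4 x y + 1/3 * (t 1 x y * t 2 x y))"
    by (intro ext, unfold P T A3) (simp add: field_simps)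
  show "power_sum 0 2 = (\<lambda>x y. t 5 x y + 1/3 * t 2 x y ^ 2)"
    by (intro ext, unfold P T A3) (simp add: field_simps power2_eq_square)
  show "power_sum 3 0 = (\<lambda>x y. t 6 x y + t 1 x y * t 3 x y + 1/9 * t 1 x y ^ 3)"
    by (intro ext, unfold P T A3) (simp add: field_simps power2_eq_square power3_eq_cube)
  show "power_sum 2 1 = (\<lambda>x y. t 7 x y + 2/3 * (t 1 x y * t 4 x y) + 1/3 * (t 2 x y * t 3 x y)
      + 1/9 * (t 1 x y ^ 2 * t 2 x y))"
    by (intro ext, unfold P T A3) (simp add: field_simps power2_eq_square)
  show "power_sum 1 2 = (\<lambda>x y. t 8 x y + 2/3 * (t 2 x y * t 4 x y) + 1/3 * (t 1 x y * t 5 x y)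
      + 1/9 * (t 1 x y * t 2 x y ^ 2))"
    by (intro ext, unfold P T A3) (simp add: field_simps power2_eq_square)
  show "power_sum 0 3 = (\<lambda>x y. t 9 x y + t 2 x y * t 5 x y + 1/9 * t 2 x y ^ 3)"
    by (intro ext, unfold P T A3) (simp add: field_simps power2_eq_square power3_eq_cube)
qed

text \<open>Inclusion-exclusion for the sum of \<open>x\<^sub>i x\<^sub>j y\<^sub>k y\<^sub>l\<close> over distinct indices, which is empty because there are
  only three indices.\<close>

lemma power_sum_2_2:
  "power_sum 2 2 = (\<lambda>x y. 1/6 * (power_sum 1 0 x y ^ 2 * power_sum 0 1 x y ^ 2
    - (power_sum 2 0 x y * power_sum 0 1 x y ^ 2 + power_sum 0 2 x y * power_sum 1 0 x y ^ 2
      + 4 * (power_sum 1 1 x y * (power_sum 1 0 x y * power_sum 0 1 x y)))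
    + (power_sum 2 0 x y * power_sum 0 2 x y + 2 * power_sum 1 1 x y ^ 2)
    + (4 * (power_sum 2 1 x y * power_sum 0 1 x y) + 4 * (power_sum 1 2 x y * power_sum 1 0 x y))))"
  by (intro ext) (simp add: power_sum_def sum_3 power2_eq_square algebra_simps)

text \<open>These exponents are the base cases of the Newton recursions in both variables; among
  them only \<open>power_sum 2 2\<close> has degree above 3.\<close>

lemma generated_power_sum_low:
  assumes "a \<le> 2" "b \<le> 2"
  shows "generated (power_sum a b)"
proof -
  have low: "generated (power_sum 0 0)" "generated (power_sum 1 0)" "generated (power_sum 0 1)"
    "generated (power_sum 2 0)" "generated (power_sum 1 1)" "generated (power_sum 0 2)"
    "generated (power_sum 2 1)" "generated (power_sum 1 2)"
    unfolding power_sum_eqs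
    by (intro generated_intros generated_trace_invariant; simp)+
  moreover have "generated (power_sum 2 2)"
    unfolding power_sum_2_2 by (intro generated_intros low)
  moreover have "a = 0 \<or> a = 1 \<or> a = 2" "b = 0 \<or> b = 1 \<or> b = 2" using assms by auto
  ultimately show ?thesis by auto
qed

lemma generated_power_sum_3: "generated (power_sum 3 0)" "generated (power_sum 0 3)"
  unfolding power_sum_eqs
  by (intro generated_intros generated_trace_invariant; simp)+

text \<open>Each \<open>x i\<close> is a root of the cubic whose coefficients are the elementary
  symmetric functions, here written in power sums; multiplication by \<open>x i ^ n\<close> gives
  the recursion.\<close>

lemma cubic_newton:
  fixes x :: "3 \<Rightarrow> complex"
  shows "x i ^ (n + 3) = (x 1 + x 2 + x 3) * x i ^ (n + 2)
    - 1/2 * ((x 1 + x 2 + x 3) ^ 2 - (x 1 ^ 2 + x 2 ^ 2 + x 3 ^ 2)) * x i ^ (n + 1)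
    + 1/6 * ((x 1 + x 2 + x 3) ^ 3 - 3 * ((x 1 + x 2 + x 3) * (x 1 ^ 2 + x 2 ^ 2 + x 3 ^ 2))
      + 2 * (x 1 ^ 3 + x 2 ^ 3 + x 3 ^ 3)) * x i ^ n"
proof -
  have "x i ^ 3 = (x 1 + x 2 + x 3) * x i ^ 2
    - 1/2 * ((x 1 + x 2 + x 3) ^ 2 - (x 1 ^ 2 + x 2 ^ 2 + x 3 ^ 2)) * x i
    + 1/6 * ((x 1 + x 2 + x 3) ^ 3 - 3 * ((x 1 + x 2 + x 3) * (x 1 ^ 2 + x 2 ^ 2 + x 3 ^ 2))
      + 2 * (x 1 ^ 3 + x 2 ^ 3 + x 3 ^ 3))" (is "_ = ?e1 * _ - ?e2 * _ + ?e3")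
    using exhaust_3[of i] by (elim disjE) (simp_all add: field_simps power2_eq_square power3_eq_cube)
  then have "x i ^ n * x i ^ 3 = x i ^ n * (?e1 * x i ^ 2 - ?e2 * x i + ?e3)"
    by (simp only:)
  then show ?thesis
    by (simp only: power_add distrib_left right_diff_distrib power_one_right ac_simps)
qed

lemma power_sum_newton:
  "power_sum (n + 3) b = (\<lambda>x y. power_sum 1 0 x y * power_sum (n + 2) b x y
    - 1/2 * (power_sum 1 0 x y ^ 2 - power_sum 2 0 x y) * power_sum (n + 1) b x y
    + 1/6 * (power_sum 1 0 x y ^ 3 - 3 * (power_sum 1 0 x y * power_sum 2 0 x y) + 2 * power_sum 3 0 x y)
      * power_sum n b x y)"
proof (intro ext)
  fix x y
  show "power_sum (n + 3) b x y = power_sum 1 0 x y * power_sum (n + 2) b x y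
    - 1/2 * (power_sum 1 0 x y ^ 2 - power_sum 2 0 x y) * power_sum (n + 1) b x y
    + 1/6 * (power_sum 1 0 x y ^ 3 - 3 * (power_sum 1 0 x y * power_sum 2 0 x y) + 2 * power_sum 3 0 x y)
      * power_sum n b x y"
    unfolding power_sum_def cubic_newton[of x _ n]
    by (simp add: sum_distrib_left sum.distrib sum_subtractf distrib_right left_diff_distrib mult.assoc
        sum_3[of "\<lambda>i. x i"] sum_3[of "\<lambda>i. x i ^ 2"] sum_3[of "\<lambda>i. x i ^ 3"])
qed

lemma power_sum_newton':
  "power_sum b (n + 3) = (\<lambda>x y. power_sum 0 1 x y * power_sum b (n + 2) x y
    - 1/2 * (power_sum 0 1 x y ^ 2 - power_sum 0 2 x y) * power_sum b (n + 1) x y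
    + 1/6 * (power_sum 0 1 x y ^ 3 - 3 * (power_sum 0 1 x y * power_sum 0 2 x y) + 2 * power_sum 0 3 x y)
      * power_sum b n x y)"
proof (intro ext)
  fix x y
  have swap: "power_sum a b x y = power_sum b a y x" for a b
    by (simp add: power_sum_def mult.commute)
  show "power_sum b (n + 3) x y = power_sum 0 1 x y * power_sum b (n + 2) x y
    - 1/2 * (power_sum 0 1 x y ^ 2 - power_sum 0 2 x y) * power_sum b (n + 1) x y
    + 1/6 * (power_sum 0 1 x y ^ 3 - 3 * (power_sum 0 1 x y * power_sum 0 2 x y) + 2 * power_sum 0 3 x y)
      * power_sum b n x y"
    unfolding swap[of _ "_ + _"] swap[of 0] swap[of b n] power_sum_newton[of n b] ..
qed

lemma three_step_induct:
  assumes "\<And>n. n \<le> 2 \<Longrightarrow> P n" "\<And>n. P n \<Longrightarrow> P (n + 1) \<Longrightarrow> P (n + 2) \<Longrightarrow> P (n + 3)"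
  shows "P (n::nat)"
proof (induction n rule: less_induct)
  case (less n)
  show ?case
  proof (cases "n \<le> 2")
    case False
    then obtain m where "n = m + 3" by (metis add.commute le_Suc_ex not_less_eq_eq numeral_2_eq_2 numeral_3_eq_3)
    then show ?thesis using assms(2)[of m] less by simp
  qed (rule assms(1))
qed

text \<open>The exponent of \<open>x\<close> is lowered while that of \<open>y\<close> is at most 2.
  Once every exponent of \<open>x\<close> is covered, the exponent of \<open>y\<close> is
  lowered.\<close>

lemma generated_power_sum: "generated (power_sum a b)"
proof -
  have "generated (power_sum a b)" if "b \<le> 2" for a b
  proof (induction a rule: three_step_induct)
    case (1 n)
    with that show ?case by (rule generated_power_sum_low[rotated])
  next
    case (2 n)
    show ?case unfolding power_sum_newton
      by (intro generated_intros 2 generated_power_sum_low generated_power_sum_3) simp_all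
  qed
  then show ?thesis
  proof (induction b rule: three_step_induct)
    case (2 n)
    show ?case unfolding power_sum_newton'
      by (intro generated_intros 2 generated_power_sum_low generated_power_sum_3) (simp_all add: 2)
  qed
qed

section \<open>Symmetrization over the permutations of three indices\<close>

definition perm3 :: "3 \<Rightarrow> 3 \<Rightarrow> 3 \<Rightarrow> 3 \<Rightarrow> 3" where
  "perm3 i j k n = (if n = 1 then i else if n = 2 then j else k)"

lemma perm3_simps [simp]: "perm3 i j k 1 = i" "perm3 i j k 2 = j" "perm3 i j k 3 = k"
  by (simp_all add: perm3_def)

definition distinct_triples :: "(3 \<times> 3 \<times> 3) list" where
  "distinct_triples = [(1, 2, 3), (1, 3, 2), (2, 1, 3), (2, 3, 1), (3, 1, 2), (3, 2, 1)]"

definition symmetrize ::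
  "((3 \<Rightarrow> complex) \<Rightarrow> (3 \<Rightarrow> complex) \<Rightarrow> complex) \<Rightarrow> (3 \<Rightarrow> complex) \<Rightarrow> (3 \<Rightarrow> complex) \<Rightarrow> complex" where
  "symmetrize F x y = (\<Sum>(i, j, k)\<leftarrow>distinct_triples. F (x \<circ> perm3 i j k) (y \<circ> perm3 i j k))"

text \<open>Inclusion-exclusion over coincident indices; the coefficients -1 and 2 are the Moebius
  numbers of the partitions of three indices.\<close>

lemma sum_distinct_triples:
  fixes f g h :: "3 \<Rightarrow> complex"
  shows "(\<Sum>(i, j, k)\<leftarrow>distinct_triples. f i * g j * h k) =
    sum f UNIV * sum g UNIV * sum h UNIV - (\<Sum>i\<in>UNIV. f i * g i) * sum h UNIV
      - (\<Sum>i\<in>UNIV. f i * h i) * sum g UNIV - (\<Sum>i\<in>UNIV. g i * h i) * sum f UNIV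
      + 2 * (\<Sum>i\<in>UNIV. f i * g i * h i)"
  by (simp add: distinct_triples_def sum_3 algebra_simps)

text \<open>A monomial in the diagonal entries is a product of three functions of one index each, so
  \<open>sum_distinct_triples\<close> expresses its symmetrization in power sums.\<close>

lemma generated_symmetrize_monomial:
  "generated (symmetrize (\<lambda>x y. \<Prod>i\<in>UNIV. x i ^ a i * y i ^ b i))"
proof -
  have prod3: "prod F (UNIV :: 3 set) = F 1 * F 2 * F 3" for F :: "3 \<Rightarrow> complex"
    unfolding UNIV_3 by (simp add: mult.assoc)
  have fg: "(\<Sum>i\<in>UNIV. (x i ^ a * y i ^ b) * (x i ^ a' * y i ^ b')) = power_sum (a + a') (b + b') x y"
    "(\<Sum>i\<in>UNIV. (x i ^ a * y i ^ b) * (x i ^ a' * y i ^ b') * (x i ^ a'' * y i ^ b'')) =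
      power_sum (a + a' + a'') (b + b' + b'') x y" for a b a' b' a'' b'' x y
    by (simp_all add: power_sum_def power_add ac_simps)
  have "symmetrize (\<lambda>x y. \<Prod>i\<in>UNIV. x i ^ a i * y i ^ b i) = (\<lambda>x y.
    power_sum (a 1) (b 1) x y * power_sum (a 2) (b 2) x y * power_sum (a 3) (b 3) x y
    - power_sum (a 1 + a 2) (b 1 + b 2) x y * power_sum (a 3) (b 3) x y
    - power_sum (a 1 + a 3) (b 1 + b 3) x y * power_sum (a 2) (b 2) x y
    - power_sum (a 2 + a 3) (b 2 + b 3) x y * power_sum (a 1) (b 1) x y
    + 2 * power_sum (a 1 + a 2 + a 3) (b 1 + b 2 + b 3) x y)"
    unfolding symmetrize_def prod3 comp_def perm3_simps
      sum_distinct_triples[of "\<lambda>i. _ i ^ _ * _ i ^ _" "\<lambda>i. _ i ^ _ * _ i ^ _" "\<lambda>i. _ i ^ _ * _ i ^ _"]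
      fg power_sum_def[symmetric] ..
  then show ?thesis
    by (simp only:) (intro generated_intros generated_power_sum)
qed

text \<open>Off-diagonal coordinates vanish on diagonal pairs; a monomial that contains one of them
  is covered by \<open>c = 0\<close>.\<close>

lemma monomial_on_diag:
  "\<exists>c a b. \<forall>x y. monom_eval (entry (diag_pair x y)) m = c * (\<Prod>i\<in>UNIV. x i ^ a i * y i ^ b i)"
proof (induction m rule: monomial_induct)
  case zero
  show ?case by (intro exI[of _ 1] exI[of _ "\<lambda>_. 0"]) simp
next
  case (add k m)
  then obtain c a b where m: "monom_eval (entry (diag_pair x y)) m = c * (\<Prod>i\<in>UNIV. x i ^ a i * y i ^ b i)" for x y
    by blast
  have step: "u n * (\<Prod>i\<in>UNIV. F i) = (\<Prod>i\<in>UNIV. (if i = n then u n else 1) * F i)" for n :: 3 and u F :: "3 \<Rightarrow> complex"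
    by (simp add: prod.distrib)
  have "\<exists>c a b. \<forall>x y. entry (diag_pair x y) k * (\<Prod>i\<in>UNIV. x i ^ a' i * y i ^ b' i) = c * (\<Prod>i\<in>UNIV. x i ^ a i * y i ^ b i)"
    for a' b'
  proof -
    have "(\<exists>n. \<forall>x y. entry (diag_pair x y) k = x n) \<or> (\<exists>n. \<forall>x y. entry (diag_pair x y) k = y n)
      \<or> (\<forall>x y. entry (diag_pair x y) k = 0)"
    proof -
      have d: "diag3 (x 1) (x 2) (x 3) $ i $ j = (if i = j then x i else 0)" for x i j
        using exhaust_3[of i] exhaust_3[of j] by (auto simp: diag3_def)
      show ?thesis
      proof (cases k)
        case (Inl ij)
        obtain i j where "ij = (i, j)" by force
        then have "entry (diag_pair x y) k = (if i = j then x i else 0)" for x y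
          by (simp add: Inl diag_pair_def d)
        then show ?thesis by (cases "i = j") auto
      next
        case (Inr ij)
        obtain i j where "ij = (i, j)" by force
        then have "entry (diag_pair x y) k = (if i = j then y i else 0)" for x y
          by (simp add: Inr diag_pair_def d)
        then show ?thesis by (cases "i = j") auto
      qed
    qed
    then consider n where "\<And>x y. entry (diag_pair x y) k = x n" | n where "\<And>x y. entry (diag_pair x y) k = y n"
      | "\<And>x y. entry (diag_pair x y) k = 0" by blast
    then show ?thesis
    proof cases
      case 1
      show ?thesis unfolding 1 step
        by (rule exI[of _ 1], rule exI[of _ "\<lambda>i. if i = n then Suc (a' i) else a' i"], rule exI[of _ b'])
          (auto intro!: prod.cong)
    next
      case 2
      show ?thesis unfolding 2 step
        by (rule exI[of _ 1], rule exI[of _ a'], rule exI[of _ "\<lambda>i. if i = n then Suc (b' i) else b' i"])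
          (auto intro!: prod.cong)
    next
      case 3
      show ?thesis unfolding 3 by (intro exI[of _ 0]) simp
    qed
  qed
  then obtain c' a' b' where "entry (diag_pair x y) k * (\<Prod>i\<in>UNIV. x i ^ a i * y i ^ b i) = c' * (\<Prod>i\<in>UNIV. x i ^ a' i * y i ^ b' i)" for x y
    by blast
  then have "monom_eval (entry (diag_pair x y)) (single k 1 + m) = (c * c') * (\<Prod>i\<in>UNIV. x i ^ a' i * y i ^ b' i)" for x y
    unfolding monom_eval_add m by simp
  then show ?case by blast
qed

lemma symmetrize_add: "symmetrize (\<lambda>x y. F x y + G x y) = (\<lambda>x y. symmetrize F x y + symmetrize G x y)"
  by (intro ext) (simp add: symmetrize_def distinct_triples_def)

lemma symmetrize_scale: "symmetrize (\<lambda>x y. c * F x y) = (\<lambda>x y. c * symmetrize F x y)"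
  by (intro ext) (simp add: symmetrize_def distinct_triples_def distrib_left)

lemma generated_symmetrize: "generated (symmetrize (\<lambda>x y. poly_eval p (entry (diag_pair x y))))"
proof (induction p rule: poly_mapping_add_induct)
  case zero
  show ?case by (simp add: symmetrize_def distinct_triples_def generated_const)
next
  case (add m c p)
  obtain c' a b where "\<And>x y. monom_eval (entry (diag_pair x y)) m = c' * (\<Prod>i\<in>UNIV. x i ^ a i * y i ^ b i)"
    using monomial_on_diag by blast
  then have "symmetrize (\<lambda>x y. poly_eval (single m c) (entry (diag_pair x y))) =
    (\<lambda>x y. c * (c' * symmetrize (\<lambda>x y. \<Prod>i\<in>UNIV. x i ^ a i * y i ^ b i) x y))"
    by (simp only: poly_eval_single symmetrize_scale)
  then have "generated (symmetrize (\<lambda>x y. poly_eval (single m c) (entry (diag_pair x y))))"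
    by (simp only:) (intro generated_intros generated_symmetrize_monomial)
  with add.IH show ?case
    unfolding poly_eval_add symmetrize_add by (intro generated_add)
qed

lemma diag_pair_permute:
  assumes "(i, j, k) \<in> set distinct_triples"
  obtains g where "invertible g" "\<And>x y. simultaneous_conj g (diag_pair x y) = diag_pair (x \<circ> perm3 i j k) (y \<circ> perm3 i j k)"
proof -
  define g :: mat3 where "g = (\<chi> n m. if m = perm3 i j k n then 1 else 0)"
  have inv: "invertible g"
    using assms by (intro invertibleI_ker)
      (auto simp: g_def distinct_triples_def matrix_vector_mult_def vec_eq_iff forall_3 sum_3)
  have "g ** diag3 (x 1) (x 2) (x 3) = diag3 (x i) (x j) (x k) ** g" for x
    using assms
    by (auto simp: g_def distinct_triples_def matrix_matrix_mult_def diag3_def vec_eq_iff forall_3 sum_3)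
  from conj_eqI[OF inv this] inv that show thesis
    by (simp add: simultaneous_conj_def diag_pair_def)
qed

theorem invariant_imp_generated:
  assumes "invariant_on_commuting (\<lambda>Z. poly_eval p (entry Z))"
  obtains P where "P \<in> polys {1..9}"
    "\<And>Z. Z \<in> commuting_variety \<Longrightarrow> poly_eval p (entry Z) = poly_eval P (\<lambda>i. trace_invariant i Z)"
proof -
  let ?F = "\<lambda>x y. poly_eval p (entry (diag_pair x y))"
  have perm: "?F (x \<circ> perm3 i j k) (y \<circ> perm3 i j k) = ?F x y" if ijk: "(i, j, k) \<in> set distinct_triples" for i j k x y
  proof -
    obtain g where "invertible g" "simultaneous_conj g (diag_pair x y) = diag_pair (x \<circ> perm3 i j k) (y \<circ> perm3 i j k)"
      using diag_pair_permute[OF ijk] by metis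
    then show ?thesis
      using assms diag_pair_commuting[of x y] unfolding invariant_on_commuting_def by metis
  qed
  \<comment> \<open>By invariance all six summands are equal, so \<open>?F\<close> is recovered by
    the Reynolds operator, the symmetrization divided by 6.\<close>
  have "symmetrize ?F x y = 6 * ?F x y" for x y
    unfolding symmetrize_def by (simp add: distinct_triples_def perm[unfolded distinct_triples_def])
  then have "?F = (\<lambda>x y. 1/6 * symmetrize ?F x y)" by (simp add: fun_eq_iff)
  moreover have "generated (\<lambda>x y. 1/6 * symmetrize ?F x y)"
    by (intro generated_intros generated_symmetrize)
  ultimately have "generated ?F" by (simp only:)
  then obtain P where P: "P \<in> polys {1..9}"
    "\<And>x y. ?F x y = poly_eval P (\<lambda>i. trace_invariant i (diag_pair x y))"
    unfolding generated_def by blast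
  have "is_polynomial (\<lambda>Z. poly_eval P (\<lambda>i. trace_invariant i Z))"
    using P(1)
    by (induction P rule: polys_induct)
      (auto intro!: is_polynomial_const is_polynomial_add is_polynomial_mult is_polynomial_trace_invariant)
  \<comment> \<open>Written as a polynomial \<open>q\<close> in the entries, the right hand side can
    be degenerated like \<open>p\<close>. Both agree at the diagonal pair and hence at
    \<open>Z\<close>.\<close>
  then obtain q where q: "\<And>Z. poly_eval P (\<lambda>i. trace_invariant i Z) = poly_eval q (entry Z)"
    unfolding is_polynomial_def by blast
  have inv_q: "invariant_on_commuting (\<lambda>Z. poly_eval q (entry Z))"
    unfolding invariant_on_commuting_def q[symmetric]
    using P(1) trace_invariant_conj by (intro allI impI poly_eval_cong[of P "{1..9}"])
  have "poly_eval p (entry Z) = poly_eval P (\<lambda>i. trace_invariant i Z)" if Z: "Z \<in> commuting_variety" for Z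
  proof -
    obtain x1 x2 x3 y1 y2 y3 where deg: "\<And>p. invariant_on_commuting (\<lambda>Z. poly_eval p (entry Z)) \<Longrightarrow>
      poly_eval p (entry Z) = poly_eval p (entry (diag3 x1 x2 x3, diag3 y1 y2 y3))"
      using degenerates_to_diagonal[OF Z] by blast
    define x where "x n = (if n = 1 then x1 else if n = 2 then x2 else x3)" for n :: 3
    define y where "y n = (if n = 1 then y1 else if n = 2 then y2 else y3)" for n :: 3
    have xy: "(diag3 x1 x2 x3, diag3 y1 y2 y3) = diag_pair x y"
      by (simp add: diag_pair_def x_def y_def)
    show ?thesis
      using deg[OF assms] deg[OF inv_q] P(2)[of x y] unfolding q xy by simp
  qed
  with P(1) that show thesis by blast
qed

text \<open>For a primitive cube root of unity \<open>w\<close> this is the discrete Fourier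
  expansion of the diagonal entries: \<open>c\<close> is their mean, and \<open>u\<close>,
  \<open>v\<close> describe the traceless part.\<close>

definition fourier_diag :: "complex \<Rightarrow> complex \<Rightarrow> complex \<Rightarrow> complex \<Rightarrow> mat3" where
  "fourier_diag w c u v = diag3 (c + (u + v)) (c + (w * u + w ^ 2 * v)) (c + (w ^ 2 * u + w * v))"

lemma fourier_diag_commuting: "(fourier_diag w c u v, fourier_diag w d r s) \<in> commuting_variety"
  by (simp add: commuting_variety_def fourier_diag_def diag3_mult mult.commute)

lemma fourier_diag_surj:
  assumes w: "w ^ 2 + w + 1 = 0"
  obtains c u v where "diag3 x y z = fourier_diag w c u v"
proof -
  note w3 = cube_root_of_unity_cubed[OF w]
  have w4: "w ^ 2 * w ^ 2 = w" "w ^ 2 * w = 1" "w * w ^ 2 = 1" "w * w = w ^ 2"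
    using w3 by (simp_all add: power2_eq_square power3_eq_cube mult.assoc)
  define c u v where "c = (x + y + z) / 3" "u = (x + w ^ 2 * y + w * z) / 3" "v = (x + w * y + w ^ 2 * z) / 3"
  note cuv = this
  have w2: "w ^ 2 = - 1 - w" using w by (simp add: eq_neg_iff_add_eq_0 algebra_simps)
  have 3: "3 * c = x + y + z" "3 * u = x + w ^ 2 * y + w * z" "3 * v = x + w * y + w ^ 2 * z"
    by (simp_all add: cuv)
  have "3 * (c + (u + v)) = 3 * x"
    unfolding distrib_left 3 w2 by (simp add: algebra_simps)
  moreover have "3 * (c + (w * u + w ^ 2 * v)) = 3 * y"
  proof -
    have "3 * (c + (w * u + w ^ 2 * v)) = 3 * c + w * (3 * u) + w ^ 2 * (3 * v)" by (simp add: algebra_simps)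
    also have "\<dots> = (1 + w + w ^ 2) * x + (1 + w * w ^ 2 + w ^ 2 * w) * y + (1 + w * w + w ^ 2 * w ^ 2) * z"
      unfolding 3 by (simp only: distrib_left distrib_right mult_1_left ac_simps)
    also have "\<dots> = 3 * y" unfolding w4 unfolding w2 by simp
    finally show ?thesis .
  qed
  moreover have "3 * (c + (w ^ 2 * u + w * v)) = 3 * z"
  proof -
    have "3 * (c + (w ^ 2 * u + w * v)) = 3 * c + w ^ 2 * (3 * u) + w * (3 * v)" by (simp add: algebra_simps)
    also have "\<dots> = (1 + w + w ^ 2) * x + (1 + w * w + w ^ 2 * w ^ 2) * y + (1 + w * w ^ 2 + w ^ 2 * w) * z"
      unfolding 3 by (simp only: distrib_left distrib_right mult_1_left ac_simps)
    also have "\<dots> = 3 * z" unfolding w4 unfolding w2 by simp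
    finally show ?thesis .
  qed
  ultimately have "diag3 x y z = fourier_diag w c u v"
    unfolding fourier_diag_def mult_cancel_left by simp
  then show thesis by (rule that)
qed

lemma trace_invariant_fourier:
  assumes w: "w ^ 2 + w + 1 = 0" and i: "i \<in> {1..9}"
  shows "trace_invariant i (fourier_diag w c u v, fourier_diag w d r s) = diag_invariants c d u v r s i"
proof -
  define w' where "w' = w ^ 2"
  note w3 = cube_root_of_unity_cubed[OF w]
  have ww: "w * w' = 1" "w ^ 3 = 1" "w' ^ 3 = 1" "w' ^ 2 = w" "w ^ 2 = w'"
  proof -
    show "w * w' = 1" using w3 by (simp add: w'_def power2_eq_square power3_eq_cube mult.assoc)
    show "w' ^ 3 = 1" unfolding w'_def by (metis mult.commute power_mult power_one w3)
    have "w' ^ 2 = w ^ 3 * w" unfolding w'_def by (simp add: power2_eq_square power3_eq_cube mult.assoc)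
    then show "w' ^ 2 = w" by (simp add: w3)
  qed (simp_all add: w'_def w3)
  have sum0: "1 + w + w' = 0" using w by (simp add: w'_def algebra_simps)
  have ww': "w' * w = 1" using ww(1) by (simp add: mult.commute)
  \<comment> \<open>\<open>lin\<close>, \<open>bil\<close> and \<open>tri\<close> are polarized
    trace formulas for products of one, two and three traceless diagonal matrices. The second covers
    the indices 3 to 5 and the third the indices 6 to 9.\<close>
  have lin: "(a + b) + (w * a + w' * b) + (w' * a + w * b) = 0" for a b
  proof -
    have "(a + b) + (w * a + w' * b) + (w' * a + w * b) = (1 + w + w') * (a + b)"
      by (simp add: algebra_simps)
    then show ?thesis by (simp add: sum0)
  qed
  have bil: "(a + b) * (e + f) + (w * a + w' * b) * (w * e + w' * f) + (w' * a + w * b) * (w' * e + w * f)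
    = 3 * (a * f + b * e)" for a b e f
  proof -
    have *: "(z * a + z' * b) * (z * e + z' * f) = z ^ 2 * (a * e) + z' ^ 2 * (b * f) + (z * z') * (a * f + b * e)" for z z'
      by (simp add: algebra_simps power2_eq_square)
    have "(a + b) * (e + f) + (w * a + w' * b) * (w * e + w' * f) + (w' * a + w * b) * (w' * e + w * f)
      = (1 + w + w') * (a * e + b * f) + 3 * (a * f + b * e)"
      unfolding * ww ww' by (simp add: algebra_simps)
    then show ?thesis by (simp add: sum0)
  qed
  have tri: "(a + b) * (e + f) * (g + h) + (w * a + w' * b) * (w * e + w' * f) * (w * g + w' * h)
    + (w' * a + w * b) * (w' * e + w * f) * (w' * g + w * h) = 3 * (a * e * g + b * f * h)" for a b e f g h
  proof -
    have *: "(z * a + z' * b) * (z * e + z' * f) * (z * g + z' * h) =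
      z ^ 3 * (a * e * g) + z' ^ 3 * (b * f * h)
      + (z * z') * (z * (a * e * h + a * f * g + b * e * g) + z' * (a * f * h + b * e * h + b * f * g))" for z z'
      by (simp add: algebra_simps power3_eq_cube)
    have "(a + b) * (e + f) * (g + h) + (w * a + w' * b) * (w * e + w' * f) * (w * g + w' * h)
      + (w' * a + w * b) * (w' * e + w * f) * (w' * g + w * h)
      = 3 * (a * e * g + b * f * h)
      + (1 + w + w') * ((a * e * h + a * f * g + b * e * g) + (a * f * h + b * e * h + b * f * g))"
      unfolding * ww ww' by (simp add: algebra_simps)
    then show ?thesis by (simp add: sum0)
  qed
  define D where "D = fourier_diag w"
  have D_def: "D c u v = diag3 (c + (u + v)) (c + (w * u + w' * v)) (c + (w' * u + w * v))" for c u v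
    by (simp add: D_def fourier_diag_def w'_def)
  have sum_D: "c + (u + v) + (c + (w * u + w' * v)) + (c + (w' * u + w * v)) = 3 * c" for c u v
    using lin[of u v] by (simp add: algebra_simps)
  have tD: "trace (D c u v) = 3 * c" for c u v
    unfolding D_def trace_diag3 by (rule sum_D)
  have D0: "traceless (D c u v) = diag3 (u + v) (w * u + w' * v) (w' * u + w * v)" for c u v
    unfolding D_def traceless_diag3 sum_D by simp
  have "trace_invariant i (D c u v, D d r s) = diag_invariants c d u v r s i"
    using i
    by (cases rule: index_cases; simp only: trace_invariant_simps tD D0 diag3_mult trace_diag3 bil tri
        diag_invariants_simps power2_eq_square power3_eq_cube) (simp_all add: algebra_simps)
  then show ?thesis by (simp add: \<open>D = fourier_diag w\<close>)
qed

corollary trace_relations_in_Jext: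
  assumes "P \<in> polys {1..9}"
    and "\<And>Z. Z \<in> commuting_variety \<Longrightarrow> poly_eval P (\<lambda>i. trace_invariant i Z) = 0"
  shows "P \<in> Jext"
proof (rule vanishing_on_diag_imp_Jext[OF assms(1)])
  fix c d u v r s
  obtain w :: complex where w: "w ^ 2 + w + 1 = 0"
    using cube_root_of_unity_exists by blast
  have "poly_eval P (diag_invariants c d u v r s) =
      poly_eval P (\<lambda>i. trace_invariant i (fourier_diag w c u v, fourier_diag w d r s))"
    by (rule poly_eval_cong[OF assms(1)]) (simp only: trace_invariant_fourier[OF w])
  then show "poly_eval P (diag_invariants c d u v r s) = 0"
    by (simp only: assms(2)[OF fourier_diag_commuting])
qed

text \<open>Each trace invariant is itself an invariant polynomial, so its value at \<open>Z\<close>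
  is its value at the diagonal pair to which \<open>Z\<close> degenerates.\<close>

lemma trace_invariants_eq_diag_invariants:
  assumes Z: "Z \<in> commuting_variety"
  obtains c d u v r s where "\<And>i. i \<in> {1..9} \<Longrightarrow> trace_invariant i Z = diag_invariants c d u v r s i"
proof -
  obtain w :: complex where w: "w ^ 2 + w + 1 = 0"
    using cube_root_of_unity_exists by blast
  obtain x1 x2 x3 y1 y2 y3 where deg: "\<And>p. invariant_on_commuting (\<lambda>Z. poly_eval p (entry Z)) \<Longrightarrow>
      poly_eval p (entry Z) = poly_eval p (entry (diag3 x1 x2 x3, diag3 y1 y2 y3))"
    using degenerates_to_diagonal[OF Z] by blast
  obtain c u v where x: "diag3 x1 x2 x3 = fourier_diag w c u v" by (rule fourier_diag_surj[OF w])
  obtain d r s where y: "diag3 y1 y2 y3 = fourier_diag w d r s" by (rule fourier_diag_surj[OF w])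
  have "trace_invariant i Z = diag_invariants c d u v r s i" if i: "i \<in> {1..9}" for i
  proof -
    obtain p where p: "\<And>Z. trace_invariant i Z = poly_eval p (entry Z)"
      using is_polynomial_trace_invariant[OF i] unfolding is_polynomial_def by blast
    have "invariant_on_commuting (\<lambda>Z. poly_eval p (entry Z))"
      unfolding invariant_on_commuting_def p[symmetric] using trace_invariant_conj[OF i] by blast
    from deg[OF this] show ?thesis
      unfolding p[symmetric] x y trace_invariant_fourier[OF w i] .
  qed
  then show thesis by (rule that)
qed

lemma Jext_vanishes:
  assumes "P \<in> Jext" "P \<in> polys {1..9}" "Z \<in> commuting_variety"
  shows "poly_eval P (\<lambda>i. trace_invariant i Z) = 0"
proof -
  obtain c d u v r s where "\<And>i. i \<in> {1..9} \<Longrightarrow> trace_invariant i Z = diag_invariants c d u v r s i"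
    using trace_invariants_eq_diag_invariants[OF assms(3)] by blast
  then have "poly_eval P (\<lambda>i. trace_invariant i Z) = poly_eval P (diag_invariants c d u v r s)"
    by (rule poly_eval_cong[OF assms(2)])
  then show ?thesis using Jext_vanishes_on_diag[OF assms(1)] by simp
qed

section \<open>The algebras in the statement\<close>

lemma poly_algebra_simps [simp]:
  "carrier (poly_algebra I) = polys I" "x \<otimes>\<^bsub>poly_algebra I\<^esub> y = x * y" "\<one>\<^bsub>poly_algebra I\<^esub> = 1"
  "x \<oplus>\<^bsub>poly_algebra I\<^esub> y = x + y" "\<zero>\<^bsub>poly_algebra I\<^esub> = 0"
  "c \<odot>\<^bsub>poly_algebra I\<^esub> x = single 0 c * x"
  by (simp_all add: poly_algebra_def polys_def)

lemma poly_algebra_cring: "cring (poly_algebra I)"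
proof (rule cringI)
  show "abelian_group (poly_algebra I)"
  proof (rule abelian_groupI)
    fix x assume "x \<in> carrier (poly_algebra I)"
    then show "\<exists>y \<in> carrier (poly_algebra I). y \<oplus>\<^bsub>poly_algebra I\<^esub> x = \<zero>\<^bsub>poly_algebra I\<^esub>"
      by (intro bexI[of _ "- x"]) (simp_all add: polys_uminus)
  qed (simp_all add: polys_add algebra_simps)
  show "comm_monoid (poly_algebra I)"
    by (rule comm_monoidI) (simp_all add: polys_mult algebra_simps)
qed (simp add: distrib_right)

lemma quotient_algebra_simps:
  "carrier (quotient_algebra A I) = carrier (A Quot I)"
  "mult (quotient_algebra A I) = mult (A Quot I)"
  "one (quotient_algebra A I) = one (A Quot I)"
  "zero (quotient_algebra A I) = zero (A Quot I)"
  "add (quotient_algebra A I) = add (A Quot I)"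
  "c \<odot>\<^bsub>quotient_algebra A I\<^esub> S = (\<Union>x \<in> S. I +>\<^bsub>A\<^esub> (c \<odot>\<^bsub>A\<^esub> x))"
  by (simp_all add: quotient_algebra_def ring.defs module.defs)

lemma ring_iso_quotient_algebra: "ring_iso (quotient_algebra A I) S = ring_iso (A Quot I) S"
  by (simp add: ring_iso_def ring_hom_def quotient_algebra_simps)

lemma comm_monoid_quotient_algebra:
  assumes "cring A" "ideal I A"
  shows "comm_monoid (quotient_algebra A I)"
proof -
  interpret cring "A Quot I"
    by (rule ideal.quotient_is_cring) (fact assms)+
  show ?thesis
    by (rule comm_monoidI, simp_all add: quotient_algebra_simps m_assoc) (rule m_comm)
qed

lemma monoid_algebra_simps:
  "carrier (monoid_algebra M) = {f. keys f \<subseteq> carrier M}"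
  "x \<oplus>\<^bsub>monoid_algebra M\<^esub> y = x + y" "\<zero>\<^bsub>monoid_algebra M\<^esub> = 0"
  "\<one>\<^bsub>monoid_algebra M\<^esub> = single \<one>\<^bsub>M\<^esub> 1"
  "c \<odot>\<^bsub>monoid_algebra M\<^esub> f = Poly_Mapping.map ((*) c) f"
  by (simp_all add: monoid_algebra_def)

section \<open>Free vector spaces and monoid algebras\<close>

lemma lookup_scale: "lookup (Poly_Mapping.map ((*) c) f) k = c * lookup f k" for c :: complex
  by (simp add: map.rep_eq when_def)

lemma scale_single: "Poly_Mapping.map ((*) c) (single k a) = single k (c * a)" for c :: complex
  by (rule poly_mapping_eqI) (simp add: lookup_scale lookup_single when_def)

lemma scale_add:
  "Poly_Mapping.map ((*) c) (f + g) = Poly_Mapping.map ((*) c) f + Poly_Mapping.map ((*) c) g" for c :: complex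
  by (rule poly_mapping_eqI) (simp add: lookup_scale lookup_add distrib_left)

lemma scale_diff:
  "Poly_Mapping.map ((*) c) (f - g) = Poly_Mapping.map ((*) c) f - Poly_Mapping.map ((*) c) g" for c :: complex
  by (rule poly_mapping_eqI) (simp add: lookup_scale lookup_minus right_diff_distrib)

lemma scale_zero: "Poly_Mapping.map ((*) c) 0 = 0" for c :: complex
  by (rule poly_mapping_eqI) (simp add: lookup_scale)

definition linear_ext :: "('k \<Rightarrow> 'l \<Rightarrow>\<^sub>0 complex) \<Rightarrow> ('k \<Rightarrow>\<^sub>0 complex) \<Rightarrow> ('l \<Rightarrow>\<^sub>0 complex)" where
  "linear_ext \<phi> f = (\<Sum>k \<in> keys f. Poly_Mapping.map ((*) (lookup f k)) (\<phi> k))"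

lemma linear_ext_0 [simp]: "linear_ext \<phi> 0 = 0"
  by (simp add: linear_ext_def)

lemma linear_ext_add:
  fixes \<phi> :: "'k \<Rightarrow> 'l \<Rightarrow>\<^sub>0 complex"
  shows "linear_ext \<phi> (f + g) = linear_ext \<phi> f + linear_ext \<phi> g"
proof -
  have "Poly_Mapping.map ((*) (0::complex)) x = 0" for x :: "'l \<Rightarrow>\<^sub>0 complex"
    by (rule poly_mapping_eqI) (simp add: lookup_scale)
  moreover have "Poly_Mapping.map ((*) (a + b)) x = Poly_Mapping.map ((*) a) x + Poly_Mapping.map ((*) b) x"
    for a b :: complex and x :: "'l \<Rightarrow>\<^sub>0 complex"
    by (rule poly_mapping_eqI) (simp add: lookup_scale lookup_add distrib_right)
  ultimately show ?thesis
    unfolding linear_ext_def by (intro setsum_keys_plus_distrib)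
qed

lemma linear_ext_single: "linear_ext \<phi> (single k c) = Poly_Mapping.map ((*) c) (\<phi> k)"
  by (cases "c = 0") (auto simp: linear_ext_def poly_mapping_eq_iff lookup_scale fun_eq_iff)

context
  fixes M :: "'m monoid" (structure)
begin

abbreviation conv :: "('m \<Rightarrow>\<^sub>0 complex) \<Rightarrow> ('m \<Rightarrow>\<^sub>0 complex) \<Rightarrow> ('m \<Rightarrow>\<^sub>0 complex)" where
  "conv f g \<equiv> f \<otimes>\<^bsub>monoid_algebra M\<^esub> g"

text \<open>Reading the double sum as an iterated linear extension makes bilinearity a consequence
  of \<open>linear_ext_add\<close>.\<close>

lemma conv_eq: "conv f g = linear_ext (\<lambda>x. linear_ext (\<lambda>y. single (x \<otimes> y) 1) g) f"
proof -
  have sum: "Poly_Mapping.map ((*) c) (sum F A) = (\<Sum>a\<in>A. Poly_Mapping.map ((*) c) (F a))"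
    for c :: complex and A :: "'m set" and F :: "'m \<Rightarrow> 'm \<Rightarrow>\<^sub>0 complex"
    by (induction A rule: infinite_finite_induct) (simp_all add: scale_zero scale_add)
  show ?thesis
    unfolding linear_ext_def by (simp add: monoid_algebra_def sum scale_single)
qed

lemma conv_add_left: "conv (f + f') g = conv f g + conv f' g"
  by (simp add: conv_eq linear_ext_add)

lemma conv_single_left: "conv (single x c) g = Poly_Mapping.map ((*) c) (linear_ext (\<lambda>y. single (x \<otimes> y) 1) g)"
  by (simp add: conv_eq linear_ext_single)

lemma conv_zero_left: "conv 0 g = 0"
  by (simp add: conv_eq)

lemma conv_single_single: "conv (single x c) (single y d) = single (x \<otimes> y) (c * d)"
  by (simp add: conv_single_left linear_ext_single scale_single)

lemma conv_add_right: "conv f (g + g') = conv f g + conv f g'"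
  by (induction f rule: poly_mapping_add_induct)
    (simp_all add: conv_zero_left conv_add_left conv_single_left linear_ext_add scale_add)

lemma conv_zero_right: "conv f 0 = 0"
  by (induction f rule: poly_mapping_add_induct)
    (simp_all add: conv_zero_left conv_add_left conv_single_left scale_zero)

end

text \<open>The multiplicative axioms are reduced to single elements by induction on supports. The
  monoid laws hold on the carrier only, hence the attention to keys.\<close>

lemma monoid_algebra_ring:
  assumes "monoid M"
  shows "ring (monoid_algebra M)"
proof -
  interpret monoid M by fact
  let ?A = "monoid_algebra M"
  have closed_add: "keys (f + g) \<subseteq> carrier M" if "keys f \<subseteq> carrier M" "keys g \<subseteq> carrier M" for f g :: "'a \<Rightarrow>\<^sub>0 complex"
    using that keys_add[of f g] by blast
  have closed_single: "keys (single k (c :: complex)) \<subseteq> carrier M" if "k \<in> carrier M" for k c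
    using that by (cases "c = 0") simp_all
  note simps = conv_zero_left conv_add_left conv_single_single conv_add_right conv_zero_right
  show ?thesis
  proof (rule ringI)
    show "abelian_group ?A"
    proof (rule abelian_groupI)
      fix x assume "x \<in> carrier ?A"
      then show "\<exists>y \<in> carrier ?A. y \<oplus>\<^bsub>?A\<^esub> x = \<zero>\<^bsub>?A\<^esub>"
        by (intro bexI[of _ "- x"]) (auto simp: monoid_algebra_simps in_keys_iff)
    qed (simp_all add: monoid_algebra_simps closed_add algebra_simps)
    show "monoid ?A"
    proof (rule monoidI)
      fix f g assume f: "f \<in> carrier ?A" and g: "g \<in> carrier ?A"
      show "f \<otimes>\<^bsub>?A\<^esub> g \<in> carrier ?A"
      proof (induction f rule: poly_mapping_add_induct)
        case (add k c f')
        have "single k c \<otimes>\<^bsub>?A\<^esub> g \<in> carrier ?A"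
        proof (induction g rule: poly_mapping_add_induct)
          case (add l d g')
          then have "k \<in> carrier M" "l \<in> carrier M"
            using f g \<open>k \<in> keys f\<close> by (auto simp: monoid_algebra_simps)
          with add.IH show ?case
            unfolding simps monoid_algebra_simps mem_Collect_eq
            by (intro closed_add closed_single m_closed)
        qed (simp add: simps monoid_algebra_simps)
        with add.IH show ?case
          unfolding simps by (simp add: monoid_algebra_simps closed_add)
      qed (simp add: simps monoid_algebra_simps)
      fix h assume h: "h \<in> carrier ?A"
      show "f \<otimes>\<^bsub>?A\<^esub> g \<otimes>\<^bsub>?A\<^esub> h = f \<otimes>\<^bsub>?A\<^esub> (g \<otimes>\<^bsub>?A\<^esub> h)"
      proof (induction f rule: poly_mapping_add_induct)
        case (add k c f')
        have "single k c \<otimes>\<^bsub>?A\<^esub> g \<otimes>\<^bsub>?A\<^esub> h = single k c \<otimes>\<^bsub>?A\<^esub> (g \<otimes>\<^bsub>?A\<^esub> h)"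
        proof (induction g rule: poly_mapping_add_induct)
          case (add l d g')
          have "single k c \<otimes>\<^bsub>?A\<^esub> single l d \<otimes>\<^bsub>?A\<^esub> h = single k c \<otimes>\<^bsub>?A\<^esub> (single l d \<otimes>\<^bsub>?A\<^esub> h)"
          proof (induction h rule: poly_mapping_add_induct)
            case (add m e h')
            have "k \<in> carrier M" "l \<in> carrier M" "m \<in> carrier M"
              using f g h \<open>k \<in> keys f\<close> \<open>l \<in> keys g\<close> \<open>m \<in> keys h\<close> by (auto simp: monoid_algebra_simps)
            with add.IH show ?case by (simp add: simps m_assoc mult.assoc)
          qed (simp add: simps)
          with add.IH show ?case by (simp add: simps)
        qed (simp add: simps)
        with add.IH show ?case by (simp add: simps)
      qed (simp add: simps)
    next
      show "\<one>\<^bsub>?A\<^esub> \<in> carrier ?A" by (simp add: monoid_algebra_simps)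
    next
      fix f assume f: "f \<in> carrier ?A"
      show "\<one>\<^bsub>?A\<^esub> \<otimes>\<^bsub>?A\<^esub> f = f"
      proof (induction f rule: poly_mapping_add_induct)
        case (add k c f')
        then have "k \<in> carrier M" using f by (auto simp: monoid_algebra_simps)
        with add.IH show ?case by (simp add: simps monoid_algebra_simps)
      qed (simp add: simps)
      show "f \<otimes>\<^bsub>?A\<^esub> \<one>\<^bsub>?A\<^esub> = f"
      proof (induction f rule: poly_mapping_add_induct)
        case (add k c f')
        then have "k \<in> carrier M" using f by (auto simp: monoid_algebra_simps)
        with add.IH show ?case by (simp add: simps monoid_algebra_simps)
      qed (simp add: simps)
    qed
  qed (simp_all add: simps monoid_algebra_simps(2))
qed

text \<open>A scalar acts as multiplication by a multiple of the unit, so ideals of the ring are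
  linear subspaces.\<close>

lemma scale_eq_conv:
  assumes "monoid M" "f \<in> carrier (monoid_algebra M)"
  shows "Poly_Mapping.map ((*) c) f = single \<one>\<^bsub>M\<^esub> c \<otimes>\<^bsub>monoid_algebra M\<^esub> f"
proof -
  interpret monoid M by fact
  show ?thesis
  proof (induction f rule: poly_mapping_add_induct)
    case (add k a f')
    then have "k \<in> carrier M" using assms(2) by (auto simp: monoid_algebra_simps)
    with add.IH show ?case by (simp add: conv_add_right conv_single_single scale_add scale_single)
  qed (simp add: conv_zero_right scale_zero)
qed

text \<open>Invariance passes from the restricted function to the polynomial because the commuting
  variety is stable under conjugation.\<close>

lemma git_coordinate_ring_carrier:
  "f \<in> carrier (git_coordinate_ring commuting_variety) \<longleftrightarrow>
    (\<exists>p. f = restrict (\<lambda>Z. poly_eval p (entry Z)) commuting_variety \<and> invariant_on_commuting (\<lambda>Z. poly_eval p (entry Z)))"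
  unfolding git_coordinate_ring_def regular_functions_def invariant_on_commuting_def
  by (auto simp: simultaneous_conj_commute)

lemma git_coordinate_ringI:
  assumes "is_polynomial f" "invariant_on_commuting f"
  shows "restrict f commuting_variety \<in> carrier (git_coordinate_ring commuting_variety)"
proof -
  obtain p where "f = (\<lambda>Z. poly_eval p (entry Z))"
    using assms(1) unfolding is_polynomial_def by blast
  with assms(2) show ?thesis unfolding git_coordinate_ring_carrier by blast
qed

lemma git_coordinate_ringE:
  assumes "f \<in> carrier (git_coordinate_ring commuting_variety)"
  obtains h where "f = restrict h commuting_variety" "is_polynomial h" "invariant_on_commuting h"
  using assms unfolding git_coordinate_ring_carrier is_polynomial_def by blast

lemma git_coordinate_ring_simps:
  "f \<otimes>\<^bsub>git_coordinate_ring V\<^esub> h = (\<lambda>Z\<in>V. f Z * h Z)" "\<one>\<^bsub>git_coordinate_ring V\<^esub> = (\<lambda>Z\<in>V. 1)"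
  "f \<oplus>\<^bsub>git_coordinate_ring V\<^esub> h = (\<lambda>Z\<in>V. f Z + h Z)" "\<zero>\<^bsub>git_coordinate_ring V\<^esub> = (\<lambda>Z\<in>V. 0)"
  "c \<odot>\<^bsub>git_coordinate_ring V\<^esub> f = (\<lambda>Z\<in>V. c * f Z)"
  by (simp_all add: git_coordinate_ring_def)

lemma restrict_binop: "(\<lambda>Z\<in>V. F (restrict f V Z) (restrict h V Z)) = restrict (\<lambda>Z. F (f Z) (h Z)) V"
  by (auto simp: restrict_def fun_eq_iff)

lemma git_coordinate_ring_ring: "ring (git_coordinate_ring commuting_variety)" (is "ring ?G")
proof -
  note simps = git_coordinate_ring_simps
  have const: "(\<lambda>Z\<in>commuting_variety. c) \<in> carrier ?G" for c
    by (rule git_coordinate_ringI) (simp_all add: is_polynomial_const invariant_on_commuting_def)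
  have add: "f \<oplus>\<^bsub>?G\<^esub> h \<in> carrier ?G" if fh: "f \<in> carrier ?G" "h \<in> carrier ?G" for f h
  proof -
    obtain f' where f': "f = restrict f' commuting_variety" "is_polynomial f'" "invariant_on_commuting f'"
      using fh(1) by (rule git_coordinate_ringE)
    obtain h' where h': "h = restrict h' commuting_variety" "is_polynomial h'" "invariant_on_commuting h'"
      using fh(2) by (rule git_coordinate_ringE)
    have "is_polynomial (\<lambda>Z. f' Z + h' Z)" "invariant_on_commuting (\<lambda>Z. f' Z + h' Z)"
      using f' h' by (simp_all add: is_polynomial_add invariant_on_commuting_def)
    then show ?thesis
      unfolding f'(1) h'(1) simps restrict_binop[of "\<lambda>a b. a + b"] by (rule git_coordinate_ringI)
  qed
  have mult: "f \<otimes>\<^bsub>?G\<^esub> h \<in> carrier ?G" if fh: "f \<in> carrier ?G" "h \<in> carrier ?G" for f h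
  proof -
    obtain f' where f': "f = restrict f' commuting_variety" "is_polynomial f'" "invariant_on_commuting f'"
      using fh(1) by (rule git_coordinate_ringE)
    obtain h' where h': "h = restrict h' commuting_variety" "is_polynomial h'" "invariant_on_commuting h'"
      using fh(2) by (rule git_coordinate_ringE)
    have "is_polynomial (\<lambda>Z. f' Z * h' Z)" "invariant_on_commuting (\<lambda>Z. f' Z * h' Z)"
      using f' h' by (simp_all add: is_polynomial_mult invariant_on_commuting_def)
    then show ?thesis
      unfolding f'(1) h'(1) simps restrict_binop[of "\<lambda>a b. a * b"] by (rule git_coordinate_ringI)
  qed
  \<comment> \<open>Elements are extensional, so equality can be checked on commuting pairs
    alone.\<close>
  have undef: "f Z = undefined" if "f \<in> carrier ?G" "Z \<notin> commuting_variety" for f Z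
    using that by (elim git_coordinate_ringE) simp
  have eqI: "f = h" if "f \<in> carrier ?G" "h \<in> carrier ?G" "\<And>Z. Z \<in> commuting_variety \<Longrightarrow> f Z = h Z" for f h
    using that undef by (intro ext) metis
  have one: "\<one>\<^bsub>?G\<^esub> \<in> carrier ?G" and zero: "\<zero>\<^bsub>?G\<^esub> \<in> carrier ?G"
    by (simp_all add: simps const)
  show ?thesis
  proof (rule ringI)
    show "abelian_group ?G"
    proof (rule abelian_groupI)
      fix f assume f: "f \<in> carrier ?G"
      \<comment> \<open>The additive inverse is the product with the constant function -1.\<close>
      show "\<exists>h \<in> carrier ?G. h \<oplus>\<^bsub>?G\<^esub> f = \<zero>\<^bsub>?G\<^esub>"
        by (rule bexI[OF _ mult[OF const[of "- 1"] f]]) (auto simp: simps intro!: restrict_ext)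
      show "\<zero>\<^bsub>?G\<^esub> \<oplus>\<^bsub>?G\<^esub> f = f"
        by (rule eqI[OF add[OF zero f] f]) (simp add: simps)
    qed (auto simp: add zero, auto simp: simps algebra_simps intro!: restrict_ext)
    show "monoid ?G"
    proof (rule monoidI)
      fix f assume f: "f \<in> carrier ?G"
      show "\<one>\<^bsub>?G\<^esub> \<otimes>\<^bsub>?G\<^esub> f = f"
        by (rule eqI[OF mult[OF one f] f]) (simp add: simps)
      show "f \<otimes>\<^bsub>?G\<^esub> \<one>\<^bsub>?G\<^esub> = f"
        by (rule eqI[OF mult[OF f one] f]) (simp add: simps)
    qed (auto simp: mult one, auto simp: simps algebra_simps intro!: restrict_ext)
  qed (auto simp: simps algebra_simps intro!: restrict_ext)
qed

section \<open>The isomorphism\<close>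

abbreviation trace_invariants :: "mat3 \<times> mat3 \<Rightarrow> nat \<Rightarrow> complex" where
  "trace_invariants Z \<equiv> \<lambda>i. trace_invariant i Z"

abbreviation (input) P where "P \<equiv> poly_algebra {1, 2::nat}"
abbreviation (input) R where "R \<equiv> poly_algebra {3..9::nat}"
abbreviation (input) Q where "Q \<equiv> quotient_algebra R J"
abbreviation (input) V where "V \<equiv> commuting_variety"
abbreviation (input) G where "G \<equiv> git_coordinate_ring V"
abbreviation (input) MA where "MA \<equiv> monoid_algebra (P \<times>\<times> Q)"
abbreviation (input) T where "T \<equiv> tensor_ideal P Q"
abbreviation coset where "coset r \<equiv> J +>\<^bsub>R\<^esub> r"
abbreviation monomial :: "('v \<Rightarrow>\<^sub>0 nat) \<Rightarrow> 'v cpoly" where "monomial m \<equiv> single m 1"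

lemma R_ring: "ring R" and P_ring: "ring P"
  using poly_algebra_cring cring.axioms(1) by blast+

lemma polys_parts: "a \<in> polys {1, 2} \<Longrightarrow> a \<in> polys {1..9::nat}" "r \<in> polys {3..9} \<Longrightarrow> r \<in> polys {1..9::nat}"
  using polys_mono[of "{1, 2}" "{1..9::nat}" a] polys_mono[of "{3..9}" "{1..9::nat}" r] by auto

lemma J_generators_polys: "J_generators \<subseteq> polys {3..9}"
  unfolding J_generators_def Let_def by (auto intro!: polys_intros)

definition trace_eval :: "nat cpoly \<Rightarrow> mat3 \<times> mat3 \<Rightarrow> complex" where
  "trace_eval p = restrict (\<lambda>Z. poly_eval p (trace_invariants Z)) V"

lemma trace_eval_closed: "p \<in> polys {1..9} \<Longrightarrow> trace_eval p \<in> carrier G"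
  unfolding trace_eval_def
proof (rule git_coordinate_ringI)
  assume p: "p \<in> polys {1..9}"
  then show "is_polynomial (\<lambda>Z. poly_eval p (trace_invariants Z))"
    by (induction p rule: polys_induct)
      (auto intro!: is_polynomial_const is_polynomial_add is_polynomial_mult is_polynomial_trace_invariant)
  show "invariant_on_commuting (\<lambda>Z. poly_eval p (trace_invariants Z))"
    unfolding invariant_on_commuting_def
    using p trace_invariant_conj by (intro allI impI poly_eval_cong[of p "{1..9}"])
qed

lemma trace_eval_hom: "trace_eval \<in> ring_hom R G"
  by (rule ring_hom_memI)
    (auto simp: polys_parts trace_eval_closed, auto simp: trace_eval_def git_coordinate_ring_simps intro!: restrict_ext)

lemma J_ideal: "ideal J R"
  unfolding J_def by (rule ring.genideal_ideal[OF R_ring]) (simp add: J_generators_polys)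

text \<open>\<open>J\<close> is the least ideal containing the generators, so it suffices that these
  lie in the kernel of the homomorphism \<open>trace_eval\<close>.\<close>

lemma J_vanishes:
  assumes "p \<in> J" "Z \<in> V"
  shows "poly_eval p (trace_invariants Z) = 0"
proof -
  have hom: "ring_hom_ring R G trace_eval"
    by (rule ring_hom_ringI2[OF R_ring git_coordinate_ring_ring trace_eval_hom])
  have "J_generators \<subseteq> a_kernel R G trace_eval"
  proof
    fix g assume g: "g \<in> J_generators"
    then have R: "g \<in> polys {3..9}" using J_generators_polys by blast
    have "poly_eval g (trace_invariants Z) = 0" if "Z \<in> V" for Z
      by (rule Jext_vanishes[OF J_generators_subset_Jext[OF g] polys_parts(2)[OF R] that])
    then have "trace_eval g = \<zero>\<^bsub>G\<^esub>"
      unfolding trace_eval_def git_coordinate_ring_simps by (rule restrict_ext)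
    then show "g \<in> a_kernel R G trace_eval"
      using R by (simp add: a_kernel_def')
  qed
  then have "J \<subseteq> a_kernel R G trace_eval"
    unfolding J_def by (rule ring.genideal_minimal[OF R_ring ring_hom_ring.kernel_is_ideal[OF hom]])
  then have "p \<in> a_kernel R G trace_eval" using assms(1) by (rule subsetD)
  then have "trace_eval p = \<zero>\<^bsub>G\<^esub>" by (simp add: a_kernel_def')
  then have "trace_eval p Z = \<zero>\<^bsub>G\<^esub> Z" by (rule fun_cong)
  then show ?thesis
    using assms(2) by (simp add: trace_eval_def git_coordinate_ring_simps)
qed

lemma J_closed: "0 \<in> J" "p \<in> J \<Longrightarrow> q \<in> J \<Longrightarrow> p + q \<in> J" "r \<in> polys {3..9} \<Longrightarrow> p \<in> J \<Longrightarrow> r * p \<in> J"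
    "p \<in> J \<Longrightarrow> p \<in> polys {3..9}"
proof -
  interpret ideal J R by (rule J_ideal)
  show "0 \<in> J" "p \<in> J \<Longrightarrow> q \<in> J \<Longrightarrow> p + q \<in> J" "r \<in> polys {3..9} \<Longrightarrow> p \<in> J \<Longrightarrow> r * p \<in> J"
    "p \<in> J \<Longrightarrow> p \<in> polys {3..9}"
    using additive_subgroup.zero_closed[OF is_additive_subgroup]
      additive_subgroup.a_closed[OF is_additive_subgroup, of p q] I_l_closed[of p r] Icarr[of p] by simp_all
qed

lemma J_generators_subset_J: "g \<in> J_generators \<Longrightarrow> g \<in> J"
  using ring.genideal_self[OF R_ring, of J_generators] J_generators_polys by (auto simp: J_def)

lemma coset_eq: "coset r = (\<lambda>j. j + r) ` J"
  by (auto simp: a_r_coset_def')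

lemma coset_self: "r \<in> coset r"
  unfolding coset_eq using J_closed(1) by (rule image_eqI[rotated]) simp

lemma coset_cong:
  assumes "r - s \<in> J" "r \<in> polys {3..9}" "s \<in> polys {3..9}"
  shows "coset r = coset s"
proof -
  have *: "coset r \<subseteq> coset s" if "r - s \<in> J" for r s
  proof
    fix x assume "x \<in> coset r"
    then obtain j where "j \<in> J" "x = j + r" by (auto simp: coset_eq)
    then have "j + (r - s) \<in> J" "x = (j + (r - s)) + s" using that J_closed(2) by simp_all
    then show "x \<in> coset s" unfolding coset_eq by blast
  qed
  have "-1 * (r - s) \<in> J" by (rule J_closed(3)) (simp_all add: assms polys_uminus)
  with *[of r s] *[of s r] assms(1) show ?thesis by auto
qed

lemma coset_J: "r \<in> J \<Longrightarrow> coset r = coset 0"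
  by (rule coset_cong) (simp_all add: J_closed)

lemma Q_carrier: "q \<in> carrier Q \<longleftrightarrow> (\<exists>r \<in> polys {3..9}. q = coset r)"
  by (auto simp: quotient_algebra_simps FactRing_def A_RCOSETS_def')

lemma coset_carrier: "r \<in> polys {3..9} \<Longrightarrow> coset r \<in> carrier Q"
  unfolding Q_carrier by blast

lemma coset_ops:
  assumes "r \<in> polys {3..9}" "s \<in> polys {3..9}"
  shows "coset r \<otimes>\<^bsub>Q\<^esub> coset s = coset (r * s)" "coset r \<oplus>\<^bsub>Q\<^esub> coset s = coset (r + s)"
    "\<one>\<^bsub>Q\<^esub> = coset 1" "c \<odot>\<^bsub>Q\<^esub> coset r = coset (single 0 c * r)"
proof -
  have rs: "r \<in> carrier R" "s \<in> carrier R" using assms by simp_all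
  note hom = ideal.rcos_ring_hom[OF J_ideal]
  show "coset r \<otimes>\<^bsub>Q\<^esub> coset s = coset (r * s)" "coset r \<oplus>\<^bsub>Q\<^esub> coset s = coset (r + s)" "\<one>\<^bsub>Q\<^esub> = coset 1"
    unfolding quotient_algebra_simps
    using ring_hom_mult[OF hom rs] ring_hom_add[OF hom rs] ring_hom_one[OF hom]
    by (simp_all only: poly_algebra_simps)
  \<comment> \<open>All representatives give the same coset, so the union that defines the scalar
    action collapses.\<close>
  have "coset (single 0 c * x) = coset (single 0 c * r)" if x: "x \<in> coset r" for x
  proof (rule coset_cong)
    obtain j where j: "j \<in> J" "x = j + r" using x by (auto simp: coset_eq)
    then show "single 0 c * x - single 0 c * r \<in> J"
      using J_closed(3)[of "single 0 c" j] by (simp add: distrib_left)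
    show "single 0 c * x \<in> polys {3..9}" "single 0 c * r \<in> polys {3..9}"
      using j assms(1) by (auto intro!: polys_intros dest: J_closed(4))
  qed
  moreover have "r \<in> coset r" by (rule coset_self)
  ultimately have "(\<Union>x \<in> coset r. coset (single 0 c * x)) = coset (single 0 c * r)" by blast
  then show "c \<odot>\<^bsub>Q\<^esub> coset r = coset (single 0 c * r)"
    by (simp only: quotient_algebra_simps poly_algebra_simps)
qed

text \<open>Choosing a representative makes the map total on sets of polynomials; at commuting pairs
  the value is independent of the choice by \<open>J_vanishes\<close>.\<close>

definition coset_eval :: "nat cpoly set \<Rightarrow> mat3 \<times> mat3 \<Rightarrow> complex" where
  "coset_eval q Z = poly_eval (SOME r. r \<in> q) (trace_invariants Z)"

lemma coset_eval_coset:
  assumes "r \<in> polys {3..9}" "Z \<in> V"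
  shows "coset_eval (coset r) Z = poly_eval r (trace_invariants Z)"
proof -
  have "r \<in> coset r" by (rule coset_self)
  then have "(SOME x. x \<in> coset r) \<in> coset r" by (rule someI)
  then obtain j where "j \<in> J" "(SOME x. x \<in> coset r) = j + r" by (auto simp: coset_eq)
  then show ?thesis by (simp add: coset_eval_def J_vanishes assms)
qed

section \<open>Evaluation on the free vector space of pairs\<close>

lemma PQ_monoid: "monoid (P \<times>\<times> Q)"
proof (rule DirProd_monoid)
  show "monoid P" using P_ring by (rule ring.is_monoid)
  show "monoid Q"
    using comm_monoid_quotient_algebra[OF poly_algebra_cring J_ideal] by (rule comm_monoid.axioms(1))
qed

lemma MA_ring: "ring MA"
  by (rule monoid_algebra_ring[OF PQ_monoid])

lemma MA_carrier_single: "a \<in> polys {1, 2} \<Longrightarrow> q \<in> carrier Q \<Longrightarrow> single (a, q) c \<in> carrier MA"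
  by (cases "c = 0") (simp_all add: monoid_algebra_simps)

lemma MA_carrier_keys:
  assumes "F \<in> carrier MA" "k \<in> keys F"
  obtains a r where "k = (a, coset r)" "a \<in> polys {1, 2}" "r \<in> polys {3..9}"
proof -
  obtain a q where k: "k = (a, q)" by force
  have "k \<in> carrier (P \<times>\<times> Q)" using assms by (auto simp: monoid_algebra_simps)
  then have "a \<in> polys {1, 2}" "q \<in> carrier Q" by (simp_all add: k)
  then show thesis using that k unfolding Q_carrier by blast
qed

text \<open>The linear extension of the map that sends a pair to the product of its two values. As
  functions on the commuting variety, these have kernel exactly \<open>T\<close>
  (\<open>kernel_eq_T\<close>).\<close>

definition eval_pairs :: "(nat cpoly \<times> nat cpoly set \<Rightarrow>\<^sub>0 complex) \<Rightarrow> mat3 \<times> mat3 \<Rightarrow> complex" where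
  "eval_pairs F Z = (\<Sum>k \<in> keys F. lookup F k * (poly_eval (fst k) (trace_invariants Z) * coset_eval (snd k) Z))"

lemma eval_pairs_0 [simp]: "eval_pairs 0 Z = 0"
  by (simp add: eval_pairs_def)

lemma eval_pairs_add: "eval_pairs (F + F') Z = eval_pairs F Z + eval_pairs F' Z"
  unfolding eval_pairs_def by (rule setsum_keys_plus_distrib) (simp_all add: distrib_right)

lemma eval_pairs_diff: "eval_pairs (F - F') Z = eval_pairs F Z - eval_pairs F' Z"
  using eval_pairs_add[of "F - F'" F' Z] by simp

lemma eval_pairs_single:
  assumes "r \<in> polys {3..9}" "Z \<in> V"
  shows "eval_pairs (single (a, coset r) c) Z = c * (poly_eval a (trace_invariants Z) * poly_eval r (trace_invariants Z))"
  using assms by (cases "c = 0") (simp_all add: eval_pairs_def coset_eval_coset)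

lemma eval_pairs_scale: "eval_pairs (Poly_Mapping.map ((*) c) F) Z = c * eval_pairs F Z"
proof (induction F rule: poly_mapping_add_induct)
  case (add k d F)
  have "eval_pairs (single k d) Z = d * (poly_eval (fst k) (trace_invariants Z) * coset_eval (snd k) Z)" for d
    by (cases "d = 0") (simp_all add: eval_pairs_def)
  with add.IH show ?case by (simp add: scale_add scale_single eval_pairs_add distrib_left)
qed (simp add: scale_zero)

lemma eval_pairs_mult:
  assumes "F \<in> carrier MA" "F' \<in> carrier MA" "Z \<in> V"
  shows "eval_pairs (F \<otimes>\<^bsub>MA\<^esub> F') Z = eval_pairs F Z * eval_pairs F' Z"
proof (induction F rule: poly_mapping_add_induct)
  case (add k c F0)
  obtain a r where k: "k = (a, coset r)" "a \<in> polys {1, 2}" "r \<in> polys {3..9}"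
    using MA_carrier_keys[OF assms(1) add(1)] by metis
  have "eval_pairs (single k c \<otimes>\<^bsub>MA\<^esub> F') Z = eval_pairs (single k c) Z * eval_pairs F' Z"
  proof (induction F' rule: poly_mapping_add_induct)
    case (add l d F1)
    obtain b s where l: "l = (b, coset s)" "b \<in> polys {1, 2}" "s \<in> polys {3..9}"
      using MA_carrier_keys[OF assms(2) add(1)] by metis
    have "eval_pairs (single k c \<otimes>\<^bsub>MA\<^esub> single l d) Z = eval_pairs (single k c) Z * eval_pairs (single l d) Z"
      using k l assms(3)
      by (simp add: conv_single_single coset_ops eval_pairs_single polys_mult)
    with add(2) show ?case by (simp add: conv_add_right eval_pairs_add distrib_left)
  qed (simp add: conv_zero_right)
  with add(2) show ?case by (simp add: conv_add_left eval_pairs_add distrib_right)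
qed (simp add: conv_zero_left)

definition tensor_eval :: "(nat cpoly \<times> nat cpoly set \<Rightarrow>\<^sub>0 complex) \<Rightarrow> mat3 \<times> mat3 \<Rightarrow> complex" where
  "tensor_eval F = restrict (eval_pairs F) V"

lemma tensor_eval_add: "tensor_eval (F + F') = tensor_eval F \<oplus>\<^bsub>G\<^esub> tensor_eval F'"
  by (auto simp: tensor_eval_def git_coordinate_ring_simps eval_pairs_add intro!: restrict_ext)

lemma tensor_eval_single: "r \<in> polys {3..9} \<Longrightarrow> tensor_eval (single (a, coset r) c) = trace_eval (single 0 c * (a * r))"
  by (auto simp: tensor_eval_def trace_eval_def eval_pairs_single intro!: restrict_ext)

lemma tensor_eval_closed:
  assumes "F \<in> carrier MA"
  shows "tensor_eval F \<in> carrier G"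
proof (induction F rule: poly_mapping_add_induct)
  case zero
  have "tensor_eval 0 = \<zero>\<^bsub>G\<^esub>" by (auto simp: tensor_eval_def git_coordinate_ring_simps intro!: restrict_ext)
  then show ?case using ring.ring_simprules(2)[OF git_coordinate_ring_ring] by simp
next
  case (add k c F0)
  obtain a r where k: "k = (a, coset r)" "a \<in> polys {1, 2}" "r \<in> polys {3..9}"
    using MA_carrier_keys[OF assms add(1)] by metis
  then have "tensor_eval (single k c) \<in> carrier G"
    by (simp add: tensor_eval_single trace_eval_closed polys_intros polys_parts)
  with add(2) show ?case
    unfolding tensor_eval_add by (intro ring.ring_simprules(1)[OF git_coordinate_ring_ring])
qed

lemma tensor_eval_hom: "tensor_eval \<in> ring_hom MA G"
proof (rule ring_hom_memI)
  fix F F' assume F: "F \<in> carrier MA" "F' \<in> carrier MA"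
  show "tensor_eval F \<in> carrier G" by (rule tensor_eval_closed[OF F(1)])
  show "tensor_eval (F \<otimes>\<^bsub>MA\<^esub> F') = tensor_eval F \<otimes>\<^bsub>G\<^esub> tensor_eval F'"
    using eval_pairs_mult[OF F] by (auto simp: tensor_eval_def git_coordinate_ring_simps intro!: restrict_ext)
  show "tensor_eval (F \<oplus>\<^bsub>MA\<^esub> F') = tensor_eval F \<oplus>\<^bsub>G\<^esub> tensor_eval F'"
    by (simp add: monoid_algebra_simps tensor_eval_add)
next
  have one: "\<one>\<^bsub>MA\<^esub> = single (1, coset 1) 1"
    using coset_ops(3)[of 0 0] by (simp add: monoid_algebra_simps)
  show "tensor_eval \<one>\<^bsub>MA\<^esub> = \<one>\<^bsub>G\<^esub>"
    unfolding one by (simp add: tensor_eval_single) (auto simp: trace_eval_def git_coordinate_ring_simps intro!: restrict_ext)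
qed

interpretation tensor_eval: ring_hom_ring MA G tensor_eval
  by (rule ring_hom_ringI2[OF MA_ring git_coordinate_ring_ring tensor_eval_hom])

section \<open>Computation modulo the bilinearity relations\<close>

lemma tensor_relations_carrier: "tensor_relations P Q \<subseteq> carrier MA"
proof -
  have diff: "F - F' \<in> carrier MA" if "F \<in> carrier MA" "F' \<in> carrier MA" for F F'
    using that keys_diff[of F F'] by (auto simp: monoid_algebra_simps)
  have ex: "\<exists>s \<in> polys {3..9}. coset r = coset s" if "r \<in> polys {3..9}" for r
    using that by blast
  show ?thesis
    unfolding tensor_relations_def Let_def
    by (auto simp: Q_carrier coset_ops intro!: diff MA_carrier_single polys_intros ex)
qed

lemma T_ideal: "ideal T MA"
  unfolding tensor_ideal_def by (rule ring.genideal_ideal[OF MA_ring tensor_relations_carrier])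

lemma tensor_relations_T: "F \<in> tensor_relations P Q \<Longrightarrow> F \<in> T"
  unfolding tensor_ideal_def using ring.genideal_self[OF MA_ring tensor_relations_carrier] by blast

lemma T_closed: "0 \<in> T" "F \<in> T \<Longrightarrow> F' \<in> T \<Longrightarrow> F + F' \<in> T" "F \<in> T \<Longrightarrow> Poly_Mapping.map ((*) c) F \<in> T"
proof -
  interpret ideal T MA by (rule T_ideal)
  show "0 \<in> T" "F \<in> T \<Longrightarrow> F' \<in> T \<Longrightarrow> F + F' \<in> T"
    using additive_subgroup.zero_closed[OF is_additive_subgroup]
      additive_subgroup.a_closed[OF is_additive_subgroup, of F F'] by (simp_all add: monoid_algebra_simps)
  assume F: "F \<in> T"
  have "single \<one>\<^bsub>P \<times>\<times> Q\<^esub> c \<in> carrier MA"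
    using monoid.one_closed[OF PQ_monoid] by (cases "c = 0") (simp_all add: monoid_algebra_simps)
  from I_l_closed[OF F this] show "Poly_Mapping.map ((*) c) F \<in> T"
    using scale_eq_conv[OF PQ_monoid Icarr[OF F]] by simp
qed

definition cong_T (infix "\<approx>" 50) where "F \<approx> F' \<longleftrightarrow> F - F' \<in> T"

lemma cong_T_refl: "F \<approx> F"
  by (simp add: cong_T_def T_closed)

lemma cong_T_add: "F \<approx> F' \<Longrightarrow> H \<approx> H' \<Longrightarrow> F + H \<approx> F' + H'"
  unfolding cong_T_def using T_closed(2)[of "F - F'" "H - H'"] by (simp add: algebra_simps)

lemma cong_T_trans [trans]: "F \<approx> F' \<Longrightarrow> F' \<approx> H \<Longrightarrow> F \<approx> H"
  unfolding cong_T_def using T_closed(2)[of "F - F'" "F' - H"] by simp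

lemma cong_T_scale: "F \<approx> F' \<Longrightarrow> Poly_Mapping.map ((*) c) F \<approx> Poly_Mapping.map ((*) c) F'"
  unfolding cong_T_def scale_diff[symmetric] by (rule T_closed)

lemma cong_T_sym: "F \<approx> F' \<Longrightarrow> F' \<approx> F"
proof -
  assume "F \<approx> F'"
  then have "Poly_Mapping.map ((*) (- 1)) (F - F') \<in> T" unfolding cong_T_def by (rule T_closed)
  also have "Poly_Mapping.map ((*) (- 1)) (F - F') = F' - F"
    by (rule poly_mapping_eqI) (simp add: lookup_scale lookup_minus)
  finally show ?thesis by (simp add: cong_T_def)
qed

lemma cong_T_0: "F \<approx> 0 \<longleftrightarrow> F \<in> T"
  by (simp add: cong_T_def)

lemma tensor_add_left:
  assumes "a \<in> polys {1, 2}" "a' \<in> polys {1, 2}" "q \<in> carrier Q"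
  shows "single (a + a', q) 1 \<approx> single (a, q) 1 + single (a', q) 1"
proof -
  have "single (a \<oplus>\<^bsub>P\<^esub> a', q) 1 - single (a, q) 1 - single (a', q) 1 \<in> tensor_relations P Q"
    unfolding tensor_relations_def Let_def
    by (rule UnI1, rule UnI1, rule UnI1, rule CollectI, intro exI conjI, rule refl)
      (simp_all add: assms coset_carrier)
  from tensor_relations_T[OF this] show ?thesis by (simp add: cong_T_def algebra_simps)
qed

lemma tensor_add_right:
  assumes "a \<in> polys {1, 2}" "r \<in> polys {3..9}" "s \<in> polys {3..9}"
  shows "single (a, coset (r + s)) 1 \<approx> single (a, coset r) 1 + single (a, coset s) 1"
proof -
  have "single (a, coset r \<oplus>\<^bsub>Q\<^esub> coset s) 1 - single (a, coset r) 1 - single (a, coset s) 1 \<in> tensor_relations P Q"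
    unfolding tensor_relations_def Let_def
    by (rule UnI1, rule UnI1, rule UnI2, rule CollectI, intro exI conjI, rule refl)
      (simp_all add: assms coset_carrier)
  from tensor_relations_T[OF this] show ?thesis
    by (simp add: cong_T_def algebra_simps coset_ops(2)[OF assms(2,3)])
qed

lemma tensor_scale_left:
  assumes "a \<in> polys {1, 2}" "q \<in> carrier Q"
  shows "single (single 0 c * a, q) 1 \<approx> single (a, q) c"
proof -
  have "single (c \<odot>\<^bsub>P\<^esub> a, q) 1 - single (a, q) c \<in> tensor_relations P Q"
    unfolding tensor_relations_def Let_def
    by (rule UnI1, rule UnI2, rule CollectI, intro exI conjI, rule refl)
      (simp_all add: assms coset_carrier)
  from tensor_relations_T[OF this] show ?thesis by (simp add: cong_T_def)
qed

lemma tensor_scale_right: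
  assumes "a \<in> polys {1, 2}" "r \<in> polys {3..9}"
  shows "single (a, coset (single 0 c * r)) 1 \<approx> single (a, coset r) c"
proof -
  have "single (a, c \<odot>\<^bsub>Q\<^esub> coset r) 1 - single (a, coset r) c \<in> tensor_relations P Q"
    unfolding tensor_relations_def Let_def
    by (rule UnI2, rule CollectI, intro exI conjI, rule refl)
      (simp_all add: assms coset_carrier)
  from tensor_relations_T[OF this] show ?thesis
    by (simp add: cong_T_def coset_ops(4)[OF assms(2,2)])
qed

text \<open>In the free vector space a pair with a zero entry is still a basis vector; only scaling
  by 0 makes it vanish modulo \<open>T\<close>.\<close>

lemma tensor_zero:
  assumes "a \<in> polys {1, 2}"
  shows "single (a, coset 0) 1 \<approx> 0"
  using tensor_scale_right[OF assms, of 0 0] by simp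

definition monomial_part :: "'v set \<Rightarrow> ('v \<Rightarrow>\<^sub>0 nat) \<Rightarrow> ('v \<Rightarrow>\<^sub>0 nat)" where
  "monomial_part A m = (\<Sum>v \<in> keys m \<inter> A. single v (lookup m v))"

lemma lookup_monomial_part: "lookup (monomial_part A m) v = (if v \<in> A then lookup m v else 0)"
  by (auto simp: monomial_part_def lookup_sum lookup_single when_def sum.delta in_keys_iff)

lemma keys_monomial_part: "keys (monomial_part A m) \<subseteq> A"
  by (auto simp: in_keys_iff lookup_monomial_part split: if_splits)

lemma monomial_part_add:
  assumes "keys k \<subseteq> A" "keys l \<subseteq> B" "A \<inter> B = {}"
  shows "monomial_part A (k + l) = k" "monomial_part B (k + l) = l"
proof -
  have "lookup k v = 0" if "v \<notin> A \<or> v \<in> B" for v using that assms(1,3) by (auto simp: in_keys_iff)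
  moreover have "lookup l v = 0" if "v \<notin> B \<or> v \<in> A" for v using that assms(2,3) by (auto simp: in_keys_iff)
  ultimately show "monomial_part A (k + l) = k" "monomial_part B (k + l) = l"
    by (auto intro!: poly_mapping_eqI simp: lookup_monomial_part lookup_add)
qed

lemma monomial_parts:
  assumes "keys m \<subseteq> A \<union> B" "A \<inter> B = {}"
  shows "monomial_part A m + monomial_part B m = m"
proof (rule poly_mapping_eqI)
  fix v
  show "lookup (monomial_part A m + monomial_part B m) v = lookup m v"
    using assms by (auto simp: lookup_monomial_part lookup_add in_keys_iff)
qed

text \<open>A monomial is cut into its part in the variables 1, 2 and its part in the variables 3 to
  9, and sent to the corresponding pair. This provides normal forms modulo \<open>T\<close> by
  polynomials in nine variables.\<close>

definition to_tensor :: "nat cpoly \<Rightarrow> (nat cpoly \<times> nat cpoly set \<Rightarrow>\<^sub>0 complex)" where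
  "to_tensor = linear_ext (\<lambda>m. single (monomial (monomial_part {1, 2} m), coset (monomial (monomial_part {3..9} m))) 1)"

lemma to_tensor_simps: "to_tensor 0 = 0" "to_tensor (p + q) = to_tensor p + to_tensor q"
  by (simp_all add: to_tensor_def linear_ext_add)

lemma to_tensor_single: "to_tensor (single m c) =
    single (monomial (monomial_part {1, 2} m), coset (monomial (monomial_part {3..9} m))) c"
  by (simp add: to_tensor_def linear_ext_single scale_single)

lemma to_tensor_monomials:
  assumes "keys k \<subseteq> {1, 2}" "keys l \<subseteq> {3..9}"
  shows "to_tensor (single k c * single l d) = single (monomial k, coset (monomial l)) (c * d)"
proof -
  have "{1, 2} \<inter> {3..9::nat} = {}" by auto
  then show ?thesis by (simp add: mult_single to_tensor_single monomial_part_add[OF assms])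
qed

lemma to_tensor_scale: "to_tensor (single 0 c * p) = Poly_Mapping.map ((*) c) (to_tensor p)"
  by (induction p rule: poly_mapping_add_induct)
    (simp_all add: to_tensor_simps scale_zero scale_add distrib_left mult_single to_tensor_single scale_single)

text \<open>Expands the second factor by bilinearity while the first is a monomial;
  \<open>pure_cong_to_tensor\<close> then expands the first factor in the same way.\<close>

lemma pure_cong_to_tensor_monomial:
  assumes k: "keys k \<subseteq> {1, 2}" and "r \<in> polys {3..9}"
  shows "single (monomial k, coset r) 1 \<approx> to_tensor (monomial k * r)"
proof -
  have mk: "monomial k \<in> polys {1, 2}" by (rule polys_single[OF k])
  have "r \<in> polys {3..9} \<and> single (monomial k, coset r) 1 \<approx> to_tensor (monomial k * r)"
  proof (induction r rule: poly_mapping_add_induct)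
    case zero
    show ?case using tensor_zero[OF mk] by (simp add: to_tensor_simps)
  next
    case (add l d r')
    have l: "keys l \<subseteq> {3..9}" using add(1) assms(2) by (auto simp: polys_def)
    have pl: "single l d \<in> polys {3..9}" for d by (rule polys_single[OF l])
    have "single (monomial k, coset (single l d + r')) 1 \<approx>
        single (monomial k, coset (single l d)) 1 + single (monomial k, coset r') 1"
      using add(2) pl by (intro tensor_add_right mk) auto
    also have "\<dots> \<approx> single (monomial k, coset (monomial l)) d + to_tensor (monomial k * r')"
      using tensor_scale_right[OF mk pl[of 1], of d] add(2)
      by (intro cong_T_add) (simp_all add: mult_single)
    also have "\<dots> = to_tensor (monomial k * (single l d + r'))"
      by (simp add: distrib_left to_tensor_simps to_tensor_monomials[OF k l])
    finally show ?case using add(2) pl by (simp add: polys_add)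
  qed
  then show ?thesis ..
qed

lemma pure_cong_to_tensor:
  assumes "a \<in> polys {1, 2}" "r \<in> polys {3..9}"
  shows "single (a, coset r) 1 \<approx> to_tensor (a * r)"
proof -
  note q = coset_carrier[OF assms(2)]
  have "a \<in> polys {1, 2} \<and> single (a, coset r) 1 \<approx> to_tensor (a * r)"
  proof (induction a rule: poly_mapping_add_induct)
    case zero
    have "single (single 0 0 * (0 :: nat cpoly), coset r) 1 \<approx> single (0, coset r) 0"
      by (rule tensor_scale_left) (simp_all add: q)
    then show ?case by (simp add: to_tensor_simps)
  next
    case (add k c a')
    have k: "keys k \<subseteq> {1, 2}" using add(1) assms(1) by (auto simp: polys_def)
    have pk: "single k c \<in> polys {1, 2}" for c by (rule polys_single[OF k])
    have "single (single k c + a', coset r) 1 \<approx> single (single k c, coset r) 1 + single (a', coset r) 1"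
      using add(2) pk q by (intro tensor_add_left) auto
    also have "\<dots> \<approx> Poly_Mapping.map ((*) c) (single (monomial k, coset r) 1) + to_tensor (a' * r)"
      using tensor_scale_left[OF pk[of 1] q, of c] add(2)
      by (intro cong_T_add) (simp_all add: mult_single scale_single)
    also have "\<dots> \<approx> Poly_Mapping.map ((*) c) (to_tensor (monomial k * r)) + to_tensor (a' * r)"
      by (intro cong_T_add cong_T_scale pure_cong_to_tensor_monomial k assms(2) cong_T_refl)
    also have "\<dots> = to_tensor ((single k c + a') * r)"
    proof -
      have "Poly_Mapping.map ((*) c) (to_tensor (monomial k * r)) = to_tensor (single 0 c * monomial k * r)"
        by (simp only: to_tensor_scale mult.assoc)
      also have "single 0 c * monomial k = single k c" by (simp add: mult_single)
      finally show ?thesis by (simp add: distrib_right to_tensor_simps)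
    qed
    finally show ?case using add(2) pk by (simp add: polys_add)
  qed
  then show ?thesis ..
qed

lemma to_tensor_surj:
  assumes "F \<in> carrier MA"
  shows "\<exists>p \<in> polys {1..9}. F \<approx> to_tensor p"
proof (induction F rule: poly_mapping_add_induct)
  case zero
  show ?case by (intro bexI[of _ 0]) (simp_all add: to_tensor_simps cong_T_refl)
next
  case (add k c F')
  then obtain p where p: "p \<in> polys {1..9}" "F' \<approx> to_tensor p" by blast
  obtain a r where k: "k = (a, coset r)" "a \<in> polys {1, 2}" "r \<in> polys {3..9}"
    using MA_carrier_keys[OF assms add(1)] by metis
  have "single k c = Poly_Mapping.map ((*) c) (single (a, coset r) 1)" by (simp add: k scale_single)
  also have "\<dots> \<approx> Poly_Mapping.map ((*) c) (to_tensor (a * r))"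
    by (intro cong_T_scale pure_cong_to_tensor k)
  also have "\<dots> = to_tensor (single 0 c * (a * r))" by (simp only: to_tensor_scale)
  finally have "single k c + F' \<approx> to_tensor (single 0 c * (a * r) + p)"
    unfolding to_tensor_simps by (intro cong_T_add p)
  moreover have "single 0 c * (a * r) + p \<in> polys {1..9}"
    using p polys_parts(1)[OF k(2)] polys_parts(2)[OF k(3)] by (intro polys_intros polys_const)
  ultimately show ?case by blast
qed

lemma monomial_split:
  assumes "keys m \<subseteq> {1..9::nat}"
  shows "single m c = single 0 c * (monomial (monomial_part {1, 2} m) * monomial (monomial_part {3..9} m))"
proof -
  have "{1..9::nat} = {1, 2} \<union> {3..9}" "{1, 2} \<inter> {3..9::nat} = {}" by auto
  with assms have "monomial_part {1, 2} m + monomial_part {3..9} m = m"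
    by (intro monomial_parts) auto
  then show ?thesis by (simp add: mult_single)
qed

text \<open>A monomial multiple of a generator splits as \<open>a * (r * g)\<close> with
  \<open>a\<close> in the first factor and \<open>r * g\<close> in \<open>J\<close>, so the second
  entry of the corresponding tensor is the zero coset.\<close>

lemma to_tensor_Jext:
  assumes "p \<in> Jext"
  shows "to_tensor p \<in> T"
proof -
  obtain h where p: "p = (\<Sum>g \<in> J_generators. h g * g)" "\<forall>g \<in> J_generators. h g \<in> polys {1..9}"
    using assms by (auto simp: ideal_span_def)
  have gen: "to_tensor (h * g) \<in> T" if g: "g \<in> J_generators" and h: "h \<in> polys {1..9}" for h g
  proof (induction h rule: poly_mapping_add_induct)
    case zero
    show ?case by (simp add: to_tensor_simps T_closed)
  next
    case (add m c h')
    have m: "keys m \<subseteq> {1..9}" using add(1) h by (auto simp: polys_def)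
    let ?a = "monomial (monomial_part {1, 2} m)" and ?r = "monomial (monomial_part {3..9} m) * g"
    have a: "?a \<in> polys {1, 2}"
      by (intro polys_single keys_monomial_part)
    have "?r \<in> J"
      by (intro J_closed(3) J_generators_subset_J g polys_single keys_monomial_part)
    note r = this J_closed(4)[OF this]
    have "to_tensor (?a * ?r) \<approx> single (?a, coset ?r) 1" by (rule cong_T_sym[OF pure_cong_to_tensor[OF a r(2)]])
    also have "\<dots> \<approx> 0" unfolding coset_J[OF r(1)] by (rule tensor_zero[OF a])
    finally have "Poly_Mapping.map ((*) c) (to_tensor (?a * ?r)) \<in> T" unfolding cong_T_0 by (rule T_closed)
    also have "Poly_Mapping.map ((*) c) (to_tensor (?a * ?r)) = to_tensor (single m c * g)"
      unfolding to_tensor_scale[symmetric] monomial_split[OF m, of c] by (simp only: mult.assoc)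
    finally show ?case using add(2) by (simp add: distrib_right to_tensor_simps T_closed)
  qed
  have "to_tensor (\<Sum>g \<in> K. h g * g) \<in> T" if "finite K" "K \<subseteq> J_generators" for K
    using that
  proof (induction K rule: finite_induct)
    case (insert g K)
    then have "to_tensor (h g * g) \<in> T" using p(2) by (intro gen) auto
    with insert show ?case by (simp add: to_tensor_simps T_closed)
  qed (simp add: to_tensor_simps T_closed)
  from this[OF finite_J_generators order_refl] show ?thesis unfolding p(1) .
qed

lemma tensor_eval_to_tensor:
  assumes "p \<in> polys {1..9}"
  shows "tensor_eval (to_tensor p) = trace_eval p"
proof -
  have "eval_pairs (to_tensor p) Z = poly_eval p (trace_invariants Z)" if Z: "Z \<in> V" for Z
  proof (induction p rule: poly_mapping_add_induct)
    case zero
    show ?case by (simp add: to_tensor_simps)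
  next
    case (add m c p')
    have m: "keys m \<subseteq> {1..9}" using add(1) assms by (auto simp: polys_def)
    have "eval_pairs (to_tensor (single m c)) Z = poly_eval (single m c) (trace_invariants Z)"
      unfolding to_tensor_single eval_pairs_single[OF polys_single[OF keys_monomial_part] Z]
      by (subst monomial_split[OF m]) simp
    with add(2) show ?case by (simp add: to_tensor_simps eval_pairs_add)
  qed
  then show ?thesis unfolding tensor_eval_def trace_eval_def by (rule restrict_ext)
qed

lemma to_tensor_closed: "p \<in> polys {1..9} \<Longrightarrow> to_tensor p \<in> carrier MA"
proof -
  assume "p \<in> polys {1..9}"
  show ?thesis
  proof (induction p rule: poly_mapping_add_induct)
    case zero
    show ?case by (simp add: to_tensor_simps monoid_algebra_simps)
  next
    case (add m c p')
    have "to_tensor (single m c) \<in> carrier MA"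
      unfolding to_tensor_single by (intro MA_carrier_single coset_carrier polys_single keys_monomial_part)
    with add(2) show ?case
      unfolding to_tensor_simps using ring.ring_simprules(1)[OF MA_ring] by (simp add: monoid_algebra_simps)
  qed
qed

lemma T_subset_kernel: "T \<subseteq> a_kernel MA G tensor_eval"
  unfolding tensor_ideal_def
proof (rule ring.genideal_minimal[OF MA_ring tensor_eval.kernel_is_ideal], rule subsetI)
  fix F assume F: "F \<in> tensor_relations P Q"
  have "eval_pairs F Z = 0" if "Z \<in> V" for Z
    using F that unfolding tensor_relations_def Let_def
    by (auto simp: Q_carrier coset_ops eval_pairs_diff eval_pairs_single polys_add polys_mult
        distrib_left distrib_right)
  then have "tensor_eval F = \<zero>\<^bsub>G\<^esub>"
    unfolding tensor_eval_def git_coordinate_ring_simps by (rule restrict_ext)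
  moreover have "F \<in> carrier MA" using tensor_relations_carrier F by (rule subsetD)
  ultimately show "F \<in> a_kernel MA G tensor_eval"
    unfolding a_kernel_def' by blast
qed

text \<open>Modulo \<open>T\<close> an element of the kernel is some \<open>to_tensor p\<close>.
  Then \<open>p\<close> vanishes at all commuting pairs, hence lies in \<open>Jext\<close>, and
  \<open>to_tensor\<close> maps \<open>Jext\<close> into \<open>T\<close>.\<close>

lemma kernel_eq_T: "a_kernel MA G tensor_eval = T"
proof (intro equalityI T_subset_kernel subsetI)
  fix F assume "F \<in> a_kernel MA G tensor_eval"
  then have F: "F \<in> carrier MA" "tensor_eval F = \<zero>\<^bsub>G\<^esub>" unfolding a_kernel_def' by blast+
  obtain p where p: "p \<in> polys {1..9}" "F \<approx> to_tensor p" using to_tensor_surj[OF F(1)] by blast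
  have "F - to_tensor p \<in> a_kernel MA G tensor_eval" using T_subset_kernel p(2)[unfolded cong_T_def] by (rule subsetD)
  then have "tensor_eval (F - to_tensor p) = \<zero>\<^bsub>G\<^esub>" unfolding a_kernel_def' by blast
  have "poly_eval p (trace_invariants Z) = 0" if Z: "Z \<in> V" for Z
  proof -
    have "tensor_eval F Z = 0" "tensor_eval (F - to_tensor p) Z = 0" "tensor_eval (to_tensor p) Z = poly_eval p (trace_invariants Z)"
      using Z by (simp_all add: F(2) \<open>tensor_eval (F - to_tensor p) = \<zero>\<^bsub>G\<^esub>\<close> tensor_eval_to_tensor[OF p(1)] git_coordinate_ring_simps trace_eval_def)
    then show ?thesis using Z by (simp add: tensor_eval_def eval_pairs_diff)
  qed
  then have "to_tensor p \<in> T" by (intro to_tensor_Jext trace_relations_in_Jext p)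
  with p(2) show "F \<in> T" unfolding cong_T_def using T_closed(2)[of "F - to_tensor p" "to_tensor p"] by simp
qed

lemma tensor_eval_surj: "tensor_eval ` carrier MA = carrier G"
proof (intro equalityI subsetI)
  fix f assume "f \<in> carrier G"
  then obtain p where f: "f = restrict (\<lambda>Z. poly_eval p (entry Z)) V"
    and inv: "invariant_on_commuting (\<lambda>Z. poly_eval p (entry Z))"
    unfolding git_coordinate_ring_carrier by blast
  obtain P' where P': "P' \<in> polys {1..9}" "\<And>Z. Z \<in> V \<Longrightarrow> poly_eval p (entry Z) = poly_eval P' (trace_invariants Z)"
    using invariant_imp_generated[OF inv] by blast
  have "f = tensor_eval (to_tensor P')"
    unfolding tensor_eval_to_tensor[OF P'(1)] f trace_eval_def using P'(2) by (rule restrict_ext)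
  then show "f \<in> tensor_eval ` carrier MA" using to_tensor_closed[OF P'(1)] by blast
qed (auto intro: tensor_eval_closed)

theorem theorem5p3:
  "let R = poly_algebra {3..9::nat};
       P = poly_algebra {1, 2::nat};
       Q = quotient_algebra R J;
       V = commuting_variety
   in \<exists>\<Phi> \<in> algebra_iso (tensor_algebra P Q) (git_coordinate_ring V).
        (\<forall>i \<in> {1, 2}. \<Phi> (pure_tensor P Q (var i) \<one>\<^bsub>Q\<^esub>) = restrict (trace_invariant i) V) \<and>
        (\<forall>i \<in> {3..9}. \<Phi> (pure_tensor P Q \<one>\<^bsub>P\<^esub> (J +>\<^bsub>R\<^esub> var i)) = restrict (trace_invariant i) V)"
proof -
  \<comment> \<open>The map of the first isomorphism theorem: \<open>tensor_eval\<close> is constant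
    on each coset of \<open>T\<close>, and \<open>the_elem\<close> extracts that value.\<close>
  define \<Phi> where "\<Phi> = (\<lambda>X. the_elem (tensor_eval ` X))"
  have coset: "tensor_eval ` (T +>\<^bsub>MA\<^esub> F) = {tensor_eval F}" if F: "F \<in> carrier MA" for F
  proof -
    have "T +>\<^bsub>MA\<^esub> F \<in> carrier (MA Quot a_kernel MA G tensor_eval)"
      using F by (auto simp: FactRing_def A_RCOSETS_def' kernel_eq_T)
    then obtain y where "tensor_eval ` (T +>\<^bsub>MA\<^esub> F) = {y}" using tensor_eval.the_elem_wf by blast
    moreover have "the_elem (tensor_eval ` (T +>\<^bsub>MA\<^esub> F)) = tensor_eval F"
      using tensor_eval.the_elem_simp[OF F] by (simp add: kernel_eq_T)
    ultimately show ?thesis by simp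
  qed
  have iso: "\<Phi> \<in> ring_iso (tensor_algebra P Q) G"
    using tensor_eval.FactRing_iso_set[OF tensor_eval_surj]
    by (simp add: \<Phi>_def tensor_algebra_def ring_iso_quotient_algebra kernel_eq_T)
  \<comment> \<open>The isomorphism theorem concerns rings; compatibility with scalars is checked on
    the union of cosets that defines the scalar action.\<close>
  have smult: "\<Phi> (c \<odot>\<^bsub>tensor_algebra P Q\<^esub> X) = c \<odot>\<^bsub>G\<^esub> \<Phi> X" if X: "X \<in> carrier (tensor_algebra P Q)" for c X
  proof -
    obtain F where F: "F \<in> carrier MA" "X = T +>\<^bsub>MA\<^esub> F"
      using X by (auto simp: tensor_algebra_def quotient_algebra_simps FactRing_def A_RCOSETS_def')
    have sub: "x \<in> carrier MA" if "x \<in> X" for x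
    proof -
      obtain t where t: "t \<in> T" "x = t \<oplus>\<^bsub>MA\<^esub> F"
        using \<open>x \<in> X\<close> unfolding F(2) a_r_coset_def' by blast
      show ?thesis
        unfolding t(2) by (rule ring.ring_simprules(1)[OF MA_ring ideal.Icarr[OF T_ideal t(1)] F(1)])
    qed
    have scale: "Poly_Mapping.map ((*) c) x \<in> carrier MA" if "x \<in> carrier MA" for x
      using that by (auto simp: monoid_algebra_simps in_keys_iff lookup_scale)
    have tensor_evalX: "tensor_eval x = tensor_eval F" if "x \<in> X" for x
      using coset[OF F(1)] that by (auto simp: F(2))
    have "tensor_eval (Poly_Mapping.map ((*) c) x) = c \<odot>\<^bsub>G\<^esub> tensor_eval x" for x
      by (auto simp: tensor_eval_def eval_pairs_scale git_coordinate_ring_simps intro!: restrict_ext)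
    then have "tensor_eval ` (T +>\<^bsub>MA\<^esub> (c \<odot>\<^bsub>MA\<^esub> x)) = {c \<odot>\<^bsub>G\<^esub> tensor_eval F}" if "x \<in> X" for x
      using coset[OF scale, of x] sub that tensor_evalX by (auto simp: monoid_algebra_simps)
    moreover have "X \<noteq> {}" using coset[OF F(1)] F(2) by auto
    ultimately have "tensor_eval ` (c \<odot>\<^bsub>tensor_algebra P Q\<^esub> X) = {c \<odot>\<^bsub>G\<^esub> tensor_eval F}"
      unfolding tensor_algebra_def quotient_algebra_simps image_UN by auto
    then show ?thesis using coset[OF F(1)] by (simp add: \<Phi>_def F(2))
  qed
  have pure: "\<Phi> (pure_tensor P Q a (coset r)) = trace_eval (a * r)"
    if "a \<in> polys {1, 2}" "r \<in> polys {3..9}" for a r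
  proof -
    have "single (a, coset r) 1 \<in> carrier MA" by (intro MA_carrier_single coset_carrier that)
    from coset[OF this] show ?thesis
      unfolding \<Phi>_def pure_tensor_def by (simp add: tensor_eval_single[OF that(2)])
  qed
  have te: "trace_eval (var i) = restrict (trace_invariant i) V" for i
    by (simp add: trace_eval_def)
  have "\<Phi> (pure_tensor P Q (var i) \<one>\<^bsub>Q\<^esub>) = restrict (trace_invariant i) V" if "i \<in> {1, 2}" for i
    using pure[of "var i" 1] that coset_ops(3)[of 0 0] by (simp add: te)
  moreover have "\<Phi> (pure_tensor P Q \<one>\<^bsub>P\<^esub> (coset (var i))) = restrict (trace_invariant i) V" if "i \<in> {3..9}" for i
    using pure[of 1 "var i"] that by (simp add: te)
  moreover have "\<Phi> \<in> algebra_iso (tensor_algebra P Q) G"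
    unfolding algebra_iso_def using iso smult by blast
  ultimately show ?thesis unfolding Let_def by blast
qed

end
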